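(* Let $I = [0,1]$ and let $H_+^{AC} = H_+^{AC}(I)$ with the Polish group topology given by the metric $\rho$. Then $H_+^{AC}$ is generically $2$-generated; that is, the set $$\Omega_2 := \{(f,g) \in H_+^{AC} \times H_+^{AC} : \langle f, g\rangle \text{ is dense in } H_+^{AC}\}$$ is comeagre in $H_+^{AC} \times H_+^{AC}$ with the product topology.
   Context: $H_+(I)$ is the group (under composition) of increasing self-homeomorphisms of $I$. $H_+^{AC}(I)$ is the subgroup of those $f \in H_+(I)$ such that both $f$ and $f^{-1}$ are absolutely continuous on $I$. It is equipped with the topology of the metric $\rho(f,g) := \int_I |f' - g'|\, d\lambda$, where $\lambda$ is Lebesgue measure and $f', g'$ are the almost-everywhere derivatives; this is a Polish group topology on $H_+^{AC}(I)$. $\langle f,g\rangle$ denotes the subgroup generated by $f$ and $g$. A Polish group $G$ is called generically $n$-generated if the set of $n$-tuples in $G^n$ that generate a dense subgroup of $G$ is comeagre in the product topology on $G^n$. *)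

theory Defs
  imports "HOL-Analysis.Analysis" "HOL-Algebra.Bij" "HOL-Algebra.Generated_Groups"
begin

definition abs_cont_on :: "real set \<Rightarrow> (real \<Rightarrow> real) \<Rightarrow> bool" where
  "abs_cont_on S f \<longleftrightarrow>
    (\<forall>\<epsilon>>0. \<exists>\<delta>>0. \<forall>(n::nat) a b.
       (\<forall>i<n. a i < b i \<and> {a i..b i} \<subseteq> S) \<and>
       disjoint_family_on (\<lambda>i. {a i<..<b i}) {..<n} \<and>
       (\<Sum>i<n. b i - a i) < \<delta> \<longrightarrow>
       (\<Sum>i<n. \<bar>f (b i) - f (a i)\<bar>) < \<epsilon>)"

abbreviation I01 :: "real set" where
  "I01 \<equiv> {0..1}"

text \<open>
  An increasing homeomorphism of \<open>[0,1]\<close> is represented by its extensional version, so that equality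
  of group elements is equality on \<open>[0,1]\<close>. All groups are subgroups of \<open>BijGroup I01\<close>,
  whose multiplication is composition.
\<close>

definition H_plus :: "(real \<Rightarrow> real) set" where
  "H_plus = {f \<in> Bij I01. (\<exists>g. homeomorphism I01 I01 f g) \<and> strict_mono_on I01 f}"

definition H_plus_AC :: "(real \<Rightarrow> real) set" where
  "H_plus_AC = {f \<in> H_plus. abs_cont_on I01 f \<and> abs_cont_on I01 (inv_into I01 f)}"

definition H_plus_AC_group :: "(real \<Rightarrow> real) monoid" where
  "H_plus_AC_group = (BijGroup I01) \<lparr>carrier := H_plus_AC\<rparr>"

text \<open>
  Elements of \<open>H_plus_AC\<close> are differentiable almost everywhere on \<open>(0,1)\<close>; on the null
  set where \<^term>\<open>deriv\<close> is not determined (including the endpoints) its value is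
  irrelevant to the integral.
\<close>

definition rho :: "(real \<Rightarrow> real) \<Rightarrow> (real \<Rightarrow> real) \<Rightarrow> real" where
  "rho f g = (LINT x:I01|lebesgue. \<bar>deriv f x - deriv g x\<bar>)"

definition AC_topology :: "(real \<Rightarrow> real) topology" where
  "AC_topology = Metric_space.mtopology H_plus_AC rho"

definition dense_in :: "'a topology \<Rightarrow> 'a set \<Rightarrow> bool" where
  "dense_in X A \<longleftrightarrow> A \<subseteq> topspace X \<and> X closure_of A = topspace X"

definition nowhere_dense_in :: "'a topology \<Rightarrow> 'a set \<Rightarrow> bool" where
  "nowhere_dense_in X A \<longleftrightarrow> A \<subseteq> topspace X \<and> X interior_of (X closure_of A) = {}"

definition meagre_in :: "'a topology \<Rightarrow> 'a set \<Rightarrow> bool" where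
  "meagre_in X A \<longleftrightarrow> (\<exists>\<N>. countable \<N> \<and> (\<forall>N\<in>\<N>. nowhere_dense_in X N) \<and> A = \<Union>\<N>)"

definition comeagre_in :: "'a topology \<Rightarrow> 'a set \<Rightarrow> bool" where
  "comeagre_in X A \<longleftrightarrow> A \<subseteq> topspace X \<and> meagre_in X (topspace X - A)"

definition \<Omega>\<^sub>2 :: "((real \<Rightarrow> real) \<times> (real \<Rightarrow> real)) set" where
  "\<Omega>\<^sub>2 = {(f, g) \<in> H_plus_AC \<times> H_plus_AC.
           dense_in AC_topology (generate H_plus_AC_group {f, g})}"

lemma abs_cont_on_compose:
  assumes f: "abs_cont_on I01 f" and g: "abs_cont_on I01 g"
    and m: "strict_mono_on I01 g" and im: "g ` I01 \<subseteq> I01"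
  shows "abs_cont_on I01 (f \<circ> g)"
  unfolding abs_cont_on_def
proof (intro allI impI)
  fix \<epsilon> :: real assume "\<epsilon> > 0"
  then obtain \<eta> where \<eta>: "\<eta> > 0" and
    H: "\<And>(n::nat) a b. (\<forall>i<n. a i < b i \<and> {a i..b i} \<subseteq> I01) \<Longrightarrow>
       disjoint_family_on (\<lambda>i. {a i<..<b i}) {..<n} \<Longrightarrow> (\<Sum>i<n. b i - a i) < \<eta> \<Longrightarrow>
       (\<Sum>i<n. \<bar>f (b i) - f (a i)\<bar>) < \<epsilon>"
    using f unfolding abs_cont_on_def by meson
  from g \<eta> obtain \<delta> where \<delta>: "\<delta> > 0" and
    G: "\<And>(n::nat) a b. (\<forall>i<n. a i < b i \<and> {a i..b i} \<subseteq> I01) \<Longrightarrow>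
       disjoint_family_on (\<lambda>i. {a i<..<b i}) {..<n} \<Longrightarrow> (\<Sum>i<n. b i - a i) < \<delta> \<Longrightarrow>
       (\<Sum>i<n. \<bar>g (b i) - g (a i)\<bar>) < \<eta>"
    unfolding abs_cont_on_def by meson
  have "(\<Sum>i<n. \<bar>(f \<circ> g) (b i) - (f \<circ> g) (a i)\<bar>) < \<epsilon>"
    if A: "(\<forall>i<n. a i < b i \<and> {a i..b i} \<subseteq> I01) \<and>
       disjoint_family_on (\<lambda>i. {a i<..<b i}) {..<n} \<and> (\<Sum>i<n. b i - a i) < \<delta>"
    for n :: nat and a b :: "nat \<Rightarrow> real"
  proof -
    have ab: "a i < b i" "a i \<in> I01" "b i \<in> I01" if "i < n" for i
      using A that by (auto dest!: spec[of _ i])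
    have gab: "g (a i) < g (b i)" "g (a i) \<in> I01" "g (b i) \<in> I01" if "i < n" for i
      using ab[OF that] im strict_mono_onD[OF m] by blast+
    have "(\<Sum>i<n. g (b i) - g (a i)) = (\<Sum>i<n. \<bar>g (b i) - g (a i)\<bar>)"
      using gab by (intro sum.cong) (auto simp: less_imp_le)
    then have s: "(\<Sum>i<n. g (b i) - g (a i)) < \<eta>"
      using G[of n a b] A by simp
    have mono: "x \<le> y \<Longrightarrow> g x \<le> g y" if "x \<in> I01" "y \<in> I01" for x y
      using strict_mono_on_leD[OF m that] .
    have d: "disjoint_family_on (\<lambda>i. {g (a i)<..<g (b i)}) {..<n}"
      unfolding disjoint_family_on_def
    proof (intro ballI impI)
      fix i j assume ij: "i \<in> {..<n}" "j \<in> {..<n}" "i \<noteq> j"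
      then have "{a i<..<b i} \<inter> {a j<..<b j} = {}"
        using A unfolding disjoint_family_on_def by blast
      then have "b i \<le> a j \<or> b j \<le> a i"
        using ab(1)[of i] ab(1)[of j] ij dense[of "max (a i) (a j)" "min (b i) (b j)"]
        by (simp add: disjoint_iff) (auto simp: min_def max_def split: if_splits)
      then have "g (b i) \<le> g (a j) \<or> g (b j) \<le> g (a i)"
        using mono ab ij by blast
      then show "{g (a i)<..<g (b i)} \<inter> {g (a j)<..<g (b j)} = {}" by auto
    qed
    have gs: "\<forall>i<n. g (a i) < g (b i) \<and> {g (a i)..g (b i)} \<subseteq> I01"
      using gab by (simp add: atLeastatMost_subset_iff)
    show ?thesis using H[OF gs d s] by simp
  qed
  then show "\<exists>\<delta>>0. \<forall>(n::nat) a b.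
       (\<forall>i<n. a i < b i \<and> {a i..b i} \<subseteq> I01) \<and>
       disjoint_family_on (\<lambda>i. {a i<..<b i}) {..<n} \<and>
       (\<Sum>i<n. b i - a i) < \<delta> \<longrightarrow>
       (\<Sum>i<n. \<bar>(f \<circ> g) (b i) - (f \<circ> g) (a i)\<bar>) < \<epsilon>"
    using \<delta> by blast
qed

lemma abs_cont_on_cong:
  assumes "abs_cont_on S f" "\<And>x. x \<in> S \<Longrightarrow> f x = g x"
  shows "abs_cont_on S g"
proof -
  have "(\<Sum>i<n. \<bar>f (b i) - f (a i)\<bar>) = (\<Sum>i<n. \<bar>g (b i) - g (a i)\<bar>)"
    if "\<forall>i<n. a i < b i \<and> {a i..b i} \<subseteq> S" for n :: nat and a b
    using that by (intro sum.cong) (auto simp: assms(2)[symmetric] less_imp_le subset_iff)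
  then show ?thesis using assms(1) unfolding abs_cont_on_def by (simp cong: conj_cong)
qed

lemma H_plus_AC_D:
  assumes "f \<in> H_plus_AC"
  shows "f \<in> Bij I01" "bij_betw f I01 I01" "continuous_on I01 f" "strict_mono_on I01 f"
    "abs_cont_on I01 f" "abs_cont_on I01 (inv_into I01 f)"
  using assms by (auto simp: H_plus_AC_def H_plus_def Bij_def homeomorphism_def)

lemma strict_mono_on_inv_into:
  assumes "bij_betw f I01 I01" "strict_mono_on I01 f"
  shows "strict_mono_on I01 (inv_into I01 f)"
proof (rule strict_mono_onI)
  fix x y :: real assume xy: "x \<in> I01" "y \<in> I01" "x < y"
  have X: "inv_into I01 f x \<in> I01" "f (inv_into I01 f x) = x"
    and Y: "inv_into I01 f y \<in> I01" "f (inv_into I01 f y) = y"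
    using assms(1) xy by (metis bij_betw_imp_surj_on inv_into_into f_inv_into_f)+
  show "inv_into I01 f x < inv_into I01 f y"
    using strict_mono_on_leD[OF assms(2) Y(1) X(1)] X Y xy by linarith
qed

lemma H_plus_AC_I:
  assumes "f \<in> Bij I01" "continuous_on I01 f" "strict_mono_on I01 f"
    "abs_cont_on I01 f" "abs_cont_on I01 (inv_into I01 f)"
  shows "f \<in> H_plus_AC"
proof -
  have "\<exists>g. homeomorphism I01 I01 f g"
    using assms(1,2) by (metis Bij_def Int_iff bij_betw_def compact_Icc homeomorphism_compact mem_Collect_eq)
  then show ?thesis using assms by (auto simp: H_plus_AC_def H_plus_def)
qed

lemma subgroup_H_plus_AC: "subgroup H_plus_AC (BijGroup I01)"
proof -
  interpret B: group "BijGroup I01" by (rule group_BijGroup)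
  have mult: "f \<otimes>\<^bsub>BijGroup I01\<^esub> g = compose I01 f g" if "f \<in> Bij I01" "g \<in> Bij I01" for f g
    using that by (simp add: BijGroup_def)
  have id: "abs_cont_on I01 (\<lambda>x\<in>I01. x)"
  proof (rule abs_cont_on_cong[of _ "\<lambda>x. x"])
    show "abs_cont_on I01 (\<lambda>x. x)"
      unfolding abs_cont_on_def
    proof (intro allI impI)
      fix e :: real assume "e > 0"
      moreover have "(\<Sum>i<n. \<bar>b i - a i\<bar>) = (\<Sum>i<n. b i - a i)"
        if "\<forall>i<n. a i < b i \<and> {a i..b i} \<subseteq> I01" for n :: nat and a b
        using that by (intro sum.cong) auto
      ultimately show "\<exists>\<delta>>0. \<forall>(n::nat) a b.
       (\<forall>i<n. a i < b i \<and> {a i..b i} \<subseteq> I01) \<and>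
       disjoint_family_on (\<lambda>i. {a i<..<b i}) {..<n} \<and>
       (\<Sum>i<n. b i - a i) < \<delta> \<longrightarrow> (\<Sum>i<n. \<bar>b i - a i\<bar>) < e"
        by (intro exI[of _ e]) auto
    qed
  qed auto
  show ?thesis
  proof (rule B.subgroupI)
    show "H_plus_AC \<subseteq> carrier (BijGroup I01)"
      using H_plus_AC_D(1) by (auto simp: BijGroup_def)
    have inv_id: "inv_into I01 (\<lambda>x\<in>I01. x) x = x" if "x \<in> I01" for x :: real
      by (rule inv_into_f_eq) (use that in \<open>auto simp: inj_on_def\<close>)
    have "(\<lambda>x\<in>I01. x) \<in> H_plus_AC"
    proof (rule H_plus_AC_I)
      show "(\<lambda>x\<in>I01. x) \<in> Bij I01" by (rule id_Bij)
      show "continuous_on I01 (\<lambda>x\<in>I01. x)"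
        by (rule continuous_on_eq[OF continuous_on_id]) auto
      show "strict_mono_on I01 (\<lambda>x\<in>I01. x)" by (auto simp: strict_mono_on_def)
      show "abs_cont_on I01 (inv_into I01 (\<lambda>x\<in>I01. x))"
        by (rule abs_cont_on_cong[OF id]) (use inv_id in auto)
    qed (rule id)
    then show "H_plus_AC \<noteq> {}" by blast
  next
    fix f assume f: "f \<in> H_plus_AC"
    note D = H_plus_AC_D[OF f]
    let ?h = "\<lambda>x\<in>I01. inv_into I01 f x"
    have inv: "inv\<^bsub>BijGroup I01\<^esub> f = ?h" using D(1) by (rule inv_BijGroup)
    have "continuous_on (f ` I01) (inv_into I01 f)"
      by (rule continuous_on_inv[OF D(3) compact_Icc]) (use D(2) in \<open>simp add: bij_betw_def\<close>)
    then have c: "continuous_on I01 (inv_into I01 f)"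
      using D(2) by (simp add: bij_betw_def)
    have hB: "?h \<in> Bij I01" using D(1) by (rule restrict_inv_into_Bij)
    have "inv_into I01 ?h x = f x" if "x \<in> I01" for x
    proof (rule inv_into_f_eq)
      show "inj_on ?h I01" using hB by (auto simp: Bij_def bij_betw_def)
      show "f x \<in> I01" using D(2) that by (auto simp: bij_betw_def)
      then show "?h (f x) = x"
        using D(2) that by (simp add: bij_betw_def)
    qed
    then have "?h \<in> H_plus_AC"
      using strict_mono_on_inv_into[OF D(2,4)]
      by (intro H_plus_AC_I hB continuous_on_eq[OF c] abs_cont_on_cong[OF D(6)]
            abs_cont_on_cong[OF D(5)]) (auto simp: strict_mono_on_def)
    then show "inv\<^bsub>BijGroup I01\<^esub> f \<in> H_plus_AC" by (simp only: inv)
  next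
    fix f g assume f: "f \<in> H_plus_AC" and g: "g \<in> H_plus_AC"
    note F = H_plus_AC_D[OF f] and G = H_plus_AC_D[OF g]
    have im: "g ` I01 = I01" "f ` I01 = I01" using F(2) G(2) by (auto simp: bij_betw_def)
    have imi: "inv_into I01 f ` I01 \<subseteq> I01"
      using im by (metis image_subsetI inv_into_into)
    have B: "compose I01 f g \<in> Bij I01" by (rule compose_Bij[OF F(1) G(1)])
    have inv: "inv_into I01 (compose I01 f g) x = (inv_into I01 g \<circ> inv_into I01 f) x"
      if x: "x \<in> I01" for x
    proof (rule inv_into_f_eq)
      show "inj_on (compose I01 f g) I01" using B by (auto simp: Bij_def bij_betw_def)
      have 1: "inv_into I01 f x \<in> I01" using x imi by blast
      then have 2: "inv_into I01 g (inv_into I01 f x) \<in> I01" using im by (metis inv_into_into)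
      then show "(inv_into I01 g \<circ> inv_into I01 f) x \<in> I01" by simp
      have "g (inv_into I01 g (inv_into I01 f x)) = inv_into I01 f x"
        using 1 im by (metis f_inv_into_f)
      moreover have "f (inv_into I01 f x) = x" using x im by (metis f_inv_into_f)
      ultimately show "compose I01 f g ((inv_into I01 g \<circ> inv_into I01 f) x) = x"
        using 2 by (simp add: compose_def)
    qed
    have "compose I01 f g \<in> H_plus_AC"
    proof (rule H_plus_AC_I[OF B])
      have eq: "(f \<circ> g) x = compose I01 f g x" if "x \<in> I01" for x
        using that by (simp add: compose_def)
      have "continuous_on I01 (f \<circ> g)" using F(3) G(3) im by (metis continuous_on_compose)
      then show "continuous_on I01 (compose I01 f g)" by (rule continuous_on_eq) (rule eq)
      show "strict_mono_on I01 (compose I01 f g)"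
      proof (rule strict_mono_onI)
        fix x y :: real assume xy: "x \<in> I01" "y \<in> I01" "x < y"
        then have "g x \<in> I01" "g y \<in> I01" "g x < g y"
          using im strict_mono_onD[OF G(4)] by blast+
        then show "compose I01 f g x < compose I01 f g y"
          using strict_mono_onD[OF F(4)] xy by (simp add: compose_def)
      qed
      show "abs_cont_on I01 (compose I01 f g)"
        by (rule abs_cont_on_cong[OF abs_cont_on_compose[OF F(5) G(5) G(4)]])
          (use im eq in auto)
      show "abs_cont_on I01 (inv_into I01 (compose I01 f g))"
        by (rule abs_cont_on_cong[OF abs_cont_on_compose[OF G(6) F(6)
              strict_mono_on_inv_into[OF F(2,4)] imi]]) (use inv in auto)
    qed
    then show "f \<otimes>\<^bsub>BijGroup I01\<^esub> g \<in> H_plus_AC" using mult F(1) G(1) by simp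
  qed
qed

lemma group_H_plus_AC: "group H_plus_AC_group"
  unfolding H_plus_AC_group_def
  by (rule subgroup.subgroup_is_group[OF subgroup_H_plus_AC group_BijGroup])

end

theory Submission
  imports Defs
begin

text \<open>
  Passing to the derivative identifies \<^term>\<open>H_plus_AC\<close> with the positive probability densities on
  \<open>[0,1]\<close>, and \<^term>\<open>rho\<close> with the \<open>L\<^sup>1\<close> distance of densities. In this metric right translations
  are isometries and left translations are continuous, so the group is topological and separable, and
  \<^term>\<open>\<Omega>\<^sub>2\<close> is a countable intersection of open sets: for each \<open>h\<close> in a countable dense set and each
  \<open>\<epsilon> = 1/n\<close>, the pairs \<open>(f, g)\<close> for which some element of \<open>\<langle>f, g\<rangle>\<close> is \<open>\<epsilon>\<close>-close to \<open>h\<close>.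

  Each of these open sets is dense. Perturb \<open>g\<close> to have a polynomial density, hence finitely many fixed points,
  and \<open>f\<close> to move all of them. Then \<open>f\<close> and \<open>g\<close> have no common fixed point in \<open>(0,1)\<close>, so some
  \<open>u \<in> \<langle>f, g\<rangle>\<close> pushes \<open>[a,b] \<subset> (0,1)\<close> arbitrarily close to \<open>0\<close>, where the last steps use only \<open>g\<close>. Changing \<open>f\<close>
  to \<open>u h u\<^sup>-\<^sup>1\<close> on a tiny neighbourhood of \<open>0\<close> containing \<open>u[a,b]\<close> and \<open>u h[a,b]\<close> does not affect \<open>u\<close> on
  \<open>[a,b] \<union> h[a,b]\<close>, and afterwards \<open>u\<^sup>-\<^sup>1 f u = h\<close> on \<open>[a,b]\<close>. Off \<open>[a,b]\<close> both sides have small total variation,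
  so they are close for \<^term>\<open>rho\<close>.
\<close>

section \<open>Integration over the unit interval\<close>

text \<open>The danger is circularity. The element \<open>u\<close> is a word in \<open>f\<close>
  and \<open>g\<close>, and \<open>f\<close> is to be altered exactly where \<open>u\<close> carries
  \<open>[a,b]\<close>, which could change \<open>u\<close> itself. Hence \<open>u\<close> is split
  as \<open>v u0\<close>. The factor \<open>u0\<close> uses both generators, but only to get below
  the least fixed point of \<open>g\<close> in \<open>(0,1)\<close>; it determines a threshold below
  which \<open>f\<close> may be changed without effect on \<open>u0\<close> over the relevant
  interval. The factor \<open>v\<close> is a power of \<open>g\<close>: it pushes below that
  threshold afterwards and is immune to changes of \<open>f\<close>. This is why \<open>g\<close>
  must have no fixed points near 0, and hence why it gets a polynomial density. That a crude
  alteration is harmless comes from the L1 metric: replacing an element on \<open>[0,m]\<close>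
  while keeping its value at \<open>m\<close> costs at most twice that value, whatever the
  derivatives do there. Since \<open>rho\<close> is written with \<open>deriv\<close>, Lebesgue
  differentiation is proved first, to identify densities with derivatives. The chain rule then
  enters only in integrated form, as substitution under a push-forward of measures.\<close>

abbreviation unit_measure :: "real measure" where
  "unit_measure \<equiv> restrict_space lborel I01"

lemma space_unit_measure [simp]: "space unit_measure = I01"
  by (simp add: space_restrict_space)

lemma emeasure_unit_measure:
  assumes "A \<in> sets borel" shows "emeasure unit_measure (A \<inter> I01) = emeasure lborel (A \<inter> I01)"
  by (rule emeasure_restrict_space) (use assms in \<open>auto\<close>)

lemma null_sets_unit_measure_iff:
  "N \<in> null_sets unit_measure \<longleftrightarrow> N \<subseteq> I01 \<and> N \<in> null_sets lborel"
  by (simp add: null_sets_restrict_space)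

text \<open>\<open>negligible\<close> refers to the completed measure; a Borel null set containing
  \<open>N\<close> carries the statement over to \<open>unit_measure\<close>.\<close>

lemma negligible_imp_AE_unit_measure:
  assumes "negligible N" shows "AE x in unit_measure. x \<notin> N"
proof -
  obtain N' where N': "N' \<in> null_sets lborel" "N \<subseteq> N'"
    using assms unfolding negligible_iff_null_sets null_sets_completion_iff2 by blast
  then have "AE x in lborel. x \<notin> N" by (auto simp: eventually_ae_filter)
  then show ?thesis by (subst AE_restrict_space_iff) auto
qed

interpretation unit_measure: finite_measure unit_measure
  by (rule finite_measureI) (simp add: emeasure_restrict_space)

lemma borel_measurable_unit_measure [measurable_dest]:
  "f \<in> borel_measurable borel \<Longrightarrow> f \<in> borel_measurable unit_measure"
  by (simp add: measurable_restrict_space1)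

lemma continuous_on_borel_measurable_unit_measure:
  fixes k :: "real \<Rightarrow> real"
  assumes "continuous_on I01 k"
  shows "k \<in> borel_measurable unit_measure"
  using borel_measurable_continuous_on_restrict[OF assms] 
  by (simp add: measurable_cong_sets[OF sets_restrict_space_cong[OF sets_lborel] refl])

lemma continuous_on_integrable_unit_measure:
  fixes k :: "real \<Rightarrow> real"
  assumes "continuous_on I01 k"
  shows "integrable unit_measure k"
  proof -
  obtain B where "\<forall>x\<in>I01. \<bar>k x\<bar> \<le> B"
    using compact_imp_bounded[OF compact_continuous_image[OF assms compact_Icc]]
    unfolding bounded_iff by auto
  then show ?thesis
    by (intro unit_measure.integrable_const_bound[of _ B] AE_I2
        continuous_on_borel_measurable_unit_measure assms) auto
qed

section \<open>Approximation in mean by continuous functions and polynomials\<close>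

text \<open>\<open>measurable_on\<close> already provides continuous functions converging to
  \<open>\<phi>\<close> off a null set, but with nothing to dominate them. Clipping at height
  \<open>m\<close> supplies the constant \<open>2 * m\<close>; the clipping error itself vanishes as
  \<open>m\<close> grows, dominated by \<open>2 * \<bar>\<phi> x\<bar>\<close>.\<close>

lemma L1_approx_continuous:
  fixes \<phi> :: "real \<Rightarrow> real"
  assumes \<phi>: "integrable unit_measure \<phi>" and "e > 0"
  shows "\<exists>k. continuous_on UNIV k \<and> (\<integral>x. \<bar>\<phi> x - k x\<bar> \<partial>unit_measure) < e"
proof -
  have "(\<lambda>x. indicator I01 x * \<phi> x) \<in> borel_measurable lborel"
    using \<phi> by (subst (asm) integrable_restrict_space) auto
  then have "(\<lambda>x. indicator I01 x * \<phi> x) measurable_on UNIV"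
    by (intro lebesgue_measurable_imp_measurable_on) (auto intro: measurable_completion)
  then obtain N g where N: "negligible N" and g: "\<And>n. continuous_on UNIV (g n)"
    and lim: "\<And>x. x \<notin> N \<Longrightarrow> (\<lambda>n. g n x) \<longlonglongrightarrow> indicator I01 x * \<phi> x"
    unfolding measurable_on_def by auto
  have AE: "AE x in unit_measure. x \<notin> N \<and> x \<in> I01"
    using negligible_imp_AE_unit_measure[OF N] AE_space by eventually_elim auto
  define k where "k m n x = max (- real m) (min (real m) (g n x))" for m n x
  define p where "p m x = max (- real m) (min (real m) (\<phi> x))" for m x
  have kc: "continuous_on UNIV (k m n)" for m n
    unfolding k_def by (intro continuous_intros g)
  have kI: "integrable unit_measure (k m n)" for m n
    by (rule continuous_on_integrable_unit_measure) (rule continuous_on_subset[OF kc], simp)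
  have [measurable]: "k m n \<in> borel_measurable unit_measure" "\<phi> \<in> borel_measurable unit_measure" for m n
    using kI \<phi> by auto
  have [measurable]: "p m \<in> borel_measurable unit_measure" for m
    unfolding p_def by measurable
  have pI: "integrable unit_measure (p m)" for m
    by (rule Bochner_Integration.integrable_bound[OF \<phi>]) (auto simp: p_def)
  have "(\<lambda>m. \<integral>x. \<bar>\<phi> x - p m x\<bar> \<partial>unit_measure) \<longlonglongrightarrow> (\<integral>x. 0 \<partial>unit_measure)"
  proof (rule integral_dominated_convergence[where w="\<lambda>x. 2 * \<bar>\<phi> x\<bar>"])
    show "AE x in unit_measure. (\<lambda>m. \<bar>\<phi> x - p m x\<bar>) \<longlonglongrightarrow> 0"
    proof (rule AE_I2)
      fix x
      obtain n where "\<bar>\<phi> x\<bar> \<le> real n" using real_arch_simple by blast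
      then have "\<forall>\<^sub>F m in sequentially. \<bar>\<phi> x - p m x\<bar> = 0"
        by (auto simp: eventually_sequentially p_def intro!: exI[of _ n])
      then show "(\<lambda>m. \<bar>\<phi> x - p m x\<bar>) \<longlonglongrightarrow> 0" by (rule tendsto_eventually)
    qed
    show "AE x in unit_measure. norm \<bar>\<phi> x - p m x\<bar> \<le> 2 * \<bar>\<phi> x\<bar>" for m
      by (auto simp: p_def)
  qed (use \<phi> in auto)
  then have "\<forall>\<^sub>F m in sequentially. (\<integral>x. \<bar>\<phi> x - p m x\<bar> \<partial>unit_measure) < e / 2"
    by (rule order_tendstoD) (use \<open>e > 0\<close> in simp)
  then obtain m where m: "(\<integral>x. \<bar>\<phi> x - p m x\<bar> \<partial>unit_measure) < e / 2"
    by (auto simp: eventually_sequentially)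
  have "(\<lambda>n. \<integral>x. \<bar>p m x - k m n x\<bar> \<partial>unit_measure) \<longlonglongrightarrow> (\<integral>x. 0 \<partial>unit_measure)"
  proof (rule integral_dominated_convergence[where w="\<lambda>x. 2 * real m"])
    show "AE x in unit_measure. (\<lambda>n. \<bar>p m x - k m n x\<bar>) \<longlonglongrightarrow> 0"
      using AE
    proof eventually_elim
      case (elim x)
      then have "(\<lambda>n. g n x) \<longlonglongrightarrow> \<phi> x" using lim[of x] by simp
      then have "(\<lambda>n. \<bar>p m x - k m n x\<bar>) \<longlonglongrightarrow> \<bar>p m x - p m x\<bar>"
        unfolding k_def p_def by (intro tendsto_intros tendsto_max tendsto_min)
      then show ?case by simp
    qed
    show "integrable unit_measure (\<lambda>x. 2 * real m)"
      by (rule continuous_on_integrable_unit_measure) auto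
    show "AE x in unit_measure. norm \<bar>p m x - k m n x\<bar> \<le> 2 * real m" for n
      by (auto simp: p_def k_def)
  qed auto
  then have "\<forall>\<^sub>F n in sequentially. (\<integral>x. \<bar>p m x - k m n x\<bar> \<partial>unit_measure) < e / 2"
    by (rule order_tendstoD) (use \<open>e > 0\<close> in simp)
  then obtain n where n: "(\<integral>x. \<bar>p m x - k m n x\<bar> \<partial>unit_measure) < e / 2"
    by (auto simp: eventually_sequentially)
  have "(\<integral>x. \<bar>\<phi> x - k m n x\<bar> \<partial>unit_measure) \<le>
      (\<integral>x. \<bar>\<phi> x - p m x\<bar> + \<bar>p m x - k m n x\<bar> \<partial>unit_measure)"
    using \<phi> pI kI by (intro integral_mono) auto
  also have "\<dots> = (\<integral>x. \<bar>\<phi> x - p m x\<bar> \<partial>unit_measure) + (\<integral>x. \<bar>p m x - k m n x\<bar> \<partial>unit_measure)"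
    using \<phi> pI kI by (intro Bochner_Integration.integral_add) auto
  finally show ?thesis using m n kc by (intro exI[of _ "k m n"]) auto
qed

lemma integral_unit_measure_le_const:
  fixes u :: "real \<Rightarrow> real"
  assumes "u \<in> borel_measurable unit_measure" "\<And>x. x \<in> I01 \<Longrightarrow> \<bar>u x\<bar> \<le> c"
  shows "(\<integral>x. \<bar>u x\<bar> \<partial>unit_measure) \<le> c"
proof -
  have "integrable unit_measure u"
    by (rule unit_measure.integrable_const_bound[of _ c]) (use assms in auto)
  then have "(\<integral>x. \<bar>u x\<bar> \<partial>unit_measure) \<le> (\<integral>x. c \<partial>unit_measure)"
    by (intro integral_mono) (use assms(2) in auto)
  also have "\<dots> = c"
    by (simp add: measure_restrict_space)
  finally show ?thesis .
qed

lemma L1_approx_polynomial: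
  fixes \<phi> :: "real \<Rightarrow> real"
  assumes \<phi>: "integrable unit_measure \<phi>" and "e > 0"
  shows "\<exists>a n. (\<integral>x. \<bar>\<phi> x - (\<Sum>i\<le>n. a i * x ^ i)\<bar> \<partial>unit_measure) < e"
proof -
  obtain k where k: "continuous_on UNIV k" "(\<integral>x. \<bar>\<phi> x - k x\<bar> \<partial>unit_measure) < e / 2"
    using L1_approx_continuous[OF \<phi>, of "e / 2"] \<open>e > 0\<close> by auto
  obtain p where p: "real_polynomial_function p" "\<And>x. x \<in> I01 \<Longrightarrow> \<bar>k x - p x\<bar> < e / 2"
    by (rule Stone_Weierstrass_real_polynomial_function[of I01 k "e / 2"])
      (use k \<open>e > 0\<close> in \<open>auto intro: continuous_on_subset\<close>)
  obtain a n where a: "p = (\<lambda>x. \<Sum>i\<le>n. a i * x ^ i)"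
    using p(1) unfolding real_polynomial_function_iff_sum by blast
  have I: "integrable unit_measure k" "integrable unit_measure p"
    by (auto intro!: continuous_on_integrable_unit_measure continuous_on_subset[OF k(1)]
        continuous_intros simp: a)
  then have "(\<integral>x. \<bar>k x - p x\<bar> \<partial>unit_measure) \<le> e / 2"
    by (intro integral_unit_measure_le_const less_imp_le[OF p(2)]) auto
  moreover have "(\<integral>x. \<bar>\<phi> x - p x\<bar> \<partial>unit_measure) \<le>
      (\<integral>x. \<bar>\<phi> x - k x\<bar> + \<bar>k x - p x\<bar> \<partial>unit_measure)"
    using \<phi> I by (intro integral_mono) auto
  moreover have "\<dots> = (\<integral>x. \<bar>\<phi> x - k x\<bar> \<partial>unit_measure) + (\<integral>x. \<bar>k x - p x\<bar> \<partial>unit_measure)"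
    using \<phi> I by (intro Bochner_Integration.integral_add) auto
  ultimately show ?thesis using k(2) unfolding a by (intro exI[of _ a] exI[of _ n]) linarith
qed

section \<open>The maximal inequality\<close>

text \<open>Weak type (1,1) by Vitali covering: disjoint balls are selected whose fivefold
  enlargements still cover, whence the constant 5; \<open>2 * r\<close> is the length of a ball. A
  Borel superset \<open>T\<close> is returned so that measurability of the maximal set is never an
  issue. Radii are capped at 1 because the covering lemma wants bounded balls, while differentiation
  is local.\<close>

lemma Hardy_Littlewood_maximal:
  fixes N :: "real measure"
  assumes sets: "sets N = sets borel" and "t > 0"
  shows "\<exists>T\<in>sets borel. ennreal t * emeasure lborel T \<le> 5 * emeasure N UNIV \<and>
    {x. \<exists>r. 0 < r \<and> r \<le> 1 \<and> ennreal (t * (2 * r)) \<le> emeasure N (cball x r)} \<subseteq> T"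
proof -
  define S where
    "S = {x. \<exists>r. 0 < r \<and> r \<le> 1 \<and> ennreal (t * (2 * r)) \<le> emeasure N (cball x r)}"
  have "\<forall>x\<in>S. \<exists>r. 0 < r \<and> r \<le> 1 \<and> ennreal (t * (2 * r)) \<le> emeasure N (cball x r)"
    by (auto simp: S_def)
  then obtain r where r: "\<And>x. x \<in> S \<Longrightarrow> 0 < r x \<and> r x \<le> 1"
    "\<And>x. x \<in> S \<Longrightarrow> ennreal (t * (2 * r x)) \<le> emeasure N (cball x (r x))"
    unfolding bchoice_iff by blast
  have "S \<subseteq> (\<Union>i\<in>S. cball i (r i))" using r by (force simp: less_imp_le)
  then obtain C where C: "countable C" "C \<subseteq> S"
    "pairwise (\<lambda>i j. disjnt (cball i (r i)) (cball j (r j))) C"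
    "S \<subseteq> (\<Union>i\<in>C. cball i (5 * r i))"
    by (rule Vitali_covering_lemma_cballs[of S "\<lambda>x. x" r S 1]) (use r in auto)
  \<comment> \<open>\<open>C\<close> may be finite; indexing by all naturals with empty sets outside
    \<open>J\<close> makes it a sequence, as countable additivity wants.\<close>
  define J where "J = to_nat_on C ` C"
  define c where "c = from_nat_into C"
  have c: "c n \<in> C" "c n \<in> S" if "n \<in> J" for n
    using that C(1,2) by (auto simp: J_def c_def)
  have c_inj: "c m \<noteq> c n" if "m \<in> J" "n \<in> J" "m \<noteq> n" for m n
    using that C(1) by (auto simp: J_def c_def)
  define X where "X n = (if n \<in> J then cball (c n) (r (c n)) else {})" for n
  define Y where "Y n = (if n \<in> J then cball (c n) (5 * r (c n)) else {})" for n
  have [measurable]: "X n \<in> sets borel" "Y n \<in> sets borel" for n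
    by (auto simp: X_def Y_def)
  have disj: "disjoint_family X"
    using C(3) c c_inj unfolding disjoint_family_on_def X_def pairwise_def disjnt_def by auto
  have YX: "ennreal t * emeasure lborel (Y n) \<le> 5 * emeasure N (X n)" for n
  proof (cases "n \<in> J")
    case True
    have "ennreal t * emeasure lborel (Y n) = ennreal t * ennreal (10 * r (c n))"
      using r(1)[OF c(2)[OF True]] True by (simp add: Y_def cball_eq_atLeastAtMost)
    also have "\<dots> = 5 * ennreal (t * (2 * r (c n)))"
      using r(1)[OF c(2)[OF True]] \<open>t > 0\<close>
      by (simp flip: ennreal_mult ennreal_numeral)
    also have "\<dots> \<le> 5 * emeasure N (X n)"
      using r(2)[OF c(2)[OF True]] True by (auto simp: X_def intro: mult_left_mono)
    finally show ?thesis .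
  qed (simp add: Y_def)
  have "S \<subseteq> (\<Union>n. Y n)"
  proof
    fix x assume "x \<in> S"
    then obtain i where "i \<in> C" "x \<in> cball i (5 * r i)" using C(4) by auto
    then show "x \<in> (\<Union>n. Y n)"
      using C(1) by (intro UN_I[of "to_nat_on C i"]) (auto simp: Y_def J_def c_def)
  qed
  moreover have "ennreal t * emeasure lborel (\<Union>n. Y n) \<le> 5 * emeasure N UNIV"
  proof -
    have "ennreal t * emeasure lborel (\<Union>n. Y n) \<le> ennreal t * (\<Sum>n. emeasure lborel (Y n))"
      by (intro mult_left_mono emeasure_subadditive_countably) auto
    also have "\<dots> = (\<Sum>n. ennreal t * emeasure lborel (Y n))" by simp
    also have "\<dots> \<le> (\<Sum>n. 5 * emeasure N (X n))" by (intro suminf_le YX) auto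
    also have "\<dots> = 5 * (\<Sum>n. emeasure N (X n))" by simp
    also have "(\<Sum>n. emeasure N (X n)) = emeasure N (\<Union>n. X n)"
      by (rule suminf_emeasure) (auto simp: sets disj)
    also have "\<dots> \<le> emeasure N UNIV"
      using sets_eq_imp_space_eq[OF sets] by (intro emeasure_mono) (auto simp: sets)
    finally show ?thesis by (simp add: mult_left_mono)
  qed
  ultimately show ?thesis unfolding S_def[symmetric] by (intro bexI[of _ "\<Union>n. Y n"]) auto
qed

section \<open>Lebesgue differentiation\<close>

lemma indicator_integrable_unit_measure:
  fixes \<phi> :: "real \<Rightarrow> real"
  assumes "integrable unit_measure \<phi>" "A \<in> sets borel"
  shows "integrable unit_measure (\<lambda>x. indicator A x * \<phi> x)"
proof -
  have "A \<inter> I01 \<in> sets unit_measure" using assms(2) by (auto simp: sets_restrict_space)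
  then have "integrable unit_measure (\<lambda>x. indicator (A \<inter> I01) x *\<^sub>R \<phi> x)"
    using assms(1) by (rule integrable_mult_indicator)
  then show ?thesis
    by (rule Bochner_Integration.integrable_cong[THEN iffD1, rotated -1]) (auto simp: indicator_def)
qed

text \<open>Inserting \<open>k\<close> splits \<open>\<phi> s - \<phi> x\<close> into three errors.
  The value of \<open>\<phi> - k\<close> at \<open>x\<close> and the oscillation of \<open>k\<close>
  cost \<open>t / 4\<close> each. The value of \<open>\<phi> - k\<close> at \<open>s\<close> is
  averaged over a ball around \<open>x\<close>, twice as long as the interval between
  \<open>x\<close> and \<open>y\<close>, and costs \<open>t / 2\<close>.\<close>

lemma Lebesgue_differentiation_step:
  fixes \<phi> k :: "real \<Rightarrow> real"
  assumes \<phi>: "integrable unit_measure \<phi>" and k: "continuous_on UNIV k" and "t > 0"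
  defines "F \<equiv> \<lambda>x. \<integral>y. indicator {..x} y * \<phi> y \<partial>unit_measure"
  defines "N \<equiv> density unit_measure (\<lambda>x. ennreal \<bar>\<phi> x - k x\<bar>)"
  assumes x: "0 < x" "x < 1" and near: "\<bar>\<phi> x - k x\<bar> \<le> t / 4"
    and avg: "\<And>r. 0 < r \<Longrightarrow> r \<le> 1 \<Longrightarrow> (\<integral>y. indicator (cball x r) y * \<bar>\<phi> y - k y\<bar> \<partial>unit_measure) \<le> t / 4 * (2 * r)"
  shows "\<exists>d>0. \<forall>y. y \<noteq> x \<and> \<bar>y - x\<bar> < d \<longrightarrow> \<bar>(F y - F x) / (y - x) - \<phi> x\<bar> \<le> t"
proof -
  have kI: "integrable unit_measure k"
    by (intro continuous_on_integrable_unit_measure continuous_on_subset[OF k]) auto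
  obtain d1 where d1: "d1 > 0" "\<And>y. \<bar>y - x\<bar> < d1 \<Longrightarrow> \<bar>k y - k x\<bar> < t / 4"
    using k \<open>t > 0\<close> unfolding continuous_on_iff dist_real_def
    by (metis UNIV_I zero_less_divide_iff zero_less_numeral)
  \<comment> \<open>Besides using continuity of \<open>k\<close>, the radius keeps \<open>y\<close>
    inside the unit interval, where \<open>unit_measure\<close> gives intervals their full
    length.\<close>
  define d where "d = Min {d1, x, 1 - x}"
  have d: "d > 0" "d \<le> d1" "d \<le> x" "d \<le> 1 - x" using x d1 by (auto simp: d_def)
  have "\<bar>(F y - F x) / (y - x) - \<phi> x\<bar> \<le> t" if y: "y \<noteq> x" "\<bar>y - x\<bar> < d" for y
  proof -
    define J where "J = {min x y<..max x y}"
    have J01: "J \<subseteq> I01" using x y d by (auto simp: J_def)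
    have [measurable]: "J \<in> sets borel" by (simp add: J_def)
    have measJ: "(\<integral>s. indicator J s * c \<partial>unit_measure) = \<bar>y - x\<bar> * c" for c
    proof -
      have "measure unit_measure J = \<bar>y - x\<bar>"
        using J01 by (subst measure_restrict_space) (auto simp: J_def)
      moreover have "J \<inter> I01 = J" using J01 by auto
      ultimately show ?thesis by simp
    qed
    note I = indicator_integrable_unit_measure[of _ J]
    have Fmm: "F (max x y) - F (min x y) = (\<integral>s. indicator J s * \<phi> s \<partial>unit_measure)"
    proof -
      have "F (max x y) - F (min x y) =
        (\<integral>s. indicator {..max x y} s * \<phi> s - indicator {..min x y} s * \<phi> s \<partial>unit_measure)"
        unfolding F_def
        by (intro Bochner_Integration.integral_diff[symmetric] indicator_integrable_unit_measure \<phi>) auto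
      also have "\<dots> = (\<integral>s. indicator J s * \<phi> s \<partial>unit_measure)"
        by (intro Bochner_Integration.integral_cong) (auto simp: J_def indicator_def)
      finally show ?thesis .
    qed
    have "\<bar>(F (max x y) - F (min x y)) - \<bar>y - x\<bar> * \<phi> x\<bar>
        = \<bar>\<integral>s. indicator J s * \<phi> s - indicator J s * \<phi> x \<partial>unit_measure\<bar>"
      unfolding Fmm measJ[symmetric]
      by (subst Bochner_Integration.integral_diff[OF I[OF \<phi>] I]) auto
    also have "\<dots> \<le> (\<integral>s. \<bar>indicator J s * \<phi> s - indicator J s * \<phi> x\<bar> \<partial>unit_measure)"
      by (rule integral_abs_bound)
    also have "\<dots> \<le> (\<integral>s. indicator (cball x \<bar>y - x\<bar>) s * \<bar>\<phi> s - k s\<bar> + indicator J s * (t / 2) \<partial>unit_measure)"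
    proof (rule integral_mono)
      show "\<bar>indicator J s * \<phi> s - indicator J s * \<phi> x\<bar> \<le>
          indicator (cball x \<bar>y - x\<bar>) s * \<bar>\<phi> s - k s\<bar> + indicator J s * (t / 2)" for s
      proof (cases "s \<in> J")
        case True
        then have s: "\<bar>s - x\<bar> < d1" "s \<in> cball x \<bar>y - x\<bar>"
          using y d by (auto simp: J_def dist_real_def)
        then have "\<bar>k s - k x\<bar> < t / 4" using d1(2) by simp
        then have "\<bar>\<phi> s - \<phi> x\<bar> \<le> \<bar>\<phi> s - k s\<bar> + t / 2" using near by linarith
        then show ?thesis using True s by simp
      qed simp
    qed (use \<phi> kI in \<open>auto intro!: indicator_integrable_unit_measure Bochner_Integration.integrable_add
          Bochner_Integration.integrable_diff integrable_abs\<close>)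
    also have "\<dots> = (\<integral>s. indicator (cball x \<bar>y - x\<bar>) s * \<bar>\<phi> s - k s\<bar> \<partial>unit_measure) + \<bar>y - x\<bar> * (t / 2)"
      unfolding measJ[symmetric]
      by (intro Bochner_Integration.integral_add)
        (use \<phi> kI in \<open>auto intro!: indicator_integrable_unit_measure\<close>)
    also have "\<dots> \<le> t / 4 * (2 * \<bar>y - x\<bar>) + \<bar>y - x\<bar> * (t / 2)"
      using y d x by (intro add_right_mono avg) auto
    finally have *: "\<bar>(F (max x y) - F (min x y)) - \<bar>y - x\<bar> * \<phi> x\<bar> \<le> \<bar>y - x\<bar> * t" by (simp add: field_simps)
    have "\<bar>F y - F x - (y - x) * \<phi> x\<bar> \<le> \<bar>y - x\<bar> * t"
    proof (cases "x < y")
      case True then show ?thesis using * by (simp add: max_def min_def)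
    next
      case False
      then have "F x - F y - (x - y) * \<phi> x = - (F y - F x - (y - x) * \<phi> x)" by (simp add: algebra_simps)
      with * False y show ?thesis by (simp add: max_def min_def)
    qed
    moreover have "(F y - F x) / (y - x) - \<phi> x = (F y - F x - (y - x) * \<phi> x) / (y - x)"
      using y by (simp add: field_simps)
    ultimately show ?thesis using y by (simp add: abs_divide divide_le_eq mult.commute)
  qed
  then show ?thesis using d(1) by blast
qed

text \<open>For each \<open>t\<close> the points whose difference quotients do not come within
  \<open>t\<close> of \<open>\<phi> x\<close> lie where either
  \<open>\<bar>\<phi> x - k x\<bar>\<close> or its maximal function is at least
  \<open>t / 4\<close>. Both sets are small once \<open>k\<close> is close to \<open>\<phi>\<close>
  in mean, so the bad set is null; then \<open>t\<close> runs through
  \<open>1 / (n + 1)\<close>.\<close>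

theorem Lebesgue_differentiation:
  fixes \<phi> :: "real \<Rightarrow> real"
  assumes \<phi>: "integrable unit_measure \<phi>"
  defines "F \<equiv> \<lambda>x. \<integral>y. indicator {..x} y * \<phi> y \<partial>unit_measure"
  shows "AE x in unit_measure. (F has_real_derivative \<phi> x) (at x)"
proof -
  define good where "good t x \<longleftrightarrow> (\<exists>d>0. \<forall>y. y \<noteq> x \<and> \<bar>y - x\<bar> < d \<longrightarrow>
    \<bar>(F y - F x) / (y - x) - \<phi> x\<bar> \<le> t)" for t x
  have neg: "negligible {x \<in> {0<..<1}. \<not> good t x}" if "t > 0" for t
    unfolding negligible_outer_le
  proof (intro allI impI)
    fix e :: real assume "e > 0"
    \<comment> \<open>The maximal inequality at level \<open>t / 4\<close> gives measure at most
      \<open>20 * e' / t\<close>, Markov's inequality at the same level \<open>4 * e' / t\<close>;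
      the sum is \<open>e\<close>.\<close>
    define e' where "e' = e * t / 24"
    have "e' > 0" using \<open>e > 0\<close> \<open>t > 0\<close> by (simp add: e'_def)
    then obtain k where k: "continuous_on UNIV k" "(\<integral>x. \<bar>\<phi> x - k x\<bar> \<partial>unit_measure) < e'"
      using L1_approx_continuous[OF \<phi>] by blast
    have kI: "integrable unit_measure k"
      by (intro continuous_on_integrable_unit_measure continuous_on_subset[OF k(1)]) auto
    have [measurable]: "\<phi> \<in> borel_measurable unit_measure" "k \<in> borel_measurable unit_measure"
      using \<phi> kI by auto
    \<comment> \<open>The image under the identity turns the density on the unit interval into a
      measure on all Borel sets of the line, as the maximal inequality expects.\<close>
    define N where "N = distr (density unit_measure (\<lambda>x. ennreal \<bar>\<phi> x - k x\<bar>)) borel (\<lambda>x. x)"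
    have id: "(\<lambda>x. x) \<in> unit_measure \<rightarrow>\<^sub>M borel" by (rule borel_measurable_unit_measure) simp
    have emN: "emeasure N A = ennreal (\<integral>y. indicator A y * \<bar>\<phi> y - k y\<bar> \<partial>unit_measure)"
      if [measurable]: "A \<in> sets borel" for A
    proof -
      have A: "A \<inter> I01 \<in> sets unit_measure" using that by (auto simp: sets_restrict_space)
      have "emeasure N A = (\<integral>\<^sup>+y. ennreal \<bar>\<phi> y - k y\<bar> * indicator (A \<inter> I01) y \<partial>unit_measure)"
        unfolding N_def using A id by (simp add: emeasure_distr emeasure_density)
      also have "\<dots> = (\<integral>\<^sup>+y. ennreal (indicator A y * \<bar>\<phi> y - k y\<bar>) \<partial>unit_measure)"
        by (intro nn_integral_cong) (auto simp: indicator_def)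
      also have "\<dots> = ennreal (\<integral>y. indicator A y * \<bar>\<phi> y - k y\<bar> \<partial>unit_measure)"
        by (intro nn_integral_eq_integral indicator_integrable_unit_measure)
          (use \<phi> kI in auto)
      finally show ?thesis .
    qed
    obtain T1 where T1: "T1 \<in> sets borel" "ennreal (t / 4) * emeasure lborel T1 \<le> 5 * emeasure N UNIV"
      and T1S: "{x. \<exists>r. 0 < r \<and> r \<le> 1 \<and> ennreal (t / 4 * (2 * r)) \<le> emeasure N (cball x r)} \<subseteq> T1"
      using Hardy_Littlewood_maximal[of N "t / 4"] \<open>t > 0\<close> by (auto simp: N_def)
    define T2 where "T2 = {x \<in> I01. t / 4 \<le> \<bar>\<phi> x - k x\<bar>}"
    have "{x \<in> space unit_measure. t / 4 \<le> \<bar>\<phi> x - k x\<bar>} \<in> sets unit_measure" by measurable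
    then have T2U: "T2 \<in> sets unit_measure" by (simp add: T2_def)
    then have T2: "T2 \<in> sets borel" by (auto simp: sets_restrict_space)
    have NU: "emeasure N UNIV \<le> ennreal e'"
      using emN[of UNIV] k(2) by (simp add: ennreal_leI)
    have "ennreal (t / 4) * emeasure lborel T1 \<le> ennreal (t / 4) * ennreal (20 * e' / t)"
    proof -
      have "5 * emeasure N UNIV \<le> 5 * ennreal e'" using NU by (rule mult_left_mono) simp
      also have "\<dots> = ennreal (t / 4) * ennreal (20 * e' / t)"
        using \<open>t > 0\<close> \<open>e' > 0\<close> by (simp flip: ennreal_mult ennreal_numeral)
      finally show ?thesis using T1(2) by (rule order_trans[rotated])
    qed
    then have mT1: "emeasure lborel T1 \<le> ennreal (20 * e' / t)"
      using \<open>t > 0\<close> by (subst (asm) ennreal_mult_le_mult_iff) auto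
    have mT2: "emeasure lborel T2 \<le> ennreal (4 * e' / t)"
    proof -
      have "measure unit_measure T2 \<le> (\<integral>x. \<bar>\<phi> x - k x\<bar> \<partial>unit_measure) / (t / 4)"
        unfolding T2_def
        using integral_Markov_inequality_measure[of unit_measure "\<lambda>x. \<bar>\<phi> x - k x\<bar>" "{}" "t / 4"] \<open>t > 0\<close> \<phi> kI
        by (simp add: conj_commute)
      also have "\<dots> \<le> 4 * e' / t" using k(2) \<open>t > 0\<close> by (simp add: field_simps)
      finally have "emeasure unit_measure T2 \<le> ennreal (4 * e' / t)"
        by (simp add: unit_measure.emeasure_eq_measure ennreal_leI)
      moreover have "T2 \<inter> I01 = T2" by (auto simp: T2_def)
      ultimately show ?thesis using emeasure_unit_measure[OF T2] by simp
    qed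
    have mT: "emeasure lborel (T1 \<union> T2) \<le> ennreal e"
    proof -
      have "emeasure lborel (T1 \<union> T2) \<le> ennreal (20 * e' / t) + ennreal (4 * e' / t)"
        by (rule order_trans[OF emeasure_subadditive add_mono[OF mT1 mT2]]) (use T1 T2 in auto)
      also have "\<dots> = ennreal e"
        using \<open>t > 0\<close> \<open>e > 0\<close> by (simp flip: ennreal_plus add: e'_def field_simps)
      finally show ?thesis .
    qed
    have "{x \<in> {0<..<1}. \<not> good t x} \<subseteq> T1 \<union> T2"
    proof (clarsimp)
      fix x assume x: "\<not> good t x" "x \<notin> T2" "0 < x" "x < 1"
      show "x \<in> T1"
      proof (rule ccontr)
        assume "x \<notin> T1"
        then have N: "\<not> ennreal (t / 4 * (2 * r)) \<le> emeasure N (cball x r)" if "0 < r" "r \<le> 1" for r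
          using T1S that by blast
        have "(\<integral>y. indicator (cball x r) y * \<bar>\<phi> y - k y\<bar> \<partial>unit_measure) \<le> t / 4 * (2 * r)"
          if "0 < r" "r \<le> 1" for r
          using N[OF that] unfolding emN[OF borel_closed[OF closed_cball]] using ennreal_leI linear by blast
        moreover have "\<bar>\<phi> x - k x\<bar> \<le> t / 4" using x by (auto simp: T2_def)
        ultimately have "good t x"
          unfolding good_def F_def
          using Lebesgue_differentiation_step[OF \<phi> k(1) \<open>t > 0\<close> x(3,4)] by blast
        with x show False by simp
      qed
    qed
    moreover have "T1 \<union> T2 \<in> lmeasurable"
      using T1 T2 mT by (intro fmeasurableI) (auto intro: le_less_trans)
    moreover have "measure lebesgue (T1 \<union> T2) \<le> e"
      using mT T1 T2 \<open>e > 0\<close> by (simp add: measure_def enn2real_leI)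
    ultimately show "\<exists>T. {x \<in> {0<..<1}. \<not> good t x} \<subseteq> T \<and> T \<in> lmeasurable \<and> measure lebesgue T \<le> e"
      by blast
  qed
  define B where "B = {0, 1} \<union> (\<Union>n. {x \<in> {0<..<1}. \<not> good (1 / real (Suc n)) x})"
  have "negligible B"
    unfolding B_def by (intro negligible_Un negligible_Union_nat neg) auto
  then have "AE x in unit_measure. x \<notin> B" by (rule negligible_imp_AE_unit_measure)
  with AE_space show ?thesis
  proof eventually_elim
    case (elim x)
    then have g: "good (1 / real (Suc n)) x" for n by (auto simp: B_def)
    have "(\<lambda>y. (F y - F x) / (y - x)) \<midarrow>x\<rightarrow> \<phi> x"
    proof (rule LIM_I)
      fix r :: real assume "r > 0"
      then obtain n where n: "1 / real (Suc n) < r" using nat_approx_posE by metis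
      from g[of n] obtain d where "d > 0" "\<And>y. y \<noteq> x \<and> \<bar>y - x\<bar> < d \<Longrightarrow>
        \<bar>(F y - F x) / (y - x) - \<phi> x\<bar> \<le> 1 / real (Suc n)"
        unfolding good_def by blast
      then show "\<exists>s>0. \<forall>y. y \<noteq> x \<and> norm (y - x) < s \<longrightarrow>
          norm ((F y - F x) / (y - x) - \<phi> x) < r"
        using n by (intro exI[of _ d]) (auto intro: le_less_trans)
    qed
    then show ?case by (simp add: has_field_derivative_iff)
  qed
qed

section \<open>Densities of absolutely continuous homeomorphisms\<close>

lemma H_plus_AC_image: "f \<in> H_plus_AC \<Longrightarrow> f ` I01 = I01"
  using H_plus_AC_D(2) by (auto simp: bij_betw_def)

lemma strict_mono_on_I01_endpoints:
  fixes f :: "real \<Rightarrow> real"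
  assumes "strict_mono_on I01 f" "f ` I01 = I01"
  shows "f 0 = 0" "f 1 = 1"
proof -
  have "0 \<in> f ` I01" "1 \<in> f ` I01" unfolding assms(2) by auto
  then obtain a b where ab: "a \<in> I01" "f a = 0" "b \<in> I01" "f b = 1"
    by (elim imageE) metis
  have "f 0 \<le> f a"
    by (rule strict_mono_on_leD[OF assms(1)]) (use ab in auto)
  moreover have "f b \<le> f 1"
    by (rule strict_mono_on_leD[OF assms(1)]) (use ab in auto)
  moreover have "f 0 \<in> I01" "f 1 \<in> I01" using assms(2) by auto
  ultimately show "f 0 = 0" "f 1 = 1" using ab by auto
qed

lemma abs_cont_onE:
  assumes "abs_cont_on S f" "e > 0"
  obtains d where "d > 0"
    "\<And>(n::nat) a b. (\<And>i. i < n \<Longrightarrow> a i < b i \<and> {a i..b i} \<subseteq> S) \<Longrightarrow>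
      disjoint_family_on (\<lambda>i. {a i<..<b i}) {..<n} \<Longrightarrow> (\<Sum>i<n. b i - a i) < d \<Longrightarrow>
      (\<Sum>i<n. \<bar>f (b i) - f (a i)\<bar>) < e"
proof -
  from assms obtain d where "d > 0" "\<forall>(n::nat) a b. (\<forall>i<n. a i < b i \<and> {a i..b i} \<subseteq> S) \<and>
       disjoint_family_on (\<lambda>i. {a i<..<b i}) {..<n} \<and> (\<Sum>i<n. b i - a i) < d \<longrightarrow>
       (\<Sum>i<n. \<bar>f (b i) - f (a i)\<bar>) < e"
    unfolding abs_cont_on_def by (elim allE[of _ e]) auto
  then show ?thesis by (intro that[of d]) simp_all
qed

section \<open>The Stieltjes measure of an absolutely continuous function and its density\<close>

text \<open>Composition with this retraction extends a function from the unit interval to the line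
  by constants, so that \<open>interval_measure\<close> can be formed.\<close>

definition clamp :: "real \<Rightarrow> real" where "clamp x = max 0 (min 1 x)"

text \<open>A null set lies in an open set of small length. Since \<open>abs_cont_on\<close> speaks
  of finite families only, the bound is shown for finite unions of boxes, with overlaps removed by
  passing to a division, and reaches the open set as an increasing limit.\<close>

lemma abs_cont_interval_measure_null:
  fixes f :: "real \<Rightarrow> real"
  assumes ac: "abs_cont_on I01 f" and cont: "continuous_on I01 f" and mono: "mono_on I01 f"
  shows "absolutely_continuous lborel (interval_measure (\<lambda>x. f (clamp x)))"
proof -
  define F where "F x = f (clamp x)" for x
  define \<mu> where "\<mu> = interval_measure F"
  have [simp, measurable_cong]: "sets \<mu> = sets borel" by (simp add: \<mu>_def)
  have clamp01: "clamp x \<in> I01" for x by (auto simp: clamp_def)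
  have Fmono: "F x \<le> F y" if "x \<le> y" for x y
    using that clamp01 by (auto simp: F_def clamp_def intro!: mono_onD[OF mono])
  have Fcont: "continuous_on UNIV F"
    unfolding F_def using clamp01
    by (intro continuous_on_compose2[OF cont]) (auto simp: clamp_def intro!: continuous_intros)
  have Icc: "emeasure \<mu> {a..b} = F b - F a" if "a \<le> b" for a b
    unfolding \<mu>_def by (rule emeasure_interval_measure_Icc[OF that Fmono Fcont])
  have small: "emeasure \<mu> N \<le> ennreal e" if N: "N \<in> null_sets lborel" and "e > 0" for N e
  proof -
    obtain d where "d > 0" and d: "\<And>(n::nat) a b.
      (\<And>i. i < n \<Longrightarrow> a i < b i \<and> {a i..b i} \<subseteq> I01) \<Longrightarrow>
      disjoint_family_on (\<lambda>i. {a i<..<b i}) {..<n} \<Longrightarrow> (\<Sum>i<n. b i - a i) < d \<Longrightarrow>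
      (\<Sum>i<n. \<bar>f (b i) - f (a i)\<bar>) < e"
      using abs_cont_onE[OF ac \<open>e > 0\<close>] by blast
    obtain T where T: "open T" "N \<subseteq> T" "emeasure lborel T < ennreal d"
    proof -
      obtain T where "open T" "N \<subseteq> T" "emeasure lborel (T - N) < ennreal d"
        by (rule outer_regular_lborel[of N d]) (use null_setsD2[OF N] \<open>d > 0\<close> in auto)
      moreover have "emeasure lborel (T - N) = emeasure lborel T"
        using N \<open>open T\<close> by (intro emeasure_Diff_null_set) auto
      ultimately show ?thesis using that by auto
    qed
    have fin: "emeasure \<mu> (\<Union>\<F>) \<le> ennreal e"
      if \<F>: "finite \<F>" "\<And>K. K \<in> \<F> \<Longrightarrow> \<exists>a b. K = cbox a b" "\<Union>\<F> \<subseteq> T" for \<F>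
    proof -
      obtain p where p: "p division_of (\<Union>\<F>)"
        using elementary_unions_intervals[OF \<F>(1)] \<F>(2) by blast
      \<comment> \<open>Boxes may stick out of the unit interval or become degenerate after
        clamping. \<open>abs_cont_on\<close> allows neither; the degenerate ones, left out of
        \<open>p'\<close>, carry no mass.\<close>
      define l u where "l K = clamp (Inf K)" and "u K = clamp (Sup K)" for K
      define p' where "p' = {K \<in> p. l K < u K}"
      have finp: "finite p" "finite p'" using p by (auto simp: p'_def)
      have K: "\<exists>a b. a \<le> b \<and> K = {a..b} \<and> l K = clamp a \<and> u K = clamp b" if Kp: "K \<in> p" for K
      proof -
        obtain a b where "K = cbox a b" using division_ofD(4)[OF p Kp] by blast
        moreover have "K \<noteq> {}" using division_ofD(3)[OF p Kp] .
        ultimately show ?thesis by (intro exI[of _ a] exI[of _ b]) (auto simp: l_def u_def)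
      qed
      have Kb: "K \<in> sets borel" if "K \<in> p" for K using K[OF that] by auto
      have muK: "emeasure \<mu> K = ennreal (f (u K) - f (l K))" if "K \<in> p" for K
        using K[OF that] Icc by (auto simp: F_def)
      have int: "{l K<..<u K} \<subseteq> interior K \<and> {l K<..<u K} \<subseteq> K" if "K \<in> p" for K
        using K[OF that] by (auto simp: clamp_def)
      obtain h where h: "bij_betw h {..<card p'} p'"
        using ex_bij_betw_nat_finite[OF finp(2)] by (auto simp: atLeast0LessThan)
      have hp: "h i \<in> p" "l (h i) < u (h i)" if "i < card p'" for i
        using h that by (auto simp: bij_betw_def p'_def)
      have disj: "disjoint_family_on (\<lambda>i. {l (h i)<..<u (h i)}) {..<card p'}"
        unfolding disjoint_family_on_def
      proof (intro ballI impI)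
        fix i j assume ij: "i \<in> {..<card p'}" "j \<in> {..<card p'}" "i \<noteq> j"
        then have "h i \<noteq> h j" using h by (auto simp: bij_betw_def inj_on_def)
        then have "interior (h i) \<inter> interior (h j) = {}"
          using division_ofD(5)[OF p] hp ij by auto
        then show "{l (h i)<..<u (h i)} \<inter> {l (h j)<..<u (h j)} = {}"
          using int[OF hp(1), of i] int[OF hp(1), of j] ij unfolding lessThan_iff by blast
      qed
      have sub: "{l (h i)<..<u (h i)} \<subseteq> T" if "i < card p'" for i
        using int[OF hp(1)[OF that]] division_ofD(2)[OF p hp(1)[OF that]] \<F>(3) by blast
      have "ennreal (\<Sum>i<card p'. u (h i) - l (h i)) = (\<Sum>i<card p'. emeasure lborel {l (h i)<..<u (h i)})"
        using hp by (subst sum_ennreal[symmetric]) (auto simp: less_imp_le intro!: sum.cong)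
      also have "\<dots> = emeasure lborel (\<Union>i<card p'. {l (h i)<..<u (h i)})"
        by (rule sum_emeasure) (use disj in auto)
      also have "\<dots> \<le> emeasure lborel T"
        using sub \<open>open T\<close> by (intro emeasure_mono UN_least) auto
      finally have "ennreal (\<Sum>i<card p'. u (h i) - l (h i)) < ennreal d" using T by auto
      then have sd: "(\<Sum>i<card p'. u (h i) - l (h i)) < d"
        by (subst (asm) ennreal_less_iff[OF sum_nonneg]) (use hp in \<open>auto intro: less_imp_le\<close>)
      have "emeasure \<mu> (\<Union>\<F>) = emeasure \<mu> (\<Union>K\<in>p. K)" using division_ofD(6)[OF p] by simp
      also have "\<dots> \<le> (\<Sum>K\<in>p. emeasure \<mu> K)"
        using Kb finp by (intro emeasure_subadditive_finite) auto
      also have "\<dots> = (\<Sum>K\<in>p. ennreal (f (u K) - f (l K)))"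
        by (intro sum.cong refl muK)
      also have "\<dots> = ennreal (\<Sum>K\<in>p. f (u K) - f (l K))"
      proof (rule sum_ennreal)
        fix k assume "k \<in> p"
        from K[OF this] Fmono show "0 \<le> f (u k) - f (l k)" by (auto simp: F_def)
      qed
      also have "(\<Sum>K\<in>p. f (u K) - f (l K)) = (\<Sum>K\<in>p'. f (u K) - f (l K))"
      proof (rule sum.mono_neutral_right)
        show "\<forall>K\<in>p - p'. f (u K) - f (l K) = 0"
        proof
          fix k assume k: "k \<in> p - p'"
          then have "u k \<le> l k" by (auto simp: p'_def)
          moreover have "l k \<le> u k" using K[of k] k by (auto simp: clamp_def)
          ultimately show "f (u k) - f (l k) = 0" by simp
        qed
      qed (auto simp: finp p'_def)
      also have "\<dots> = (\<Sum>i<card p'. f (u (h i)) - f (l (h i)))"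
        by (rule sum.reindex_bij_betw[OF h, symmetric])
      also have "ennreal (\<Sum>i<card p'. f (u (h i)) - f (l (h i))) \<le>
          ennreal (\<Sum>i<card p'. \<bar>f (u (h i)) - f (l (h i))\<bar>)"
        by (intro ennreal_leI sum_mono) simp
      also have "\<dots> \<le> ennreal e"
        by (rule ennreal_leI[OF less_imp_le[OF d[OF _ disj sd]]]) (use hp clamp01 in \<open>auto simp: l_def u_def clamp_def\<close>)
      finally show ?thesis .
    qed
    obtain D where D: "countable D" "D \<subseteq> Pow T" "\<And>X. X \<in> D \<Longrightarrow> \<exists>a b. X = cbox a b" "\<Union>D = T"
      using open_countable_Union_open_cbox[OF \<open>open T\<close>] by metis
    have "emeasure \<mu> T \<le> ennreal e"
    proof (cases "D = {}")
      case True
      then show ?thesis using D(4) by auto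
    next
      case False
      define X where "X n = (\<Union>i\<le>n. from_nat_into D i)" for n
      have fD: "from_nat_into D i \<in> D" for i using False by (rule from_nat_into)
      have "from_nat_into D i \<in> sets borel" for i using D(3)[OF fD[of i]] by auto
      then have Xs: "range X \<subseteq> sets \<mu>" by (auto simp: X_def)
      have "T = \<Union>(range (from_nat_into D))"
        using D(4) range_from_nat_into[OF False D(1)] by simp
      also have "\<dots> = (\<Union>n. X n)" unfolding X_def by blast
      finally have "T = (\<Union>n. X n)" .
      moreover have inc: "incseq X" by (rule incseq_SucI) (auto simp: X_def atMost_Suc)
      ultimately have "emeasure \<mu> T = (SUP n. emeasure \<mu> (X n))"
        using SUP_emeasure_incseq[OF Xs inc] by simp
      also have "\<dots> \<le> ennreal e"
      proof (rule SUP_least)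
        fix n
        have "X n = \<Union>(from_nat_into D ` {..n})" by (simp add: X_def)
        then show "emeasure \<mu> (X n) \<le> ennreal e"
          using fD D(2,3) by (simp only:) (intro fin; auto)
      qed
      finally show ?thesis .
    qed
    moreover have "emeasure \<mu> N \<le> emeasure \<mu> T"
      using T by (intro emeasure_mono) auto
    ultimately show ?thesis by (rule order_trans[rotated])
  qed
  have "N \<in> null_sets \<mu>" if N: "N \<in> null_sets lborel" for N
  proof -
    have "emeasure \<mu> N \<le> 0"
      by (rule ennreal_le_epsilon) (use small[OF N] in auto)
    then show ?thesis using N by (auto simp: null_sets_def)
  qed
  then show ?thesis unfolding absolutely_continuous_def \<mu>_def F_def by blast
qed

text \<open>Radon-Nikodym for the Stieltjes measure. Only nonnegativity comes out here; strict
  positivity almost everywhere will come from comparing with the density of the inverse.\<close>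

lemma abs_cont_has_density:
  assumes f: "f \<in> H_plus_AC"
  shows "\<exists>\<phi>. integrable unit_measure \<phi> \<and> (\<forall>x. 0 \<le> \<phi> x) \<and>
    (\<forall>y\<in>I01. f y = (\<integral>x. indicator {..y} x * \<phi> x \<partial>unit_measure))"
proof -
  note D = H_plus_AC_D[OF f]
  have mono: "mono_on I01 f" using D(4) by (rule strict_mono_on_imp_mono_on)
  have f01: "f 0 = 0" "f 1 = 1" using strict_mono_on_I01_endpoints[OF D(4) H_plus_AC_image[OF f]] .
  define F where "F x = f (clamp x)" for x
  have ac: "absolutely_continuous lborel (interval_measure F)"
    unfolding F_def by (rule abs_cont_interval_measure_null[OF D(5,3) mono])
  obtain h where h: "h \<in> borel_measurable lborel" "density lborel h = interval_measure F"
    using sigma_finite_measure.Radon_Nikodym[OF sigma_finite_lborel ac] by auto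
  have Fmono: "F x \<le> F y" if "x \<le> y" for x y
    using that by (auto simp: F_def clamp_def intro!: mono_onD[OF mono])
  have Fcont: "continuous_on UNIV F"
    unfolding F_def
    by (intro continuous_on_compose2[OF D(3)]) (auto simp: clamp_def intro!: continuous_intros)
  have [measurable]: "h \<in> borel_measurable unit_measure" "h \<in> borel_measurable borel"
    using h(1) by (auto intro: borel_measurable_unit_measure)
  have nn: "(\<integral>\<^sup>+x. indicator {..y} x * h x \<partial>unit_measure) = ennreal (f y)" if y: "y \<in> I01" for y
  proof -
    have "(\<integral>\<^sup>+x. indicator {..y} x * h x \<partial>unit_measure) = (\<integral>\<^sup>+x. h x * indicator {0..y} x \<partial>lborel)"
      using y by (subst nn_integral_restrict_space) (auto intro!: nn_integral_cong simp: indicator_def)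
    also have "\<dots> = emeasure (density lborel h) {0..y}"
      by (subst emeasure_density) auto
    also have "\<dots> = F y - F 0"
      unfolding h(2) using y by (intro emeasure_interval_measure_Icc Fmono Fcont) auto
    also have "\<dots> = ennreal (f y)" using y f01 by (simp add: F_def clamp_def)
    finally show ?thesis .
  qed
  \<comment> \<open>The Radon-Nikodym derivative takes values in \<open>ennreal\<close>; its total
    mass is \<open>f 1\<close>, so it is finite almost everywhere and \<open>enn2real\<close>
    changes no integral.\<close>
  define \<phi> where "\<phi> x = enn2real (h x)" for x
  have "(\<integral>\<^sup>+x. h x \<partial>unit_measure) = (\<integral>\<^sup>+x. indicator {..1} x * h x \<partial>unit_measure)"
    by (intro nn_integral_cong) (auto simp: indicator_def)
  then have "(\<integral>\<^sup>+x. h x \<partial>unit_measure) \<noteq> \<infinity>" using nn[of 1] by simp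
  then have "AE x in unit_measure. h x \<noteq> \<infinity>" by (intro nn_integral_PInf_AE) auto
  then have AE: "AE x in unit_measure. ennreal (\<phi> x) = h x"
    by eventually_elim (simp add: \<phi>_def ennreal_enn2real less_top)
  have [measurable]: "\<phi> \<in> borel_measurable unit_measure" unfolding \<phi>_def by measurable
  have int: "integrable unit_measure \<phi>"
  proof (rule integrableI_nonneg)
    have "(\<integral>\<^sup>+x. ennreal (\<phi> x) \<partial>unit_measure) = (\<integral>\<^sup>+x. h x \<partial>unit_measure)"
      by (rule nn_integral_cong_AE[OF AE])
    then show "(\<integral>\<^sup>+x. ennreal (\<phi> x) \<partial>unit_measure) < \<infinity>"
      using \<open>_ \<noteq> \<infinity>\<close> by (simp add: less_top)
  qed (auto simp: \<phi>_def)
  have "f y = (\<integral>x. indicator {..y} x * \<phi> x \<partial>unit_measure)" if y: "y \<in> I01" for y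
  proof -
    have "ennreal (\<integral>x. indicator {..y} x * \<phi> x \<partial>unit_measure) = (\<integral>\<^sup>+x. ennreal (indicator {..y} x * \<phi> x) \<partial>unit_measure)"
      by (intro nn_integral_eq_integral[symmetric] indicator_integrable_unit_measure int) (auto simp: \<phi>_def)
    also have "\<dots> = (\<integral>\<^sup>+x. indicator {..y} x * h x \<partial>unit_measure)"
      using AE by (intro nn_integral_cong_AE) (auto simp: indicator_def)
    also have "\<dots> = ennreal (f y)" by (rule nn[OF y])
    finally show ?thesis
    proof (subst (asm) ennreal_inj)
      show "0 \<le> f y" using y H_plus_AC_image[OF f] by auto
      show "0 \<le> (\<integral>x. indicator {..y} x * \<phi> x \<partial>unit_measure)"
        by (intro integral_nonneg_AE) (simp add: \<phi>_def)
    qed simp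
  qed
  moreover have "0 \<le> \<phi> x" for x by (simp add: \<phi>_def)
  ultimately show ?thesis using int by blast
qed

lemma measure_unit_measure_Ioc:
  "0 \<le> a \<Longrightarrow> a \<le> b \<Longrightarrow> b \<le> 1 \<Longrightarrow> measure unit_measure {a<..b} = b - a"
  by (subst measure_restrict_space) auto

section \<open>Primitives of integrable functions\<close>

definition primitive :: "(real \<Rightarrow> real) \<Rightarrow> real \<Rightarrow> real" where
  "primitive \<phi> y = (\<integral>x. indicator {..y} x * \<phi> x \<partial>unit_measure)"

lemma primitive_diff:
  assumes \<phi>: "integrable unit_measure \<phi>" and "x \<le> y"
  shows "primitive \<phi> y - primitive \<phi> x = (\<integral>s. indicator {x<..y} s * \<phi> s \<partial>unit_measure)"
proof -
  have "primitive \<phi> y - primitive \<phi> x =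
      (\<integral>s. indicator {..y} s * \<phi> s - indicator {..x} s * \<phi> s \<partial>unit_measure)"
    unfolding primitive_def
    by (intro Bochner_Integration.integral_diff[symmetric] indicator_integrable_unit_measure \<phi>) auto
  also have "\<dots> = (\<integral>s. indicator {x<..y} s * \<phi> s \<partial>unit_measure)"
    using \<open>x \<le> y\<close> by (intro Bochner_Integration.integral_cong) (auto simp: indicator_def)
  finally show ?thesis .
qed

lemma primitive_0: "primitive \<phi> 0 = 0"
proof -
  have "AE x in unit_measure. x \<notin> {0}"
    by (rule negligible_imp_AE_unit_measure) simp
  then have "AE x in unit_measure. indicator {..0} x * \<phi> x = 0"
    using AE_space by eventually_elim auto
  then show ?thesis unfolding primitive_def by (rule integral_eq_zero_AE)
qed

lemma primitive_1: "primitive \<phi> 1 = (\<integral>x. \<phi> x \<partial>unit_measure)"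
  unfolding primitive_def by (intro Bochner_Integration.integral_cong) (auto simp: indicator_def)

text \<open>Both densities are almost everywhere the derivative of the same function. The endpoints
  are left out because the primitives are known to agree only on the unit interval, while the
  derivative is two-sided.\<close>

lemma primitive_eq_imp_AE_eq:
  assumes \<phi>: "integrable unit_measure \<phi>" and \<psi>: "integrable unit_measure \<psi>"
    and eq: "\<And>y. y \<in> I01 \<Longrightarrow> primitive \<phi> y = primitive \<psi> y"
  shows "AE x in unit_measure. \<phi> x = \<psi> x"
proof -
  have "AE x in unit_measure. x \<notin> {0, 1}"
    by (rule negligible_imp_AE_unit_measure) simp
  with Lebesgue_differentiation[OF \<phi>] Lebesgue_differentiation[OF \<psi>] AE_space
  show ?thesis
  proof eventually_elim
    case (elim x)
    then have x: "x \<in> {0<..<1}" by auto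
    have "(primitive \<phi> has_real_derivative \<phi> x) (at x)" "(primitive \<psi> has_real_derivative \<psi> x) (at x)"
      using elim unfolding primitive_def[abs_def] by auto
    moreover have "(primitive \<phi> has_real_derivative \<psi> x) (at x)"
      by (rule has_field_derivative_transform_within_open[OF calculation(2) _ x]) (auto intro: eq[symmetric])
    ultimately show ?case using DERIV_unique by blast
  qed
qed

text \<open>A bounded density would give a Lipschitz primitive. Here \<open>\<phi>\<close> is split
  into a part \<open>k\<close> bounded by \<open>B\<close>, contributing at most \<open>B\<close>
  times the total length, and a remainder whose whole integral is below \<open>e / 2\<close> and
  which disjoint intervals cannot count twice.\<close>

lemma abs_cont_on_primitive:
  assumes \<phi>: "integrable unit_measure \<phi>"
  shows "abs_cont_on I01 (primitive \<phi>)"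
  unfolding abs_cont_on_def
proof (intro allI impI)
  fix e :: real assume "e > 0"
  then obtain k where k: "continuous_on UNIV k" "(\<integral>x. \<bar>\<phi> x - k x\<bar> \<partial>unit_measure) < e / 2"
    using L1_approx_continuous[OF \<phi>, of "e / 2"] by auto
  have kI: "integrable unit_measure k"
    by (intro continuous_on_integrable_unit_measure continuous_on_subset[OF k(1)]) auto
  have "compact (k ` I01)"
    by (intro compact_continuous_image continuous_on_subset[OF k(1)]) auto
  then obtain B where B: "B > 0" "\<And>x. x \<in> I01 \<Longrightarrow> \<bar>k x\<bar> \<le> B"
    using compact_imp_bounded bounded_pos by (metis imageI real_norm_def)
  have "(\<Sum>i<n. \<bar>primitive \<phi> (b i) - primitive \<phi> (a i)\<bar>) < e"
    if A: "\<forall>i<n. a i < b i \<and> {a i..b i} \<subseteq> I01" and disj: "disjoint_family_on (\<lambda>i. {a i<..<b i}) {..<n}"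
      and small: "(\<Sum>i<n. b i - a i) < e / (2 * B)" for n :: nat and a b :: "nat \<Rightarrow> real"
  proof -
    have ab: "a i < b i" "0 \<le> a i" "b i \<le> 1" if "i < n" for i
      using A that by (auto dest!: spec[of _ i])
    \<comment> \<open>Differences of \<open>primitive\<close> live on half-open intervals. A point
      common to two of these would have common points of the open ones just to its left.\<close>
    have dis: "i = j" if ij: "i < n" "j < n" "s \<in> {a i<..b i}" "s \<in> {a j<..b j}" for i j s
    proof (rule ccontr)
      assume "i \<noteq> j"
      then have "{a i<..<b i} \<inter> {a j<..<b j} = {}"
        using disj ij(1,2) unfolding disjoint_family_on_def by blast
      moreover have "max (a i) (a j) < s" using ij by simp
      then obtain r where "max (a i) (a j) < r" "r < s" using dense by blast
      with ij have "r \<in> {a i<..<b i} \<inter> {a j<..<b j}" by auto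
      ultimately show False by auto
    qed
    have I: "integrable unit_measure (\<lambda>s. indicator {a i<..b i} s * g s)"
      if "integrable unit_measure g" for i and g :: "real \<Rightarrow> real"
      by (intro indicator_integrable_unit_measure that) auto
    have "(\<Sum>i<n. \<bar>primitive \<phi> (b i) - primitive \<phi> (a i)\<bar>)
        \<le> (\<Sum>i<n. \<integral>s. indicator {a i<..b i} s * (\<bar>\<phi> s - k s\<bar> + B) \<partial>unit_measure)"
    proof (rule sum_mono)
      fix i assume "i \<in> {..<n}"
      then have "\<bar>primitive \<phi> (b i) - primitive \<phi> (a i)\<bar> = \<bar>\<integral>s. indicator {a i<..b i} s * \<phi> s \<partial>unit_measure\<bar>"
        using ab by (subst primitive_diff[OF \<phi>]) (auto intro: less_imp_le)
      also have "\<dots> \<le> (\<integral>s. \<bar>indicator {a i<..b i} s * \<phi> s\<bar> \<partial>unit_measure)"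
        by (rule integral_abs_bound)
      also have "\<dots> \<le> (\<integral>s. indicator {a i<..b i} s * (\<bar>\<phi> s - k s\<bar> + B) \<partial>unit_measure)"
      proof (rule integral_mono)
        show "integrable unit_measure (\<lambda>s. \<bar>indicator {a i<..b i} s * \<phi> s\<bar>)"
          using I[OF \<phi>] by (rule integrable_abs)
        show "integrable unit_measure (\<lambda>s. indicator {a i<..b i} s * (\<bar>\<phi> s - k s\<bar> + B))"
          by (rule I) (use \<phi> kI in auto)
        fix s assume "s \<in> space unit_measure"
        then have "\<bar>\<phi> s\<bar> \<le> \<bar>\<phi> s - k s\<bar> + B" using B(2)[of s] by auto
        then show "\<bar>indicator {a i<..b i} s * \<phi> s\<bar> \<le> indicator {a i<..b i} s * (\<bar>\<phi> s - k s\<bar> + B)"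
          by (auto simp: indicator_def)
      qed
      finally show "\<bar>primitive \<phi> (b i) - primitive \<phi> (a i)\<bar> \<le>
          (\<integral>s. indicator {a i<..b i} s * (\<bar>\<phi> s - k s\<bar> + B) \<partial>unit_measure)" .
    qed
    also have "\<dots> = (\<Sum>i<n. (\<integral>s. indicator {a i<..b i} s * \<bar>\<phi> s - k s\<bar> \<partial>unit_measure) + B * (b i - a i))"
    proof (rule sum.cong)
      fix i assume "i \<in> {..<n}"
      then have i: "i < n" by simp
      have "measure unit_measure {a i<..b i} = b i - a i" "{a i<..b i} \<inter> I01 = {a i<..b i}"
        using ab[OF i] by (auto simp: measure_unit_measure_Ioc)
      then have "(\<integral>s. indicator {a i<..b i} s * B \<partial>unit_measure) = B * (b i - a i)" by simp
      moreover have "(\<integral>s. indicator {a i<..b i} s * (\<bar>\<phi> s - k s\<bar> + B) \<partial>unit_measure) =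
         (\<integral>s. indicator {a i<..b i} s * \<bar>\<phi> s - k s\<bar> \<partial>unit_measure) + (\<integral>s. indicator {a i<..b i} s * B \<partial>unit_measure)"
        unfolding distrib_left
        by (rule Bochner_Integration.integral_add[OF I I]) (use \<phi> kI in auto)
      ultimately show "(\<integral>s. indicator {a i<..b i} s * (\<bar>\<phi> s - k s\<bar> + B) \<partial>unit_measure) =
         (\<integral>s. indicator {a i<..b i} s * \<bar>\<phi> s - k s\<bar> \<partial>unit_measure) + B * (b i - a i)" by simp
    qed simp
    also have "\<dots> = (\<integral>s. (\<Sum>i<n. indicator {a i<..b i} s * \<bar>\<phi> s - k s\<bar>) \<partial>unit_measure) + B * (\<Sum>i<n. b i - a i)"
      unfolding sum.distrib sum_distrib_left[symmetric]
      by (subst Bochner_Integration.integral_sum[OF I]) (use \<phi> kI in auto)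
    also have "\<dots> \<le> (\<integral>s. \<bar>\<phi> s - k s\<bar> \<partial>unit_measure) + B * (\<Sum>i<n. b i - a i)"
    proof (intro add_right_mono integral_mono)
      fix s
      show "(\<Sum>i<n. indicator {a i<..b i} s * \<bar>\<phi> s - k s\<bar>) \<le> \<bar>\<phi> s - k s\<bar>"
      proof (cases "\<exists>j<n. s \<in> {a j<..b j}")
        case True
        then obtain j where j: "j < n" "s \<in> {a j<..b j}" by blast
        have "(\<Sum>i<n. indicator {a i<..b i} s * \<bar>\<phi> s - k s\<bar>) =
            (\<Sum>i<n. if i = j then \<bar>\<phi> s - k s\<bar> else 0)"
        proof (rule sum.cong)
          fix i assume "i \<in> {..<n}"
          then have "i \<noteq> j \<Longrightarrow> s \<notin> {a i<..b i}" using dis j by blast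
          then show "indicator {a i<..b i} s * \<bar>\<phi> s - k s\<bar> = (if i = j then \<bar>\<phi> s - k s\<bar> else 0)"
            using j by (cases "i = j") simp_all
        qed simp
        also have "\<dots> = \<bar>\<phi> s - k s\<bar>" using j by (subst sum.delta) auto
        finally show ?thesis by (rule eq_refl)
      next
        case False
        then have "(\<Sum>i<n. indicator {a i<..b i} s * \<bar>\<phi> s - k s\<bar>) = 0"
          by (intro sum.neutral) (auto simp: indicator_def)
        then show ?thesis by (simp only: abs_ge_zero)
      qed
    next
      show "integrable unit_measure (\<lambda>s. \<Sum>i<n. indicator {a i<..b i} s * \<bar>\<phi> s - k s\<bar>)"
        by (intro Bochner_Integration.integrable_sum I) (use \<phi> kI in auto)
      show "integrable unit_measure (\<lambda>s. \<bar>\<phi> s - k s\<bar>)"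
        using \<phi> kI by auto
    qed
    also have "\<dots> < e / 2 + B * (e / (2 * B))"
      using small B(1) by (intro add_strict_mono k(2) mult_strict_left_mono)
    also have "\<dots> = e" using B(1) by simp
    finally show ?thesis .
  qed
  then show "\<exists>\<delta>>0. \<forall>(n::nat) a b. (\<forall>i<n. a i < b i \<and> {a i..b i} \<subseteq> I01) \<and>
       disjoint_family_on (\<lambda>i. {a i<..<b i}) {..<n} \<and> (\<Sum>i<n. b i - a i) < \<delta> \<longrightarrow>
       (\<Sum>i<n. \<bar>primitive \<phi> (b i) - primitive \<phi> (a i)\<bar>) < e"
    using \<open>e > 0\<close> B(1) by (intro exI[of _ "e / (2 * B)"]) auto
qed

lemma abs_cont_on_imp_continuous_on:
  assumes "abs_cont_on I01 f"
  shows "continuous_on I01 f"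
  unfolding continuous_on_iff
proof (intro ballI allI impI)
  fix x e :: real assume x: "x \<in> I01" and "e > 0"
  obtain d where "d > 0" and d: "\<And>(n::nat) a b.
      (\<And>i. i < n \<Longrightarrow> a i < b i \<and> {a i..b i} \<subseteq> I01) \<Longrightarrow>
      disjoint_family_on (\<lambda>i. {a i<..<b i}) {..<n} \<Longrightarrow> (\<Sum>i<n. b i - a i) < d \<Longrightarrow>
      (\<Sum>i<n. \<bar>f (b i) - f (a i)\<bar>) < e"
    using abs_cont_onE[OF assms \<open>e > 0\<close>] by blast
  have *: "\<bar>f v - f u\<bar> < e" if "u < v" "u \<in> I01" "v \<in> I01" "v - u < d" for u v
    using d[of 1 "\<lambda>_. u" "\<lambda>_. v"] that by (auto simp: disjoint_family_on_def)
  have "dist (f y) (f x) < e" if "y \<in> I01" "dist y x < d" for y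
    using *[of x y] *[of y x] that x \<open>e > 0\<close>
    by (cases x y rule: linorder_cases) (auto simp: dist_real_def abs_minus_commute)
  then show "\<exists>d>0. \<forall>y\<in>I01. dist y x < d \<longrightarrow> dist (f y) (f x) < e" using \<open>d > 0\<close> by blast
qed

lemma primitive_strict_mono:
  assumes \<phi>: "integrable unit_measure \<phi>" "\<And>x. 0 < \<phi> x"
  shows "strict_mono_on I01 (primitive \<phi>)"
proof (rule strict_mono_onI)
  fix x y :: real assume xy: "x \<in> I01" "y \<in> I01" "x < y"
  have I: "integrable unit_measure (\<lambda>s. indicator {x<..y} s * \<phi> s)"
    by (intro indicator_integrable_unit_measure \<phi>) auto
  have nn: "0 \<le> indicator {x<..y} s * \<phi> s" for s
    using \<phi>(2)[of s] by (simp add: indicator_def)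
  have "(\<integral>s. indicator {x<..y} s * \<phi> s \<partial>unit_measure) \<noteq> 0"
  proof
    assume "(\<integral>s. indicator {x<..y} s * \<phi> s \<partial>unit_measure) = 0"
    then have "AE s in unit_measure. indicator {x<..y} s * \<phi> s = 0"
      by (subst (asm) integral_nonneg_eq_0_iff_AE[OF I]) (simp_all add: nn)
    then have "AE s in unit_measure. s \<notin> {x<..y}"
      by eventually_elim (use \<phi>(2) in \<open>auto simp: indicator_def less_imp_neq[symmetric] split: if_splits\<close>)
    then have "{x<..y} \<in> null_sets unit_measure"
      using xy by (subst AE_iff_null_sets) (auto simp: sets_restrict_space image_iff intro!: bexI[of _ "{x<..y}"])
    then show False using xy by (auto simp: null_sets_unit_measure_iff)
  qed
  moreover have "0 \<le> (\<integral>s. indicator {x<..y} s * \<phi> s \<partial>unit_measure)"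
    by (intro integral_nonneg_AE) (simp add: nn)
  ultimately have "0 < (\<integral>s. indicator {x<..y} s * \<phi> s \<partial>unit_measure)" by simp
  then show "primitive \<phi> x < primitive \<phi> y"
    using primitive_diff[OF \<phi>(1), of x y] xy by simp
qed

section \<open>Substitution by push-forward of measures\<close>

lemma measurable_unit_measure_bij:
  assumes "bij_betw f I01 I01" "continuous_on I01 f"
  shows "inv_into I01 f \<in> unit_measure \<rightarrow>\<^sub>M unit_measure" "f \<in> unit_measure \<rightarrow>\<^sub>M unit_measure"
proof -
  have *: "g \<in> unit_measure \<rightarrow>\<^sub>M unit_measure" if "continuous_on I01 g" "g ` I01 \<subseteq> I01" for g
    by (rule measurable_restrict_space2)
      (use that continuous_on_borel_measurable_unit_measure[OF that(1)] in auto)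
  show "f \<in> unit_measure \<rightarrow>\<^sub>M unit_measure"
    by (rule *) (use assms in \<open>auto simp: bij_betw_def\<close>)
  have "continuous_on (f ` I01) (inv_into I01 f)"
    by (rule continuous_on_inv[OF assms(2) compact_Icc]) (use assms(1) in \<open>simp add: bij_betw_def\<close>)
  then show "inv_into I01 f \<in> unit_measure \<rightarrow>\<^sub>M unit_measure"
    using assms(1) by (intro *) (auto simp: bij_betw_def intro: inv_into_into)
qed

text \<open>Rays determine a finite Borel measure on the line, and for \<open>y\<close> in the unit
  interval the preimage of \<open>{y<..}\<close> is \<open>{c<..1}\<close> with
  \<open>f c = y\<close>, which has mass \<open>1 - y\<close> by the formula for \<open>f\<close>.
  Both measures are first carried to the whole line, where comparison on rays applies.\<close>

theorem distr_primitive: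
  assumes bij: "bij_betw f I01 I01" and cont: "continuous_on I01 f" and mono: "strict_mono_on I01 f"
    and \<phi>: "integrable unit_measure \<phi>" "\<And>x. 0 \<le> \<phi> x"
    and f: "\<And>y. y \<in> I01 \<Longrightarrow> f y = primitive \<phi> y"
  shows "distr (density unit_measure (\<lambda>x. ennreal (\<phi> x))) unit_measure f = unit_measure"
proof -
  note fM = measurable_unit_measure_bij(2)[OF bij cont]
  have im: "f ` I01 = I01" using bij by (simp add: bij_betw_def)
  note f01 = strict_mono_on_I01_endpoints[OF mono im]
  have fB: "f \<in> borel_measurable unit_measure"
    by (rule continuous_on_borel_measurable_unit_measure[OF cont])
  have idB: "(\<lambda>x. x) \<in> unit_measure \<rightarrow>\<^sub>M borel" by (rule borel_measurable_unit_measure) simp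
  have [measurable]: "\<phi> \<in> borel_measurable unit_measure" using \<phi> by auto
  define N1 where "N1 = distr (density unit_measure (\<lambda>x. ennreal (\<phi> x))) borel f"
  define N2 where "N2 = distr unit_measure borel (\<lambda>x. x)"
  have N1: "emeasure N1 A = ennreal (\<integral>x. indicator (f -` A \<inter> I01) x * \<phi> x \<partial>unit_measure)"
    if "A \<in> sets borel" for A
  proof -
    have m: "f -` A \<inter> I01 \<in> sets unit_measure" using measurable_sets[OF fB that] by simp
    then have m': "f -` A \<inter> I01 \<in> sets borel" by (auto simp: sets_restrict_space)
    have "emeasure N1 A = (\<integral>\<^sup>+x. ennreal (\<phi> x) * indicator (f -` A \<inter> I01) x \<partial>unit_measure)"
      unfolding N1_def using that fB m by (simp add: emeasure_distr emeasure_density)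
    also have "\<dots> = (\<integral>\<^sup>+x. ennreal (indicator (f -` A \<inter> I01) x * \<phi> x) \<partial>unit_measure)"
      by (intro nn_integral_cong) (auto simp: indicator_def)
    also have "\<dots> = ennreal (\<integral>x. indicator (f -` A \<inter> I01) x * \<phi> x \<partial>unit_measure)"
      by (intro nn_integral_eq_integral indicator_integrable_unit_measure \<phi>(1) m') (simp add: \<phi>)
    finally show ?thesis .
  qed
  have N2: "emeasure N2 A = emeasure lborel (A \<inter> I01)" if "A \<in> sets borel" for A
    unfolding N2_def using that idB emeasure_unit_measure[OF that] by (simp add: emeasure_distr)
  have "N1 = N2"
  proof (rule measure_eqI_lessThan)
    fix y :: real
    show "emeasure N1 {y<..} < \<infinity>" by (simp add: N1)
    consider "y < 0" | "y \<in> I01" | "1 < y" by force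
    then show "emeasure N1 {y<..} = emeasure N2 {y<..}"
    proof cases
      case 1
      then have "f -` {y<..} \<inter> I01 = I01" "{y<..} \<inter> I01 = I01" using im by force+
      moreover have "(\<integral>x. indicator I01 x * \<phi> x \<partial>unit_measure) = primitive \<phi> 1"
        unfolding primitive_1 by (intro Bochner_Integration.integral_cong) (auto simp: indicator_def)
      ultimately show ?thesis using f[of 1] f01 by (simp add: N1 N2)
    next
      case 2
      then obtain c where c: "c \<in> I01" "f c = y" using im by (metis imageE)
      have "f -` {y<..} \<inter> I01 = {c<..1}"
        using c strict_mono_on_less[OF mono] by auto
      moreover have "(\<integral>x. indicator {c<..1} x * \<phi> x \<partial>unit_measure) = 1 - y"
        using primitive_diff[OF \<phi>(1), of c 1] f[of 1] f[of c] c f01 by simp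
      moreover have "{y<..} \<inter> I01 = {y<..1}" using 2 by auto
      ultimately show ?thesis using 2 by (simp add: N1 N2)
    next
      case 3
      then have "f -` {y<..} \<inter> I01 = {}" "{y<..} \<inter> I01 = {}" using im by force+
      then show ?thesis by (simp add: N1 N2)
    qed
  qed (auto simp: N1_def N2_def)
  show ?thesis
  proof (rule measure_eqI)
    fix A assume "A \<in> sets (distr (density unit_measure (\<lambda>x. ennreal (\<phi> x))) unit_measure f)"
    then have A: "A \<in> sets unit_measure" by simp
    then have A': "A \<in> sets borel" "A \<subseteq> I01" by (auto simp: sets_restrict_space)
    have "emeasure (distr (density unit_measure (\<lambda>x. ennreal (\<phi> x))) unit_measure f) A = emeasure N1 A"
      unfolding N1_def using A A' fM fB by (simp add: emeasure_distr)
    also have "\<dots> = emeasure unit_measure A"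
      unfolding \<open>N1 = N2\<close> N2_def using A' idB by (simp add: emeasure_distr Int_absorb2)
    finally show "emeasure (distr (density unit_measure (\<lambda>x. ennreal (\<phi> x))) unit_measure f) A = emeasure unit_measure A" .
  qed simp
qed

text \<open>Substitution needs no derivative of \<open>f\<close> at any point: integration against a
  density and integration against an image measure are joined by
  \<open>distr_primitive\<close>.\<close>

lemma change_of_variables:
  assumes bij: "bij_betw f I01 I01" and cont: "continuous_on I01 f" and mono: "strict_mono_on I01 f"
    and \<phi>: "integrable unit_measure \<phi>" "\<And>x. 0 \<le> \<phi> x"
    and f: "\<And>y. y \<in> I01 \<Longrightarrow> f y = primitive \<phi> y"
    and k: "k \<in> borel_measurable unit_measure"
  shows "integrable unit_measure (\<lambda>x. k (f x) * \<phi> x) \<longleftrightarrow> integrable unit_measure k"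
    and "(\<integral>x. k (f x) * \<phi> x \<partial>unit_measure) = (\<integral>x. k x \<partial>unit_measure)"
proof -
  note fM = measurable_unit_measure_bij(2)[OF bij cont]
  have d: "distr (density unit_measure (\<lambda>x. ennreal (\<phi> x))) unit_measure f = unit_measure"
    by (rule distr_primitive[OF bij cont mono \<phi> f])
  have [measurable]: "\<phi> \<in> borel_measurable unit_measure" using \<phi> by auto
  have kf: "(\<lambda>x. k (f x)) \<in> borel_measurable unit_measure" using fM k by (rule measurable_compose)
  have "integrable (distr (density unit_measure (\<lambda>x. ennreal (\<phi> x))) unit_measure f) k \<longleftrightarrow>
      integrable (density unit_measure (\<lambda>x. ennreal (\<phi> x))) (\<lambda>x. k (f x))"
    by (rule integrable_distr_eq) (use fM k in auto)
  also have "\<dots> \<longleftrightarrow> integrable unit_measure (\<lambda>x. k (f x) * \<phi> x)"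
    using kf by (subst integrable_density) (auto simp: \<phi> mult.commute)
  finally show "integrable unit_measure (\<lambda>x. k (f x) * \<phi> x) \<longleftrightarrow> integrable unit_measure k"
    unfolding d by simp
  have "(\<integral>x. k x \<partial>distr (density unit_measure (\<lambda>x. ennreal (\<phi> x))) unit_measure f) =
      (\<integral>x. k (f x) \<partial>density unit_measure (\<lambda>x. ennreal (\<phi> x)))"
    by (rule integral_distr) (use fM k in auto)
  also have "\<dots> = (\<integral>x. k (f x) * \<phi> x \<partial>unit_measure)"
    using kf by (subst integral_density) (auto simp: \<phi> mult.commute)
  finally show "(\<integral>x. k (f x) * \<phi> x \<partial>unit_measure) = (\<integral>x. k x \<partial>unit_measure)"
    unfolding d by simp
qed

text \<open>The chain rule in integrated form. Monotonicity turns the cut \<open>x \<le> y\<close>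
  into the cut of \<open>f x\<close> at \<open>f y\<close>, after which the substitution applies to
  the truncated \<open>k\<close>.\<close>

lemma primitive_compose:
  assumes bij: "bij_betw f I01 I01" and cont: "continuous_on I01 f" and mono: "strict_mono_on I01 f"
    and \<phi>: "integrable unit_measure \<phi>" "\<And>x. 0 \<le> \<phi> x"
    and f: "\<And>y. y \<in> I01 \<Longrightarrow> f y = primitive \<phi> y"
    and k: "k \<in> borel_measurable unit_measure" and y: "y \<in> I01"
  shows "primitive (\<lambda>x. k (f x) * \<phi> x) y = primitive k (f y)"
proof -
  have "f y \<in> I01" using bij y by (auto simp: bij_betw_def)
  have "indicator {..y} x = (indicator {..f y} (f x) :: real)" if "x \<in> I01" for x
    using strict_mono_on_less_eq[OF mono that y] by (simp add: indicator_def)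
  then have "primitive (\<lambda>x. k (f x) * \<phi> x) y =
      (\<integral>x. (indicator {..f y} (f x) * k (f x)) * \<phi> x \<partial>unit_measure)"
    unfolding primitive_def by (intro Bochner_Integration.integral_cong) auto
  also have "\<dots> = primitive k (f y)"
    unfolding primitive_def
    by (rule change_of_variables(2)[OF bij cont mono \<phi> f, where k="\<lambda>x. indicator {..f y} x * k x"])
      (assumption, intro borel_measurable_times[OF borel_measurable_unit_measure k], auto)
  finally show ?thesis .
qed

lemma primitive_cong_AE:
  assumes "\<phi> \<in> borel_measurable unit_measure" "\<psi> \<in> borel_measurable unit_measure"
    "AE x in unit_measure. \<phi> x = \<psi> x"
  shows "primitive \<phi> y = primitive \<psi> y"
  unfolding primitive_def
  using assms(3)
  by (intro integral_cong_AE borel_measurable_times[OF borel_measurable_unit_measure] assms(1,2))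
    (auto elim: eventually_mono)

lemma primitive_cong: "(\<And>x. x \<in> I01 \<Longrightarrow> \<phi> x = \<psi> x) \<Longrightarrow> primitive \<phi> y = primitive \<psi> y"
  unfolding primitive_def by (intro Bochner_Integration.integral_cong) auto

lemma primitive_one: "y \<in> I01 \<Longrightarrow> primitive (\<lambda>_. 1) y = y"
proof -
  assume y: "y \<in> I01"
  have "{0<..y} \<inter> I01 = {0<..y}" using y by auto
  then show ?thesis
    using primitive_diff[of "\<lambda>_. 1" 0 y] y measure_unit_measure_Ioc[of 0 y] by (simp add: primitive_0)
qed

text \<open>A density only matters almost everywhere on the unit interval; the representative is chosen positive
  on the whole line, so that its products with compositions need no side conditions.\<close>

definition has_density :: "(real \<Rightarrow> real) \<Rightarrow> (real \<Rightarrow> real) \<Rightarrow> bool" where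
  "has_density f \<phi> \<longleftrightarrow> f \<in> H_plus_AC \<and> integrable unit_measure \<phi> \<and> (\<forall>x. 0 < \<phi> x) \<and>
    (\<forall>y\<in>I01. f y = primitive \<phi> y)"

lemma has_densityD:
  assumes "has_density f \<phi>"
  shows "f \<in> H_plus_AC" "integrable unit_measure \<phi>" "\<And>x. 0 < \<phi> x" "\<And>x. 0 \<le> \<phi> x"
    "\<And>y. y \<in> I01 \<Longrightarrow> f y = primitive \<phi> y" "\<phi> \<in> borel_measurable unit_measure"
  using assms by (auto simp: has_density_def less_imp_le)

lemma restrict_inv_in_H_plus_AC:
  assumes "f \<in> H_plus_AC" shows "restrict (inv_into I01 f) I01 \<in> H_plus_AC"
  using subgroup.m_inv_closed[OF subgroup_H_plus_AC assms] inv_BijGroup[OF H_plus_AC_D(1)[OF assms]]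
  by simp

lemma H_plus_AC_has_density:
  assumes f: "f \<in> H_plus_AC"
  shows "\<exists>\<phi>. has_density f \<phi>"
proof -
  obtain \<phi> where \<phi>: "integrable unit_measure \<phi>" "\<And>x. 0 \<le> \<phi> x"
    and f\<phi>: "\<And>y. y \<in> I01 \<Longrightarrow> f y = primitive \<phi> y"
    using abs_cont_has_density[OF f] unfolding primitive_def by blast
  obtain \<gamma> where \<gamma>: "integrable unit_measure \<gamma>" "\<And>x. 0 \<le> \<gamma> x"
    and f\<gamma>: "\<And>y. y \<in> I01 \<Longrightarrow> restrict (inv_into I01 f) I01 y = primitive \<gamma> y"
    using abs_cont_has_density[OF restrict_inv_in_H_plus_AC[OF f]] unfolding primitive_def by blast
  note D = H_plus_AC_D[OF f]
  have \<gamma>m: "\<gamma> \<in> borel_measurable unit_measure" using \<gamma> by auto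
  have [measurable]: "\<phi> \<in> borel_measurable unit_measure" using \<phi> by auto
  \<comment> \<open>the chain rule for \<open>f\<^sup>-\<^sup>1 \<circ> f\<close> forces \<open>\<phi> > 0\<close> almost everywhere\<close>
  have "AE x in unit_measure. \<gamma> (f x) * \<phi> x = 1"
  proof (rule primitive_eq_imp_AE_eq)
    show "integrable unit_measure (\<lambda>x. \<gamma> (f x) * \<phi> x)"
      using change_of_variables(1)[OF D(2-4) \<phi> f\<phi> \<gamma>m] \<gamma>(1) by simp
    fix y assume y: "y \<in> I01"
    then have fy: "f y \<in> I01" using H_plus_AC_image[OF f] by auto
    have "primitive (\<lambda>x. \<gamma> (f x) * \<phi> x) y = primitive \<gamma> (f y)"
      by (rule primitive_compose[OF D(2-4) \<phi> f\<phi> \<gamma>m y])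
    also have "\<dots> = y" using f\<gamma>[OF fy] fy D(2) y by (simp add: bij_betw_def)
    finally show "primitive (\<lambda>x. \<gamma> (f x) * \<phi> x) y = primitive (\<lambda>_. 1) y" using y by (simp add: primitive_one)
  qed simp
  \<comment> \<open>A product equal to 1 excludes zeros of \<open>\<phi>\<close> outside a null set;
    overwriting the zeros by 1 changes no integral.\<close>
  then have pos: "AE x in unit_measure. \<phi> x = (if 0 < \<phi> x then \<phi> x else 1)"
    by eventually_elim (use \<phi>(2) in \<open>auto simp: less_le\<close>)
  have m: "(\<lambda>x. if 0 < \<phi> x then \<phi> x else 1) \<in> borel_measurable unit_measure" by measurable
  have "has_density f (\<lambda>x. if 0 < \<phi> x then \<phi> x else 1)"
    unfolding has_density_def
    using f integrable_cong_AE_imp[OF \<phi>(1) m pos] primitive_cong_AE[OF _ m pos] f\<phi> by auto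
  then show ?thesis by blast
qed

text \<open>The way to build group elements: a positive density of mass one is enough. The inverse
  is absolutely continuous because its density is \<open>1 / \<phi>\<close> composed with the
  inverse, which is integrable by substitution since \<open>k (f x) * \<phi> x = 1\<close>.\<close>

lemma has_densityI:
  assumes ext: "f \<in> extensional I01" and \<phi>: "integrable unit_measure \<phi>" "\<And>x. 0 < \<phi> x"
    and f: "\<And>y. y \<in> I01 \<Longrightarrow> f y = primitive \<phi> y" and f1: "f 1 = 1"
  shows "has_density f \<phi>"
proof -
  have nn: "0 \<le> \<phi> x" for x using \<phi>(2)[of x] by simp
  have ac: "abs_cont_on I01 f"
    by (rule abs_cont_on_cong[OF abs_cont_on_primitive[OF \<phi>(1)]]) (simp add: f)
  have cont: "continuous_on I01 f" by (rule abs_cont_on_imp_continuous_on[OF ac])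
  have mono: "strict_mono_on I01 f"
    using primitive_strict_mono[OF \<phi>] f by (simp add: strict_mono_on_def)
  have f0: "f 0 = 0" using f[of 0] primitive_0 by simp
  have "f ` I01 = I01"
  proof
    show "f ` I01 \<subseteq> I01"
    proof
      fix z assume "z \<in> f ` I01"
      then obtain x where x: "x \<in> I01" "z = f x" by blast
      have "f 0 \<le> f x" by (rule strict_mono_on_leD[OF mono]) (use x in auto)
      moreover have "f x \<le> f 1" by (rule strict_mono_on_leD[OF mono]) (use x in auto)
      ultimately show "z \<in> I01" using x f0 f1 by simp
    qed
    show "I01 \<subseteq> f ` I01"
    proof
      fix y :: real assume "y \<in> I01"
      then obtain x where "0 \<le> x" "x \<le> 1" "f x = y"
        using IVT'[of f 0 y 1] f0 f1 cont by auto
      then show "y \<in> f ` I01" by auto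
    qed
  qed
  then have bij: "bij_betw f I01 I01"
    using mono by (simp add: bij_betw_def strict_mono_on_imp_inj_on)
  let ?g = "inv_into I01 f"
  define k where "k = (\<lambda>s. 1 / \<phi> (?g s))"
  have [measurable]: "\<phi> \<in> borel_measurable unit_measure" using \<phi> by auto
  have [measurable]: "?g \<in> unit_measure \<rightarrow>\<^sub>M unit_measure"
    by (rule measurable_unit_measure_bij(1)[OF bij cont])
  have km: "k \<in> borel_measurable unit_measure" unfolding k_def by measurable
  have k1: "k (f x) * \<phi> x = 1" if "x \<in> I01" for x
    using that bij \<phi>(2)[of x] by (simp add: k_def bij_betw_def)
  have "integrable unit_measure (\<lambda>x. k (f x) * \<phi> x)"
    by (rule Bochner_Integration.integrable_cong[THEN iffD2, OF refl, of _ _ "\<lambda>_. 1"]) (auto simp: k1)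
  then have kI: "integrable unit_measure k"
    using change_of_variables(1)[OF bij cont mono \<phi>(1) nn f km] by simp
  have "?g y = primitive k y" if y: "y \<in> I01" for y
  proof -
    have gy: "?g y \<in> I01" "f (?g y) = y"
      using y \<open>f ` I01 = I01\<close> by (metis inv_into_into, metis f_inv_into_f)
    have "primitive k (f (?g y)) = primitive (\<lambda>x. k (f x) * \<phi> x) (?g y)"
      by (rule primitive_compose[OF bij cont mono \<phi>(1) nn f km gy(1), symmetric])
    also have "\<dots> = primitive (\<lambda>_. 1) (?g y)" by (rule primitive_cong) (simp add: k1)
    finally show ?thesis using gy by (simp add: primitive_one)
  qed
  then have "abs_cont_on I01 ?g"
    by (intro abs_cont_on_cong[OF abs_cont_on_primitive[OF kI]]) simp
  then have "f \<in> H_plus_AC"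
    using ext bij by (intro H_plus_AC_I cont mono ac) (auto simp: Bij_def)
  then show ?thesis using \<phi> f by (simp add: has_density_def)
qed

section \<open>The metric as a distance of densities\<close>

text \<open>Lebesgue differentiation for \<open>primitive \<phi>\<close>, transferred to
  \<open>f\<close>. An extensional \<open>f\<close> is \<open>undefined\<close> outside the unit
  interval, so the transfer works only at interior points, where \<open>f\<close> and its primitive
  agree nearby.\<close>

lemma deriv_eq_density:
  assumes "has_density f \<phi>"
  shows "AE x in unit_measure. deriv f x = \<phi> x"
proof -
  note D = has_densityD[OF assms]
  have "AE x in unit_measure. x \<notin> {0, 1}"
    by (rule negligible_imp_AE_unit_measure) simp
  with Lebesgue_differentiation[OF D(2)] AE_space
  show ?thesis
  proof eventually_elim
    case (elim x)
    then have x: "x \<in> {0<..<1}" by auto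
    have "(primitive \<phi> has_real_derivative \<phi> x) (at x)"
      using elim unfolding primitive_def[abs_def] by auto
    then have "(f has_real_derivative \<phi> x) (at x)"
      by (rule has_field_derivative_transform_within_open[OF _ _ x]) (auto simp: D(5))
    then show ?case by (rule DERIV_imp_deriv)
  qed
qed

text \<open>From here on distances are computed from densities. \<open>rho\<close> integrates over
  the completed measure, where measurability of the integrand with \<open>deriv\<close> is inherited
  from its almost everywhere equality with a Borel function.\<close>

theorem rho_eq:
  assumes f: "has_density f \<phi>" and g: "has_density g \<psi>"
  shows "rho f g = (\<integral>x. \<bar>\<phi> x - \<psi> x\<bar> \<partial>unit_measure)"
proof -
  note F = has_densityD[OF f] and G = has_densityD[OF g]
  have "AE x in unit_measure. \<bar>deriv f x - deriv g x\<bar> = \<bar>\<phi> x - \<psi> x\<bar>"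
    using deriv_eq_density[OF f] deriv_eq_density[OF g] by eventually_elim simp
  then have "AE x in lborel. x \<in> I01 \<longrightarrow> \<bar>deriv f x - deriv g x\<bar> = \<bar>\<phi> x - \<psi> x\<bar>"
    by (subst (asm) AE_restrict_space_iff) auto
  then have "AE x in lborel. indicator I01 x *\<^sub>R \<bar>\<phi> x - \<psi> x\<bar> = indicator I01 x *\<^sub>R \<bar>deriv f x - deriv g x\<bar>"
    by eventually_elim (auto simp: indicator_def)
  then have ae: "AE x in lebesgue. indicator I01 x *\<^sub>R \<bar>\<phi> x - \<psi> x\<bar> = indicator I01 x *\<^sub>R \<bar>deriv f x - deriv g x\<bar>"
    by (rule AE_completion)
  have "integrable unit_measure (\<lambda>x. \<bar>\<phi> x - \<psi> x\<bar>)" using F G by auto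
  then have "integrable lborel (\<lambda>x. indicator I01 x *\<^sub>R \<bar>\<phi> x - \<psi> x\<bar>)"
    by (subst (asm) integrable_restrict_space) auto
  then have m: "(\<lambda>x. indicator I01 x *\<^sub>R \<bar>\<phi> x - \<psi> x\<bar>) \<in> borel_measurable lborel" by auto
  then have m': "(\<lambda>x. indicator I01 x *\<^sub>R \<bar>\<phi> x - \<psi> x\<bar>) \<in> borel_measurable lebesgue"
    by (rule measurable_completion)
  have "rho f g = (\<integral>x. indicator I01 x *\<^sub>R \<bar>deriv f x - deriv g x\<bar> \<partial>lebesgue)"
    unfolding rho_def set_lebesgue_integral_def ..
  also have "\<dots> = (\<integral>x. indicator I01 x *\<^sub>R \<bar>\<phi> x - \<psi> x\<bar> \<partial>lebesgue)"
    by (rule integral_cong_AE[symmetric, OF m' borel_measurable_AE[OF m' ae] ae])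
  also have "\<dots> = (\<integral>x. indicator I01 x *\<^sub>R \<bar>\<phi> x - \<psi> x\<bar> \<partial>lborel)"
    by (rule integral_completion[OF m])
  also have "\<dots> = (\<integral>x. \<bar>\<phi> x - \<psi> x\<bar> \<partial>unit_measure)"
    by (rule integral_restrict_space[symmetric]) simp
  finally show ?thesis .
qed

lemma H_plus_AC_ext:
  assumes "f \<in> H_plus_AC" "g \<in> H_plus_AC" "\<And>x. x \<in> I01 \<Longrightarrow> f x = g x"
  shows "f = g"
  using assms H_plus_AC_D(1)[of f] H_plus_AC_D(1)[of g]
  by (intro extensionalityI[of _ I01]) (auto simp: Bij_def)

interpretation H: Metric_space H_plus_AC rho
proof
  have rhoE: "\<exists>\<phi> \<psi>. has_density f \<phi> \<and> has_density g \<psi> \<and> rho f g = (\<integral>x. \<bar>\<phi> x - \<psi> x\<bar> \<partial>unit_measure)"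
    if "f \<in> H_plus_AC" "g \<in> H_plus_AC" for f g
    using that H_plus_AC_has_density rho_eq by metis
  \<comment> \<open>Nonnegativity and symmetry are required for all functions, members of
    \<open>H_plus_AC\<close> or not, so they come from the integral itself; the other two axioms go
    through densities.\<close>
  show "0 \<le> rho f g" for f g
    unfolding rho_def set_lebesgue_integral_def by (intro integral_nonneg_AE) auto
  show "rho f g = rho g f" for f g
    unfolding rho_def by (simp add: abs_minus_commute)
  show "rho f g = 0 \<longleftrightarrow> f = g" if fg: "f \<in> H_plus_AC" "g \<in> H_plus_AC" for f g
  proof
    obtain \<phi> \<psi> where d: "has_density f \<phi>" "has_density g \<psi>"
      "rho f g = (\<integral>x. \<bar>\<phi> x - \<psi> x\<bar> \<partial>unit_measure)"
      using rhoE[OF fg] by blast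
    note F = has_densityD[OF d(1)] and G = has_densityD[OF d(2)]
    assume "rho f g = 0"
    moreover have "integrable unit_measure (\<lambda>x. \<bar>\<phi> x - \<psi> x\<bar>)" using F G by auto
    ultimately have "AE x in unit_measure. \<bar>\<phi> x - \<psi> x\<bar> = 0"
      using integral_nonneg_eq_0_iff_AE[of unit_measure "\<lambda>x. \<bar>\<phi> x - \<psi> x\<bar>"] d(3) by auto
    then have "AE x in unit_measure. \<phi> x = \<psi> x" by eventually_elim simp
    then show "f = g"
      using F G by (intro H_plus_AC_ext) (auto intro: primitive_cong_AE)
  qed (simp add: rho_def set_lebesgue_integral_def)
  show "rho f h \<le> rho f g + rho g h" if fgh: "f \<in> H_plus_AC" "g \<in> H_plus_AC" "h \<in> H_plus_AC" for f g h
  proof -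
    obtain \<phi> \<psi> \<eta> where d: "has_density f \<phi>" "has_density g \<psi>" "has_density h \<eta>"
      using fgh H_plus_AC_has_density by metis
    have I: "integrable unit_measure \<phi>" "integrable unit_measure \<psi>" "integrable unit_measure \<eta>"
      using d has_densityD by auto
    have "(\<integral>x. \<bar>\<phi> x - \<eta> x\<bar> \<partial>unit_measure) \<le> (\<integral>x. \<bar>\<phi> x - \<psi> x\<bar> + \<bar>\<psi> x - \<eta> x\<bar> \<partial>unit_measure)"
      using I by (intro integral_mono) auto
    also have "\<dots> = (\<integral>x. \<bar>\<phi> x - \<psi> x\<bar> \<partial>unit_measure) + (\<integral>x. \<bar>\<psi> x - \<eta> x\<bar> \<partial>unit_measure)"
      using I by (intro Bochner_Integration.integral_add) auto
    finally show ?thesis using d by (simp add: rho_eq)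
  qed
qed

section \<open>The topological group of absolutely continuous homeomorphisms\<close>

interpretation G: group H_plus_AC_group by (rule group_H_plus_AC)

lemma carrier_H_plus_AC_group [simp]: "carrier H_plus_AC_group = H_plus_AC"
  by (simp add: H_plus_AC_group_def)

lemma mult_apply:
  "f \<in> H_plus_AC \<Longrightarrow> g \<in> H_plus_AC \<Longrightarrow> x \<in> I01 \<Longrightarrow> (f \<otimes>\<^bsub>H_plus_AC_group\<^esub> g) x = f (g x)"
  using H_plus_AC_D(1)[of f] H_plus_AC_D(1)[of g]
  by (simp add: H_plus_AC_group_def BijGroup_def compose_def)

lemma one_apply: "x \<in> I01 \<Longrightarrow> \<one>\<^bsub>H_plus_AC_group\<^esub> x = x"
  by (simp add: H_plus_AC_group_def BijGroup_def)

lemma H_plus_AC_in_I01: "f \<in> H_plus_AC \<Longrightarrow> x \<in> I01 \<Longrightarrow> f x \<in> I01"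
  using H_plus_AC_image by blast

lemma inv_apply_left: "f \<in> H_plus_AC \<Longrightarrow> x \<in> I01 \<Longrightarrow> (inv\<^bsub>H_plus_AC_group\<^esub> f) (f x) = x"
  using mult_apply[of "inv\<^bsub>H_plus_AC_group\<^esub> f" f x] G.l_inv[of f] G.inv_closed[of f] one_apply[of x] by simp

lemma inv_apply_right: "f \<in> H_plus_AC \<Longrightarrow> x \<in> I01 \<Longrightarrow> f ((inv\<^bsub>H_plus_AC_group\<^esub> f) x) = x"
  using mult_apply[of f "inv\<^bsub>H_plus_AC_group\<^esub> f" x] G.r_inv[of f] G.inv_closed[of f] one_apply[of x] by simp

lemma H_plus_AC_le_iff: "f \<in> H_plus_AC \<Longrightarrow> x \<in> I01 \<Longrightarrow> y \<in> I01 \<Longrightarrow> f x \<le> f y \<longleftrightarrow> x \<le> y"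
  using strict_mono_on_less_eq[OF H_plus_AC_D(4)] by blast

lemma H_plus_AC_less_iff: "f \<in> H_plus_AC \<Longrightarrow> x \<in> I01 \<Longrightarrow> y \<in> I01 \<Longrightarrow> f x < f y \<longleftrightarrow> x < y"
  using strict_mono_on_less[OF H_plus_AC_D(4)] by blast

lemma H_plus_AC_endpoints: "f \<in> H_plus_AC \<Longrightarrow> f 0 = 0" "f \<in> H_plus_AC \<Longrightarrow> f 1 = 1"
  using strict_mono_on_I01_endpoints[OF H_plus_AC_D(4) H_plus_AC_image] by auto

lemma has_density_change_of_variables:
  assumes g: "has_density g \<psi>" and k: "k \<in> borel_measurable unit_measure"
  shows "integrable unit_measure (\<lambda>x. k (g x) * \<psi> x) \<longleftrightarrow> integrable unit_measure k"
    and "(\<integral>x. k (g x) * \<psi> x \<partial>unit_measure) = (\<integral>x. k x \<partial>unit_measure)"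
proof -
  note D = has_densityD[OF g]
  note H = H_plus_AC_D[OF D(1)]
  show "integrable unit_measure (\<lambda>x. k (g x) * \<psi> x) \<longleftrightarrow> integrable unit_measure k"
    by (rule change_of_variables(1)[OF H(2-4) D(2,4,5) k])
  show "(\<integral>x. k (g x) * \<psi> x \<partial>unit_measure) = (\<integral>x. k x \<partial>unit_measure)"
    by (rule change_of_variables(2)[OF H(2-4) D(2,4,5) k])
qed

lemma has_density_integral: "has_density f \<phi> \<Longrightarrow> (\<integral>x. \<phi> x \<partial>unit_measure) = 1"
  using has_density_change_of_variables(2)[of f \<phi> "\<lambda>_. 1"] measure_unit_measure_Ioc[of 0 1]
  by (simp add: measure_restrict_space)

lemma has_density_mult:
  assumes f: "has_density f \<phi>" and g: "has_density g \<psi>"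
  shows "has_density (f \<otimes>\<^bsub>H_plus_AC_group\<^esub> g) (\<lambda>x. \<phi> (g x) * \<psi> x)"
proof -
  note F = has_densityD[OF f] and D = has_densityD[OF g]
  note H = H_plus_AC_D[OF D(1)]
  have "f \<otimes>\<^bsub>H_plus_AC_group\<^esub> g \<in> H_plus_AC" using G.m_closed[of f g] F D by simp
  moreover have "integrable unit_measure (\<lambda>x. \<phi> (g x) * \<psi> x)"
    using has_density_change_of_variables(1)[OF g F(6)] F(2) by simp
  moreover have "0 < \<phi> (g x) * \<psi> x" for x using F(3) D(3) by simp
  moreover have "(f \<otimes>\<^bsub>H_plus_AC_group\<^esub> g) y = primitive (\<lambda>x. \<phi> (g x) * \<psi> x) y" if "y \<in> I01" for y
    using primitive_compose[OF H(2-4) D(2,4,5) F(6) that]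
      mult_apply[OF F(1) D(1) that] F(5) H_plus_AC_in_I01[OF D(1) that] by simp
  ultimately show ?thesis by (simp add: has_density_def)
qed

text \<open>Both densities acquire the same factor \<open>\<eta>\<close>, so the integral changes by
  a substitution along \<open>h\<close> only.\<close>

lemma rho_mult_right:
  assumes "f \<in> H_plus_AC" "g \<in> H_plus_AC" "h \<in> H_plus_AC"
  shows "rho (f \<otimes>\<^bsub>H_plus_AC_group\<^esub> h) (g \<otimes>\<^bsub>H_plus_AC_group\<^esub> h) = rho f g"
proof -
  obtain \<phi> \<psi> \<eta> where d: "has_density f \<phi>" "has_density g \<psi>" "has_density h \<eta>"
    using assms H_plus_AC_has_density by metis
  note F = has_densityD[OF d(1)] and G = has_densityD[OF d(2)] and H = has_densityD[OF d(3)]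
  have "rho (f \<otimes>\<^bsub>H_plus_AC_group\<^esub> h) (g \<otimes>\<^bsub>H_plus_AC_group\<^esub> h) =
      (\<integral>x. \<bar>\<phi> (h x) * \<eta> x - \<psi> (h x) * \<eta> x\<bar> \<partial>unit_measure)"
    by (rule rho_eq) (intro has_density_mult d)+
  also have "\<dots> = (\<integral>x. \<bar>\<phi> (h x) - \<psi> (h x)\<bar> * \<eta> x \<partial>unit_measure)"
    using H(4) by (simp add: abs_mult left_diff_distrib[symmetric])
  also have "\<dots> = (\<integral>x. \<bar>\<phi> x - \<psi> x\<bar> \<partial>unit_measure)"
    by (rule has_density_change_of_variables(2)[OF d(3), where k="\<lambda>x. \<bar>\<phi> x - \<psi> x\<bar>"])
      (use F(6) G(6) in measurable)
  also have "\<dots> = rho f g" by (rule rho_eq[OF d(1,2), symmetric])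
  finally show ?thesis .
qed

text \<open>Both functions start at 0, so the total variation of their difference bounds it
  uniformly.\<close>

lemma rho_bound_pointwise:
  assumes "f \<in> H_plus_AC" "g \<in> H_plus_AC" "x \<in> I01"
  shows "\<bar>f x - g x\<bar> \<le> rho f g"
proof -
  obtain \<phi> \<psi> where d: "has_density f \<phi>" "has_density g \<psi>"
    using assms H_plus_AC_has_density by metis
  note F = has_densityD[OF d(1)] and G = has_densityD[OF d(2)]
  have "f x - g x = (\<integral>s. indicator {..x} s * \<phi> s - indicator {..x} s * \<psi> s \<partial>unit_measure)"
    unfolding F(5)[OF assms(3)] G(5)[OF assms(3)] primitive_def
    by (intro Bochner_Integration.integral_diff[symmetric] indicator_integrable_unit_measure F(2) G(2)) auto
  then have "\<bar>f x - g x\<bar> \<le> (\<integral>s. \<bar>indicator {..x} s * \<phi> s - indicator {..x} s * \<psi> s\<bar> \<partial>unit_measure)"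
    by (simp only: integral_abs_bound)
  also have "\<dots> \<le> (\<integral>s. \<bar>\<phi> s - \<psi> s\<bar> \<partial>unit_measure)"
  proof (rule integral_mono)
    show "integrable unit_measure (\<lambda>s. \<bar>indicator {..x} s * \<phi> s - indicator {..x} s * \<psi> s\<bar>)"
      by (intro integrable_abs Bochner_Integration.integrable_diff indicator_integrable_unit_measure F(2) G(2)) auto
    show "integrable unit_measure (\<lambda>s. \<bar>\<phi> s - \<psi> s\<bar>)" using F(2) G(2) by auto
  qed (auto simp: indicator_def)
  also have "\<dots> = rho f g" by (rule rho_eq[OF d, symmetric])
  finally show ?thesis .
qed

text \<open>Left translation is no isometry: the density becomes
  \<open>\<phi> (g x) * \<psi> x\<close>, and pointwise control of \<open>\<phi> (g x)\<close> is
  hopeless for merely integrable \<open>\<phi>\<close>. So \<open>\<phi>\<close> is replaced by a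
  continuous \<open>k\<close>. The error of the replacement is the same for every \<open>g\<close>,
  by substitution, and for \<open>k\<close> uniform continuity suffices.\<close>

lemma rho_mult_left_continuous:
  assumes f: "f \<in> H_plus_AC" and g0: "g0 \<in> H_plus_AC" and "e > 0"
  shows "\<exists>d>0. \<forall>g\<in>H_plus_AC. rho g g0 < d \<longrightarrow>
    rho (f \<otimes>\<^bsub>H_plus_AC_group\<^esub> g) (f \<otimes>\<^bsub>H_plus_AC_group\<^esub> g0) < e"
proof -
  obtain \<phi> \<psi>0 where \<phi>: "has_density f \<phi>" and \<psi>0: "has_density g0 \<psi>0"
    using f g0 H_plus_AC_has_density by metis
  note F = has_densityD[OF \<phi>] and G0 = has_densityD[OF \<psi>0]
  obtain k where k: "continuous_on UNIV k" "(\<integral>x. \<bar>\<phi> x - k x\<bar> \<partial>unit_measure) < e / 4"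
    using L1_approx_continuous[OF F(2), of "e / 4"] \<open>e > 0\<close> by auto
  have kc: "continuous_on I01 k" by (rule continuous_on_subset[OF k(1)]) simp
  have km: "k \<in> borel_measurable unit_measure"
    by (rule continuous_on_borel_measurable_unit_measure[OF kc])
  have \<phi>k: "(\<lambda>x. \<bar>\<phi> x - k x\<bar>) \<in> borel_measurable unit_measure" using F(6) km by measurable
  have \<phi>kI: "integrable unit_measure (\<lambda>x. \<bar>\<phi> x - k x\<bar>)"
    using F(2) continuous_on_integrable_unit_measure[OF kc] by auto
  have "compact (k ` I01)" by (intro compact_continuous_image kc compact_Icc)
  then obtain B where B: "B > 0" "\<And>x. x \<in> I01 \<Longrightarrow> \<bar>k x\<bar> \<le> B"
    using compact_imp_bounded bounded_pos by (metis imageI real_norm_def)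
  have "uniformly_continuous_on I01 k" by (intro compact_uniformly_continuous kc compact_Icc)
  then obtain d' where d': "d' > 0" "\<And>x y. x \<in> I01 \<Longrightarrow> y \<in> I01 \<Longrightarrow> \<bar>x - y\<bar> < d' \<Longrightarrow> \<bar>k x - k y\<bar> < e / 4"
    using \<open>e > 0\<close> unfolding uniformly_continuous_on_def dist_real_def
    by (metis zero_less_divide_iff zero_less_numeral)
  \<comment> \<open>The first bound makes \<open>g\<close> and \<open>g0\<close> uniformly
    \<open>d'\<close>-close through \<open>rho_bound_pointwise\<close>; the second keeps
    \<open>B * rho g g0\<close> within \<open>e / 4\<close>, the share of each of the four
    errors.\<close>
  define d where "d = min d' (e / (4 * B))"
  have "d > 0" using d' B \<open>e > 0\<close> by (simp add: d_def)
  moreover have "rho (f \<otimes>\<^bsub>H_plus_AC_group\<^esub> g) (f \<otimes>\<^bsub>H_plus_AC_group\<^esub> g0) < e"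
    if g: "g \<in> H_plus_AC" and gd: "rho g g0 < d" for g
  proof -
    obtain \<psi> where \<psi>: "has_density g \<psi>" using g H_plus_AC_has_density by metis
    note G = has_densityD[OF \<psi>]
    have gm: "g \<in> unit_measure \<rightarrow>\<^sub>M unit_measure" "g0 \<in> unit_measure \<rightarrow>\<^sub>M unit_measure"
      using measurable_unit_measure_bij(2) H_plus_AC_D(2,3) g g0 by blast+
    have [measurable]: "(\<lambda>x. k (g x)) \<in> borel_measurable unit_measure" "(\<lambda>x. k (g0 x)) \<in> borel_measurable unit_measure"
      using gm km by (auto intro: measurable_compose)
    have kB: "\<bar>k (g x)\<bar> \<le> B" "\<bar>k (g0 x)\<bar> \<le> B" if "x \<in> I01" for x
      using B(2) H_plus_AC_in_I01[OF g that] H_plus_AC_in_I01[OF g0 that] by auto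
    have I1: "integrable unit_measure (\<lambda>x. \<bar>\<phi> (g x) - k (g x)\<bar> * \<psi> x)"
      using has_density_change_of_variables(1)[OF \<psi> \<phi>k] \<phi>kI by simp
    have I2: "integrable unit_measure (\<lambda>x. \<bar>\<phi> (g0 x) - k (g0 x)\<bar> * \<psi>0 x)"
      using has_density_change_of_variables(1)[OF \<psi>0 \<phi>k] \<phi>kI by simp
    have I3: "integrable unit_measure (\<lambda>x. B * \<bar>\<psi> x - \<psi>0 x\<bar>)" using G(2) G0(2) by auto
    have I4: "integrable unit_measure (\<lambda>x. e / 4 * \<psi>0 x)" using G0(2) by auto
    have "rho (f \<otimes>\<^bsub>H_plus_AC_group\<^esub> g) (f \<otimes>\<^bsub>H_plus_AC_group\<^esub> g0) =
        (\<integral>x. \<bar>\<phi> (g x) * \<psi> x - \<phi> (g0 x) * \<psi>0 x\<bar> \<partial>unit_measure)"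
      by (rule rho_eq) (intro has_density_mult \<phi> \<psi> \<psi>0)+
    also have "\<dots> \<le> (\<integral>x. \<bar>\<phi> (g x) - k (g x)\<bar> * \<psi> x + \<bar>\<phi> (g0 x) - k (g0 x)\<bar> * \<psi>0 x
        + B * \<bar>\<psi> x - \<psi>0 x\<bar> + e / 4 * \<psi>0 x \<partial>unit_measure)"
    proof (rule integral_mono)
      show "integrable unit_measure (\<lambda>x. \<bar>\<phi> (g x) * \<psi> x - \<phi> (g0 x) * \<psi>0 x\<bar>)"
        using has_densityD(2)[OF has_density_mult[OF \<phi> \<psi>]] has_densityD(2)[OF has_density_mult[OF \<phi> \<psi>0]]
        by auto
      show "integrable unit_measure (\<lambda>x. \<bar>\<phi> (g x) - k (g x)\<bar> * \<psi> x + \<bar>\<phi> (g0 x) - k (g0 x)\<bar> * \<psi>0 x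
        + B * \<bar>\<psi> x - \<psi>0 x\<bar> + e / 4 * \<psi>0 x)"
        by (intro Bochner_Integration.integrable_add I1 I2 I3 I4)
      fix x assume "x \<in> space unit_measure"
      then have x: "x \<in> I01" by simp
      have "\<bar>g x - g0 x\<bar> < d'" using rho_bound_pointwise[OF g g0 x] gd by (simp add: d_def)
      then have kk: "\<bar>k (g x) - k (g0 x)\<bar> \<le> e / 4"
        using d'(2) H_plus_AC_in_I01[OF g x] H_plus_AC_in_I01[OF g0 x] by (simp add: less_imp_le)
      have "\<phi> (g x) * \<psi> x - \<phi> (g0 x) * \<psi>0 x = (\<phi> (g x) - k (g x)) * \<psi> x
          - (\<phi> (g0 x) - k (g0 x)) * \<psi>0 x + k (g x) * (\<psi> x - \<psi>0 x) + (k (g x) - k (g0 x)) * \<psi>0 x"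
        by (simp add: algebra_simps)
      then have "\<bar>\<phi> (g x) * \<psi> x - \<phi> (g0 x) * \<psi>0 x\<bar> \<le> \<bar>(\<phi> (g x) - k (g x)) * \<psi> x\<bar>
          + \<bar>(\<phi> (g0 x) - k (g0 x)) * \<psi>0 x\<bar> + \<bar>k (g x) * (\<psi> x - \<psi>0 x)\<bar> + \<bar>(k (g x) - k (g0 x)) * \<psi>0 x\<bar>"
        by linarith
      also have "\<dots> \<le> \<bar>\<phi> (g x) - k (g x)\<bar> * \<psi> x + \<bar>\<phi> (g0 x) - k (g0 x)\<bar> * \<psi>0 x
        + B * \<bar>\<psi> x - \<psi>0 x\<bar> + e / 4 * \<psi>0 x"
        unfolding abs_mult
        using G(4)[of x] G0(4)[of x] kk kB(1)[OF x] \<open>e > 0\<close> B(1)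
        by (intro add_mono mult_mono) auto
      finally show "\<bar>\<phi> (g x) * \<psi> x - \<phi> (g0 x) * \<psi>0 x\<bar> \<le> \<bar>\<phi> (g x) - k (g x)\<bar> * \<psi> x
        + \<bar>\<phi> (g0 x) - k (g0 x)\<bar> * \<psi>0 x + B * \<bar>\<psi> x - \<psi>0 x\<bar> + e / 4 * \<psi>0 x" .
    qed
    also have "\<dots> = (\<integral>x. \<bar>\<phi> (g x) - k (g x)\<bar> * \<psi> x \<partial>unit_measure) + (\<integral>x. \<bar>\<phi> (g0 x) - k (g0 x)\<bar> * \<psi>0 x \<partial>unit_measure)
        + (\<integral>x. B * \<bar>\<psi> x - \<psi>0 x\<bar> \<partial>unit_measure) + (\<integral>x. e / 4 * \<psi>0 x \<partial>unit_measure)"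
      using I1 I2 I3 I4
      by (simp only: Bochner_Integration.integral_add Bochner_Integration.integrable_add)
    also have "(\<integral>x. \<bar>\<phi> (g x) - k (g x)\<bar> * \<psi> x \<partial>unit_measure) = (\<integral>x. \<bar>\<phi> x - k x\<bar> \<partial>unit_measure)"
      by (rule has_density_change_of_variables(2)[OF \<psi> \<phi>k])
    also have "(\<integral>x. \<bar>\<phi> (g0 x) - k (g0 x)\<bar> * \<psi>0 x \<partial>unit_measure) = (\<integral>x. \<bar>\<phi> x - k x\<bar> \<partial>unit_measure)"
      by (rule has_density_change_of_variables(2)[OF \<psi>0 \<phi>k])
    also have "(\<integral>x. B * \<bar>\<psi> x - \<psi>0 x\<bar> \<partial>unit_measure) = B * rho g g0"
      using rho_eq[OF \<psi> \<psi>0] by simp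
    also have "(\<integral>x. e / 4 * \<psi>0 x \<partial>unit_measure) = e / 4"
      using has_density_integral[OF \<psi>0] by simp
    finally have "rho (f \<otimes>\<^bsub>H_plus_AC_group\<^esub> g) (f \<otimes>\<^bsub>H_plus_AC_group\<^esub> g0) \<le>
      (\<integral>x. \<bar>\<phi> x - k x\<bar> \<partial>unit_measure) + (\<integral>x. \<bar>\<phi> x - k x\<bar> \<partial>unit_measure) + B * rho g g0 + e / 4" .
    moreover have "B * rho g g0 \<le> e / 4"
    proof -
      have "rho g g0 \<le> e / (4 * B)" using gd by (simp add: d_def)
      then show ?thesis using B(1) by (simp add: field_simps)
    qed
    ultimately show ?thesis using k(2) by linarith
  qed
  ultimately show ?thesis by blast
qed

text \<open>In the triangle through the product of \<open>f0\<close> and \<open>g\<close>, one side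
  is a right translate of the pair \<open>f\<close>, \<open>f0\<close>, and only the other needs
  continuity of a left translation.\<close>

lemma rho_mult_continuous:
  assumes f0: "f0 \<in> H_plus_AC" and g0: "g0 \<in> H_plus_AC" and "e > 0"
  shows "\<exists>d>0. \<forall>f\<in>H_plus_AC. \<forall>g\<in>H_plus_AC. rho f f0 < d \<longrightarrow> rho g g0 < d \<longrightarrow>
    rho (f \<otimes>\<^bsub>H_plus_AC_group\<^esub> g) (f0 \<otimes>\<^bsub>H_plus_AC_group\<^esub> g0) < e"
proof -
  obtain d where d: "d > 0" "\<And>g. g \<in> H_plus_AC \<Longrightarrow> rho g g0 < d \<Longrightarrow>
    rho (f0 \<otimes>\<^bsub>H_plus_AC_group\<^esub> g) (f0 \<otimes>\<^bsub>H_plus_AC_group\<^esub> g0) < e / 2"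
    using rho_mult_left_continuous[OF f0 g0, of "e / 2"] \<open>e > 0\<close> by auto
  have "rho (f \<otimes>\<^bsub>H_plus_AC_group\<^esub> g) (f0 \<otimes>\<^bsub>H_plus_AC_group\<^esub> g0) < e"
    if fg: "f \<in> H_plus_AC" "g \<in> H_plus_AC" "rho f f0 < min d (e / 2)" "rho g g0 < min d (e / 2)" for f g
  proof -
    have "rho (f \<otimes>\<^bsub>H_plus_AC_group\<^esub> g) (f0 \<otimes>\<^bsub>H_plus_AC_group\<^esub> g0) \<le>
        rho (f \<otimes>\<^bsub>H_plus_AC_group\<^esub> g) (f0 \<otimes>\<^bsub>H_plus_AC_group\<^esub> g) +
        rho (f0 \<otimes>\<^bsub>H_plus_AC_group\<^esub> g) (f0 \<otimes>\<^bsub>H_plus_AC_group\<^esub> g0)"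
      using G.m_closed[of f g] G.m_closed[of f0 g] G.m_closed[of f0 g0] fg f0 g0
      by (intro H.triangle) auto
    also have "\<dots> < e / 2 + e / 2"
      using fg d(2) rho_mult_right[OF fg(1) f0 fg(2)] by (intro add_strict_mono) auto
    finally show ?thesis by simp
  qed
  then show ?thesis using d(1) \<open>e > 0\<close> by (intro exI[of _ "min d (e / 2)"]) auto
qed

text \<open>Right translation by \<open>f\<close> turns the distance of the two inverses into the
  distance from the identity to the product of the inverse of \<open>f0\<close> with
  \<open>f\<close>, so continuity of left translation by the inverse of \<open>f0\<close> is
  enough.\<close>

lemma rho_inv_continuous:
  assumes f0: "f0 \<in> H_plus_AC" and "e > 0"
  shows "\<exists>d>0. \<forall>f\<in>H_plus_AC. rho f f0 < d \<longrightarrow> rho (inv\<^bsub>H_plus_AC_group\<^esub> f) (inv\<^bsub>H_plus_AC_group\<^esub> f0) < e"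
proof -
  let ?i = "\<lambda>f. inv\<^bsub>H_plus_AC_group\<^esub> f"
  have i: "?i f \<in> H_plus_AC" if "f \<in> H_plus_AC" for f using G.inv_closed[of f] that by simp
  obtain d where d: "d > 0" "\<And>g. g \<in> H_plus_AC \<Longrightarrow> rho g f0 < d \<Longrightarrow>
    rho (?i f0 \<otimes>\<^bsub>H_plus_AC_group\<^esub> g) (?i f0 \<otimes>\<^bsub>H_plus_AC_group\<^esub> f0) < e"
    using rho_mult_left_continuous[OF i[OF f0] f0 \<open>e > 0\<close>] by auto
  have "rho (?i f) (?i f0) < e" if f: "f \<in> H_plus_AC" "rho f f0 < d" for f
  proof -
    have "rho (?i f) (?i f0) = rho (?i f \<otimes>\<^bsub>H_plus_AC_group\<^esub> f) (?i f0 \<otimes>\<^bsub>H_plus_AC_group\<^esub> f)"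
      by (rule rho_mult_right[symmetric]) (use f f0 i in auto)
    also have "\<dots> = rho (?i f0 \<otimes>\<^bsub>H_plus_AC_group\<^esub> f) (?i f0 \<otimes>\<^bsub>H_plus_AC_group\<^esub> f0)"
      using G.l_inv[of f] G.l_inv[of f0] f f0 by (simp add: H.commute)
    also have "\<dots> < e" by (rule d(2)[OF f])
    finally show ?thesis .
  qed
  then show ?thesis using d(1) by blast
qed

text \<open>A word is a continuous function of its letters. An element of \<open>generate\<close>
  does not record its word, so the induction only claims that a perturbed element exists; it is
  built by the same word in the new letters.\<close>

lemma generate_perturb:
  assumes f0: "f0 \<in> H_plus_AC" and g0: "g0 \<in> H_plus_AC"
    and "u \<in> generate H_plus_AC_group {f0, g0}" and "e > 0"
  shows "\<exists>d>0. \<forall>f\<in>H_plus_AC. \<forall>g\<in>H_plus_AC. rho f f0 < d \<longrightarrow> rho g g0 < d \<longrightarrow>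
    (\<exists>u'\<in>generate H_plus_AC_group {f, g}. rho u' u < e)"
  using assms(3,4)
proof (induction arbitrary: e rule: generate.induct)
  case one
  then show ?case
    using H.zero[of "\<one>\<^bsub>H_plus_AC_group\<^esub>"] G.one_closed
    by (intro exI[of _ 1]) (auto intro!: bexI[OF _ generate.one])
next
  case (incl h)
  then show ?case
    by (intro exI[of _ e]) (auto intro: generate.incl)
next
  case (inv h)
  from inv(1) f0 g0 have "h \<in> H_plus_AC" by auto
  then obtain d where "d > 0" "\<And>f. f \<in> H_plus_AC \<Longrightarrow> rho f h < d \<Longrightarrow>
      rho (inv\<^bsub>H_plus_AC_group\<^esub> f) (inv\<^bsub>H_plus_AC_group\<^esub> h) < e"
    using rho_inv_continuous[OF _ inv(2)] by blast
  then show ?case using inv(1)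
    by (intro exI[of _ d]) (auto intro: generate.inv)
next
  case (eng h1 h2)
  have gen: "h \<in> H_plus_AC" if "h \<in> generate H_plus_AC_group {f, g}" "f \<in> H_plus_AC" "g \<in> H_plus_AC" for f g h
    using G.generate_in_carrier[of "{f, g}" h] that by auto
  have h: "h1 \<in> H_plus_AC" "h2 \<in> H_plus_AC" using eng(1,2) gen f0 g0 by auto
  obtain d where d: "d > 0" "\<And>f g. f \<in> H_plus_AC \<Longrightarrow> g \<in> H_plus_AC \<Longrightarrow> rho f h1 < d \<Longrightarrow> rho g h2 < d \<Longrightarrow>
    rho (f \<otimes>\<^bsub>H_plus_AC_group\<^esub> g) (h1 \<otimes>\<^bsub>H_plus_AC_group\<^esub> h2) < e"
    using rho_mult_continuous[OF h eng(5)] by blast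
  obtain d1 where d1: "d1 > 0" "\<forall>f\<in>H_plus_AC. \<forall>g\<in>H_plus_AC. rho f f0 < d1 \<longrightarrow> rho g g0 < d1 \<longrightarrow>
    (\<exists>u'\<in>generate H_plus_AC_group {f, g}. rho u' h1 < d)"
    using eng(3)[OF d(1)] by blast
  obtain d2 where d2: "d2 > 0" "\<forall>f\<in>H_plus_AC. \<forall>g\<in>H_plus_AC. rho f f0 < d2 \<longrightarrow> rho g g0 < d2 \<longrightarrow>
    (\<exists>u'\<in>generate H_plus_AC_group {f, g}. rho u' h2 < d)"
    using eng(4)[OF d(1)] by blast
  have "\<exists>u'\<in>generate H_plus_AC_group {f, g}. rho u' (h1 \<otimes>\<^bsub>H_plus_AC_group\<^esub> h2) < e"
    if fg: "f \<in> H_plus_AC" "g \<in> H_plus_AC" "rho f f0 < min d1 d2" "rho g g0 < min d1 d2" for f g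
  proof -
    obtain u1 where u1: "u1 \<in> generate H_plus_AC_group {f, g}" "rho u1 h1 < d"
      using d1(2)[rule_format, of f g] fg by auto
    obtain u2 where u2: "u2 \<in> generate H_plus_AC_group {f, g}" "rho u2 h2 < d"
      using d2(2)[rule_format, of f g] fg by auto
    show ?thesis
      using d(2)[OF gen[OF u1(1) fg(1,2)] gen[OF u2(1) fg(1,2)] u1(2) u2(2)] generate.eng[OF u1(1) u2(1)]
      by blast
  qed
  then show ?case using d1 d2 by (intro exI[of _ "min d1 d2"]) auto
qed

section \<open>Separability and perturbations\<close>

lemma measure_unit_measure_I01 [simp]: "measure unit_measure I01 = 1"
  by (simp add: measure_restrict_space)

text \<open>Lists of rationals give a countable index set. On the unit interval powers are at most
  1, so an error of \<open>e / (2 * (n + 1))\<close> in each of the \<open>n + 1\<close>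
  coefficients adds up to \<open>e / 2\<close>.\<close>

lemma L1_approx_rational_polynomial:
  fixes \<phi> :: "real \<Rightarrow> real"
  assumes \<phi>: "integrable unit_measure \<phi>" and "e > 0"
  shows "\<exists>qs. (\<integral>x. \<bar>\<phi> x - (\<Sum>i<length qs. of_rat (qs ! i) * x ^ i)\<bar> \<partial>unit_measure) < e"
proof -
  obtain a n where an: "(\<integral>x. \<bar>\<phi> x - (\<Sum>i\<le>n. a i * x ^ i)\<bar> \<partial>unit_measure) < e / 2"
    using L1_approx_polynomial[OF \<phi>, of "e / 2"] \<open>e > 0\<close> by auto
  have "\<exists>q. a i - e / (2 * real (Suc n)) < real_of_rat q \<and> real_of_rat q < a i" for i
    by (rule of_rat_dense) (use \<open>e > 0\<close> in simp)
  then obtain q where q: "\<And>i. a i - e / (2 * real (Suc n)) < real_of_rat (q i)" "\<And>i. real_of_rat (q i) < a i"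
    by metis
  define p r where "p x = (\<Sum>i\<le>n. a i * x ^ i)" and "r x = (\<Sum>i\<le>n. of_rat (q i) * x ^ i)" for x :: real
  have I: "integrable unit_measure p" "integrable unit_measure r"
    unfolding p_def[abs_def] r_def[abs_def]
    by (intro continuous_on_integrable_unit_measure continuous_intros)+
  have "\<bar>p x - r x\<bar> \<le> e / 2" if x: "x \<in> I01" for x
  proof -
    have "\<bar>p x - r x\<bar> \<le> (\<Sum>i\<le>n. \<bar>(a i - of_rat (q i)) * x ^ i\<bar>)"
      unfolding p_def r_def sum_subtractf[symmetric] left_diff_distrib[symmetric] by (rule sum_abs)
    also have "\<dots> \<le> (\<Sum>i\<le>n. e / (2 * real (Suc n)))"
    proof (rule sum_mono)
      fix i
      have "\<bar>a i - of_rat (q i)\<bar> \<le> e / (2 * real (Suc n))" using q[of i] by linarith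
      moreover have "\<bar>x ^ i\<bar> \<le> 1" using x by (simp add: power_le_one)
      ultimately show "\<bar>(a i - of_rat (q i)) * x ^ i\<bar> \<le> e / (2 * real (Suc n))"
        unfolding abs_mult using mult_mono[of "\<bar>a i - of_rat (q i)\<bar>" "e / (2 * real (Suc n))" "\<bar>x ^ i\<bar>" 1] \<open>e > 0\<close>
        by simp
    qed
    also have "\<dots> = e / 2" by (simp add: field_simps)
    finally show ?thesis .
  qed
  then have "(\<integral>x. \<bar>p x - r x\<bar> \<partial>unit_measure) \<le> e / 2"
    using I by (intro integral_unit_measure_le_const) auto
  moreover have "(\<integral>x. \<bar>\<phi> x - r x\<bar> \<partial>unit_measure) \<le>
      (\<integral>x. \<bar>\<phi> x - p x\<bar> + \<bar>p x - r x\<bar> \<partial>unit_measure)"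
    using \<phi> I by (intro integral_mono) auto
  moreover have "\<dots> = (\<integral>x. \<bar>\<phi> x - p x\<bar> \<partial>unit_measure) + (\<integral>x. \<bar>p x - r x\<bar> \<partial>unit_measure)"
    using \<phi> I by (intro Bochner_Integration.integral_add) auto
  ultimately have "(\<integral>x. \<bar>\<phi> x - r x\<bar> \<partial>unit_measure) < e" using an unfolding p_def by linarith
  moreover have "r x = (\<Sum>i<length (map q [0..<Suc n]). of_rat (map q [0..<Suc n] ! i) * x ^ i)" for x
    unfolding r_def by (rule sum.cong) (auto simp del: upt_Suc)
  ultimately show ?thesis by (intro exI[of _ "map q [0..<Suc n]"]) (simp only:)
qed

text \<open>Rational polynomials are dense in mean but need not be densities: positivity and mass
  one may fail. So each pair of a polynomial and a tolerance selects one group element with density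
  within that tolerance of the polynomial, if there is any.\<close>

lemma H_plus_AC_separable:
  "\<exists>C\<subseteq>H_plus_AC. countable C \<and> (\<forall>h\<in>H_plus_AC. \<forall>e>0. \<exists>c\<in>C. rho c h < e)"
proof -
  define p where "p qs x = (\<Sum>i<length qs. of_rat (qs ! i) * x ^ i)" for qs :: "rat list" and x :: real
  have pI: "integrable unit_measure (p qs)" for qs
    unfolding p_def[abs_def] by (intro continuous_on_integrable_unit_measure continuous_intros)
  define Q where "Q z c \<longleftrightarrow> c \<in> H_plus_AC \<and> (\<exists>\<phi>. has_density c \<phi> \<and>
    (\<integral>x. \<bar>\<phi> x - p (fst z) x\<bar> \<partial>unit_measure) < 1 / real (Suc (snd z)))" for z :: "rat list \<times> nat" and c
  define C where "C = (\<lambda>z. SOME c. Q z c) ` {z. \<exists>c. Q z c}"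
  have QC: "Q z (SOME c. Q z c)" if "\<exists>c. Q z c" for z using that by (rule someI_ex)
  have "countable C" unfolding C_def by (rule countable_image[OF countableI_type])
  moreover have "C \<subseteq> H_plus_AC" using QC unfolding C_def Q_def by blast
  moreover have "\<exists>c\<in>C. rho c h < e" if h: "h \<in> H_plus_AC" and "e > 0" for h e
  proof -
    obtain \<phi> where \<phi>: "has_density h \<phi>" using h H_plus_AC_has_density by blast
    note H = has_densityD[OF \<phi>]
    obtain m where m: "1 / real (Suc m) < e / 2" using nat_approx_posE[of "e / 2"] \<open>e > 0\<close> by auto
    obtain qs where qs: "(\<integral>x. \<bar>\<phi> x - p qs x\<bar> \<partial>unit_measure) < 1 / real (Suc m)"
      using L1_approx_rational_polynomial[OF H(2), of "1 / real (Suc m)"] unfolding p_def by auto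
    have ex: "\<exists>c. Q (qs, m) c" using \<phi> h qs unfolding Q_def by auto
    define c where "c = (SOME c. Q (qs, m) c)"
    have c: "c \<in> C" unfolding c_def C_def using ex by blast
    obtain \<psi> where \<psi>: "has_density c \<psi>" "(\<integral>x. \<bar>\<psi> x - p qs x\<bar> \<partial>unit_measure) < 1 / real (Suc m)"
      using QC[OF ex] unfolding Q_def c_def by auto
    note \<Psi> = has_densityD[OF \<psi>(1)]
    have "rho c h = (\<integral>x. \<bar>\<psi> x - \<phi> x\<bar> \<partial>unit_measure)" by (rule rho_eq[OF \<psi>(1) \<phi>])
    also have "\<dots> \<le> (\<integral>x. \<bar>\<psi> x - p qs x\<bar> + \<bar>\<phi> x - p qs x\<bar> \<partial>unit_measure)"
      using H(2) \<Psi>(2) pI by (intro integral_mono) auto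
    also have "\<dots> = (\<integral>x. \<bar>\<psi> x - p qs x\<bar> \<partial>unit_measure) + (\<integral>x. \<bar>\<phi> x - p qs x\<bar> \<partial>unit_measure)"
      using H(2) \<Psi>(2) pI by (intro Bochner_Integration.integral_add) auto
    also have "\<dots> < e" using qs \<psi>(2) m by linarith
    finally show ?thesis using c by blast
  qed
  ultimately show ?thesis by blast
qed

lemma primitive_FTC:
  assumes "y \<in> I01" "\<And>x. (F has_real_derivative p x) (at x)" "\<And>x. isCont p x"
  shows "primitive p y = F y - F 0"
proof -
  have "primitive p y = (\<integral>x. p x * indicator {0..y} x \<partial>lborel)"
    unfolding primitive_def using assms(1)
    by (subst integral_restrict_space) (auto intro!: Bochner_Integration.integral_cong simp: indicator_def)
  also have "\<dots> = F y - F 0"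
    by (rule integral_FTC_Icc_real) (use assms in auto)
  finally show ?thesis .
qed

lemma primitive_lincomb:
  assumes "integrable unit_measure \<phi>" "integrable unit_measure \<psi>"
  shows "primitive (\<lambda>x. a * \<phi> x + b * \<psi> x) y = a * primitive \<phi> y + b * primitive \<psi> y"
proof -
  have "primitive (\<lambda>x. a * \<phi> x + b * \<psi> x) y =
      (\<integral>x. a * (indicator {..y} x * \<phi> x) + b * (indicator {..y} x * \<psi> x) \<partial>unit_measure)"
    unfolding primitive_def by (intro Bochner_Integration.integral_cong) (auto simp: algebra_simps)
  also have "\<dots> = a * primitive \<phi> y + b * primitive \<psi> y"
    unfolding primitive_def using indicator_integrable_unit_measure[OF assms(1), of "{..y}"]
      indicator_integrable_unit_measure[OF assms(2), of "{..y}"]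
    by (subst Bochner_Integration.integral_add) auto
  finally show ?thesis .
qed

section \<open>Perturbations by explicit densities\<close>

text \<open>Densities form a convex set, and two of mass one are at distance at most 2, whence
  \<open>2 * t\<close>. The square is the partner because it moves every point of
  \<open>(0,1)\<close> and has an explicit density.\<close>

lemma mix_with_square:
  assumes f: "f \<in> H_plus_AC" and t: "0 < t" "t < 1"
  shows "\<exists>g\<in>H_plus_AC. rho g f \<le> 2 * t \<and> (\<forall>x\<in>I01. g x = (1 - t) * f x + t * x\<^sup>2)"
proof -
  obtain \<phi> where \<phi>: "has_density f \<phi>" using f H_plus_AC_has_density by blast
  note F = has_densityD[OF \<phi>]
  \<comment> \<open>the absolute value only keeps \<open>\<psi>\<close> positive off the unit interval\<close>
  define \<psi> where "\<psi> x = (1 - t) * \<phi> x + t * (2 * \<bar>x\<bar>)" for x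
  have I2: "integrable unit_measure (\<lambda>x. 2 * \<bar>x\<bar>)"
    by (intro continuous_on_integrable_unit_measure continuous_intros)
  have sq: "primitive (\<lambda>x. 2 * \<bar>x\<bar>) y = y\<^sup>2" if "y \<in> I01" for y
  proof -
    have "primitive (\<lambda>x. 2 * \<bar>x\<bar>) y = primitive (\<lambda>x. 2 * x) y" by (rule primitive_cong) simp
    also have "\<dots> = y\<^sup>2 - 0\<^sup>2"
      by (rule primitive_FTC[OF that]) (auto intro!: derivative_eq_intros)
    finally show ?thesis by simp
  qed
  define g where "g = restrict (\<lambda>x. (1 - t) * f x + t * x\<^sup>2) I01"
  have g: "has_density g \<psi>"
  proof (rule has_densityI)
    show "integrable unit_measure \<psi>" unfolding \<psi>_def[abs_def] using F(2) I2 by auto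
    show "0 < \<psi> x" for x using F(3)[of x] t by (simp add: \<psi>_def add_pos_nonneg)
    show "g y = primitive \<psi> y" if "y \<in> I01" for y
      unfolding \<psi>_def[abs_def] primitive_lincomb[OF F(2) I2] using that F(5)[OF that] sq[OF that]
      by (simp add: g_def)
    show "g 1 = 1" using H_plus_AC_endpoints(2)[OF f] by (simp add: g_def)
  qed (simp add: g_def)
  have "rho g f = (\<integral>x. \<bar>\<psi> x - \<phi> x\<bar> \<partial>unit_measure)" by (rule rho_eq[OF g \<phi>])
  also have "\<dots> \<le> (\<integral>x. t * (2 * \<bar>x\<bar>) + t * \<phi> x \<partial>unit_measure)"
  proof (rule integral_mono)
    show "integrable unit_measure (\<lambda>x. \<bar>\<psi> x - \<phi> x\<bar>)" using has_densityD(2)[OF g] F(2) by auto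
    show "integrable unit_measure (\<lambda>x. t * (2 * \<bar>x\<bar>) + t * \<phi> x)" using F(2) I2 by auto
    show "\<bar>\<psi> x - \<phi> x\<bar> \<le> t * (2 * \<bar>x\<bar>) + t * \<phi> x" for x
    proof -
      have "\<psi> x - \<phi> x = t * (2 * \<bar>x\<bar>) - t * \<phi> x" by (simp add: \<psi>_def algebra_simps)
      moreover have "0 \<le> t * (2 * \<bar>x\<bar>)" "0 \<le> t * \<phi> x" using t F(4)[of x] by auto
      ultimately show ?thesis by linarith
    qed
  qed
  also have "\<dots> = t * primitive (\<lambda>x. 2 * \<bar>x\<bar>) 1 + t * primitive \<phi> 1"
    unfolding primitive_1 using F(2) I2 by (subst Bochner_Integration.integral_add) auto
  also have "\<dots> = 2 * t" using sq[of 1] F(5)[of 1] H_plus_AC_endpoints(2)[OF f] by simp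
  finally show ?thesis using has_densityD(1)[OF g] by (intro bexI[of _ g]) (auto simp: g_def)
qed

lemma perturb_away_fixpoints:
  assumes f: "f \<in> H_plus_AC" and A: "finite A" "A \<subseteq> {0<..<1}" and "e > 0"
  shows "\<exists>g\<in>H_plus_AC. rho g f < e \<and> (\<forall>x\<in>A. g x \<noteq> x)"
proof -
  define T where "T x = {t. (1 - t) * f x + t * x\<^sup>2 = x}" for x
  \<comment> \<open>the condition is affine in \<open>t\<close>, so a point is fixed for at most one parameter\<close>
  have "finite (T x)" if "x \<in> A" for x
  proof -
    have x: "x \<noteq> x\<^sup>2" using that A(2) by (auto simp: power2_eq_square)
    have "s = t" if "s \<in> T x" "t \<in> T x" for s t
    proof (rule ccontr)
      assume "s \<noteq> t"
      have "(1 - s) * f x + s * x\<^sup>2 = x" "(1 - t) * f x + t * x\<^sup>2 = x" using that by (auto simp: T_def)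
      moreover have "(s - t) * (x\<^sup>2 - f x) = ((1 - s) * f x + s * x\<^sup>2) - ((1 - t) * f x + t * x\<^sup>2)"
        by (simp add: algebra_simps)
      ultimately have "(s - t) * (x\<^sup>2 - f x) = 0" by simp
      then have "f x = x\<^sup>2" using \<open>s \<noteq> t\<close> by simp
      then have "x = x\<^sup>2" using \<open>(1 - s) * f x + s * x\<^sup>2 = x\<close> by (simp add: left_diff_distrib)
      with x show False by simp
    qed
    then have "T x \<subseteq> {t}" if "t \<in> T x" for t using that by blast
    then have "T x = {} \<or> (\<exists>t. T x \<subseteq> {t})" by blast
    then show ?thesis by (auto intro: finite_subset)
  qed
  then have "finite (\<Union>x\<in>A. T x)" using A(1) by blast
  moreover have "infinite {0<..<min 1 (e / 2)}" using \<open>e > 0\<close> by simp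
  ultimately obtain t where t: "t \<in> {0<..<min 1 (e / 2)}" "t \<notin> (\<Union>x\<in>A. T x)"
    by (meson finite_subset subsetI)
  then obtain g where g: "g \<in> H_plus_AC" "rho g f \<le> 2 * t" "\<forall>x\<in>I01. g x = (1 - t) * f x + t * x\<^sup>2"
    using mix_with_square[OF f, of t] by auto
  have "g x \<noteq> x" if "x \<in> A" for x
    using t(2) that A(2) g(3) by (force simp: T_def)
  then show ?thesis using g t(1) by (intro bexI[of _ g]) auto
qed

text \<open>With a polynomial density, \<open>g x - x\<close> is a polynomial on the unit interval:
  it has finitely many zeros or vanishes identically. In the second case \<open>g\<close> is the
  identity, and mixing in the square removes all interior fixed points.\<close>

lemma perturb_finite_fixpoints:
  assumes f: "f \<in> H_plus_AC" and "e > 0"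
  shows "\<exists>g\<in>H_plus_AC. rho g f < e \<and> finite {x \<in> {0<..<1}. g x = x}"
proof -
  obtain \<phi> where \<phi>: "has_density f \<phi>" using f H_plus_AC_has_density by blast
  note F = has_densityD[OF \<phi>]
  \<comment> \<open>The polynomial is within \<open>3 * d\<close> of \<open>\<phi>\<close> in mean
    and normalising it costs another \<open>3 * d\<close>, in all at most \<open>e / 2\<close>. The
    bound \<open>1 / 6\<close> keeps the normaliser \<open>c\<close> positive.\<close>
  define d where "d = min (e / 12) (1 / 6)"
  have d: "d > 0" "d \<le> e / 12" "d \<le> 1 / 6" using \<open>e > 0\<close> by (auto simp: d_def)
  obtain k where k: "continuous_on UNIV k" "(\<integral>x. \<bar>\<phi> x - k x\<bar> \<partial>unit_measure) < d"
    using L1_approx_continuous[OF F(2) d(1)] by blast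
  have kI: "integrable unit_measure k"
    by (intro continuous_on_integrable_unit_measure continuous_on_subset[OF k(1)]) auto
  \<comment> \<open>Cutting at 0 takes \<open>k\<close> no further from the positive
    \<open>\<phi>\<close>, and lifting by \<open>d\<close> before approximating within
    \<open>d\<close> makes the polynomial positive on the unit interval.\<close>
  have "continuous_on I01 (\<lambda>x. max (k x) 0 + d)"
    by (intro continuous_intros continuous_on_subset[OF k(1)]) auto
  then obtain p where p: "real_polynomial_function p" "\<And>x. x \<in> I01 \<Longrightarrow> \<bar>(max (k x) 0 + d) - p x\<bar> < d"
    using Stone_Weierstrass_real_polynomial_function[of I01 "\<lambda>x. max (k x) 0 + d" d] d(1) by blast
  obtain a n where a: "p = (\<lambda>x. \<Sum>i\<le>n. a i * x ^ i)"
    using p(1) unfolding real_polynomial_function_iff_sum by blast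
  have p_pos: "0 < p x" if "x \<in> I01" for x using p(2)[OF that] by linarith
  have pI: "integrable unit_measure p"
    unfolding a by (intro continuous_on_integrable_unit_measure continuous_intros)
  have p\<phi>: "(\<integral>x. \<bar>p x - \<phi> x\<bar> \<partial>unit_measure) \<le> 3 * d"
  proof -
    have "(\<integral>x. \<bar>p x - \<phi> x\<bar> \<partial>unit_measure) \<le> (\<integral>x. \<bar>\<phi> x - k x\<bar> + 2 * d \<partial>unit_measure)"
    proof (rule integral_mono)
      show "\<bar>p x - \<phi> x\<bar> \<le> \<bar>\<phi> x - k x\<bar> + 2 * d" if "x \<in> space unit_measure" for x
        using p(2)[of x] that F(3)[of x] by auto
    qed (use F(2) kI pI in auto)
    also have "\<dots> = (\<integral>x. \<bar>\<phi> x - k x\<bar> \<partial>unit_measure) + 2 * d"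
      using F(2) kI by (subst Bochner_Integration.integral_add) auto
    finally show ?thesis using k(2) by simp
  qed
  define c where "c = (\<integral>x. p x \<partial>unit_measure)"
  have c: "\<bar>c - 1\<bar> \<le> 3 * d"
  proof -
    have "c - 1 = (\<integral>x. p x - \<phi> x \<partial>unit_measure)"
      unfolding c_def using pI F(2) has_density_integral[OF \<phi>]
      by (subst Bochner_Integration.integral_diff) auto
    then have "\<bar>c - 1\<bar> \<le> (\<integral>x. \<bar>p x - \<phi> x\<bar> \<partial>unit_measure)" by (simp only: integral_abs_bound)
    then show ?thesis using p\<phi> by linarith
  qed
  then have c0: "c > 0" using d by linarith
  define P where "P x = (\<Sum>i\<le>n. a i / (c * real (Suc i)) * x ^ Suc i)" for x
  have P_deriv: "(P has_real_derivative p x / c) (at x)" for x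
    unfolding P_def[abs_def] a sum_divide_distrib
  proof (rule DERIV_sum)
    fix i
    have "((\<lambda>x. a i / (c * real (Suc i)) * x ^ Suc i) has_real_derivative
        a i / (c * real (Suc i)) * (real (Suc i) * x ^ i)) (at x)"
      using c0 by (auto intro!: derivative_eq_intros simp del: power_Suc of_nat_Suc)
    also have "a i / (c * real (Suc i)) * (real (Suc i) * x ^ i) = a i * x ^ i / c"
      using c0 by (simp add: field_simps del: of_nat_Suc)
    finally show "((\<lambda>x. a i / (c * real (Suc i)) * x ^ Suc i) has_real_derivative a i * x ^ i / c) (at x)" .
  qed
  have P: "P y = primitive (\<lambda>x. p x / c) y" if "y \<in> I01" for y
    using primitive_FTC[OF that P_deriv] c0 by (simp add: a P_def)
  \<comment> \<open>The polynomial may be negative off the unit interval, whereas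
    \<open>has_density\<close> asks for a positive representative on the whole line.\<close>
  define \<psi> where "\<psi> x = (if x \<in> I01 then p x / c else 1)" for x
  define g where "g = restrict P I01"
  have g: "has_density g \<psi>"
  proof (rule has_densityI)
    show "integrable unit_measure \<psi>"
      by (rule Bochner_Integration.integrable_cong[THEN iffD2, OF refl, of _ _ "\<lambda>x. p x / c"])
        (use pI in \<open>auto simp: \<psi>_def\<close>)
    show "0 < \<psi> x" for x using p_pos c0 by (simp add: \<psi>_def)
    show "g y = primitive \<psi> y" if "y \<in> I01" for y
    proof -
      have "primitive \<psi> y = primitive (\<lambda>x. p x / c) y" by (rule primitive_cong) (simp add: \<psi>_def)
      then show ?thesis using P[OF that] that by (simp add: g_def)
    qed
    show "g 1 = 1" using P[of 1] c0 by (simp add: g_def primitive_1 c_def)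
  qed (simp add: g_def)
  have g_H: "g \<in> H_plus_AC" using has_densityD(1)[OF g] .
  have gf: "rho g f \<le> e / 2"
  proof -
    have "rho g f = (\<integral>x. \<bar>\<psi> x - \<phi> x\<bar> \<partial>unit_measure)" by (rule rho_eq[OF g \<phi>])
    also have "\<dots> \<le> (\<integral>x. \<bar>1 / c - 1\<bar> * p x + \<bar>p x - \<phi> x\<bar> \<partial>unit_measure)"
    proof (rule integral_mono)
      show "\<bar>\<psi> x - \<phi> x\<bar> \<le> \<bar>1 / c - 1\<bar> * p x + \<bar>p x - \<phi> x\<bar>" if "x \<in> space unit_measure" for x
      proof -
        have "\<psi> x - \<phi> x = (1 / c - 1) * p x + (p x - \<phi> x)" using that by (simp add: \<psi>_def algebra_simps)
        then have "\<bar>\<psi> x - \<phi> x\<bar> \<le> \<bar>(1 / c - 1) * p x\<bar> + \<bar>p x - \<phi> x\<bar>" by linarith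
        then show ?thesis using p_pos[of x] that by (simp add: abs_mult)
      qed
    qed (use has_densityD(2)[OF g] F(2) pI in auto)
    also have "\<dots> = \<bar>1 / c - 1\<bar> * c + (\<integral>x. \<bar>p x - \<phi> x\<bar> \<partial>unit_measure)"
      unfolding c_def using pI F(2) by (subst Bochner_Integration.integral_add) auto
    also have "\<bar>1 / c - 1\<bar> * c = \<bar>c - 1\<bar>"
    proof -
      have "\<bar>1 / c - 1\<bar> * c = \<bar>(1 / c - 1) * c\<bar>" using c0 by (simp add: abs_mult)
      also have "\<dots> = \<bar>c - 1\<bar>" using c0 by (simp add: algebra_simps abs_minus_commute)
      finally show ?thesis .
    qed
    finally show ?thesis using c p\<phi> d by linarith
  qed
  have "real_polynomial_function (\<lambda>x. P x - x)"
    unfolding P_def[abs_def]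
    by (intro real_polynomial_function_diff real_polynomial_function_sum real_polynomial_function.intros
        real_polynomial_function_power) (auto simp: bounded_linear_ident)
  then obtain b m where b: "\<And>x. P x - x = (\<Sum>i\<le>m. b i * x ^ i)"
    unfolding real_polynomial_function_iff_sum by metis
  show ?thesis
  proof (cases "\<exists>j\<le>m. b j \<noteq> 0")
    case True
    then have "finite {x. P x - x = 0}" unfolding b polyfun_finite_roots by simp
    then have "finite {x \<in> {0<..<1}. g x = x}"
      by (rule rev_finite_subset) (auto simp: g_def)
    then show ?thesis using g_H gf \<open>e > 0\<close> by (intro bexI[of _ g]) auto
  next
    case False
    then have id: "g x = x" if "x \<in> I01" for x using b[of x] that by (simp add: g_def)
    \<comment> \<open>Mixing adds at most \<open>e / 4\<close> to the \<open>e / 2\<close> already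
      spent.\<close>
    define t where "t = min (1 / 2) (e / 8)"
    have t: "0 < t" "t < 1" "t \<le> e / 8" using \<open>e > 0\<close> by (auto simp: t_def)
    obtain h where h: "h \<in> H_plus_AC" "rho h g \<le> 2 * t" "\<forall>x\<in>I01. h x = (1 - t) * g x + t * x\<^sup>2"
      using mix_with_square[OF g_H t(1,2)] by blast
    have "h x \<noteq> x" if "x \<in> {0<..<1}" for x
    proof
      assume "h x = x"
      moreover have "h x = (1 - t) * x + t * x\<^sup>2" using h(3) id[of x] that by simp
      ultimately have "t * (x * (x - 1)) = 0" by (simp add: algebra_simps power2_eq_square)
      then show False using t that by auto
    qed
    then have "{x \<in> {0<..<1}. h x = x} = {}" by blast
    then have "finite {x \<in> {0<..<1}. h x = x}" by (simp only: finite.emptyI)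
    moreover have "rho h f < e"
      using H.triangle[OF h(1) g_H f] h(2) gf t \<open>e > 0\<close> by linarith
    ultimately show ?thesis using h(1) by blast
  qed
qed

text \<open>On \<open>[p,m]\<close> the graph is bridged by a segment, whose slope \<open>s\<close>
  is positive because \<open>v p < f m\<close>. The densities of \<open>g\<close> and
  \<open>f\<close> differ only on \<open>[0,m]\<close>, where each has mass \<open>f m\<close>; this
  bounds the distance however wild \<open>v\<close> is.\<close>

lemma H_plus_AC_glue:
  assumes f: "f \<in> H_plus_AC" and v: "v \<in> H_plus_AC" and pm: "0 < p" "p < m" "m < 1" "v p < f m"
  shows "\<exists>g\<in>H_plus_AC. rho g f \<le> 2 * f m \<and> (\<forall>x\<in>{0..p}. g x = v x) \<and> (\<forall>x\<in>{m..1}. g x = f x)"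
proof -
  obtain \<phi> \<nu> where \<phi>: "has_density f \<phi>" and \<nu>: "has_density v \<nu>"
    using f v H_plus_AC_has_density by metis
  note F = has_densityD[OF \<phi>] and V = has_densityD[OF \<nu>]
  define s where "s = (f m - v p) / (m - p)"
  have s: "s > 0" "s * (m - p) = f m - v p" using pm by (auto simp: s_def)
  define \<xi> where "\<xi> x = (if x \<le> p then \<nu> x else if x \<le> m then s else \<phi> x)" for x
  have \<xi>I: "integrable unit_measure \<xi>"
  proof -
    have "integrable unit_measure (\<lambda>x. indicator {..p} x * \<nu> x + indicator {p<..m} x * s + indicator {m<..} x * \<phi> x)"
      using F(2) V(2) by (intro Bochner_Integration.integrable_add indicator_integrable_unit_measure) auto
    then show ?thesis
      by (rule Bochner_Integration.integrable_cong[THEN iffD1, OF refl, rotated -1])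
        (use pm in \<open>auto simp: \<xi>_def indicator_def\<close>)
  qed
  have low: "primitive \<xi> y = v y" if "0 \<le> y" "y \<le> p" for y
  proof -
    have "primitive \<xi> y = primitive \<nu> y"
      unfolding primitive_def using that
      by (intro Bochner_Integration.integral_cong) (auto simp: \<xi>_def indicator_def)
    then show ?thesis using V(5)[of y] that pm by simp
  qed
  have high: "primitive \<xi> y = f y" if "m \<le> y" "y \<le> 1" for y
  proof -
    have "primitive \<xi> m - primitive \<xi> p = (\<integral>x. indicator {p<..m} x * s \<partial>unit_measure)"
      unfolding primitive_diff[OF \<xi>I less_imp_le[OF pm(2)]]
      by (intro Bochner_Integration.integral_cong) (auto simp: \<xi>_def indicator_def)
    also have "\<dots> = (m - p) * s"
    proof -
      have "{p<..m} \<inter> I01 = {p<..m}" using pm by auto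
      then show ?thesis using measure_unit_measure_Ioc[of p m] pm by simp
    qed
    finally have 1: "primitive \<xi> m = f m" using low[of p] s pm by (simp add: mult.commute)
    have "primitive \<xi> y - primitive \<xi> m = primitive \<phi> y - primitive \<phi> m"
      unfolding primitive_diff[OF \<xi>I that(1)] primitive_diff[OF F(2) that(1)]
      using pm by (intro Bochner_Integration.integral_cong) (auto simp: \<xi>_def indicator_def)
    then show ?thesis using 1 F(5)[of y] F(5)[of m] that pm by simp
  qed
  define g where "g = restrict (primitive \<xi>) I01"
  have g: "has_density g \<xi>"
  proof (rule has_densityI)
    show "0 < \<xi> x" for x using F(3) V(3) s by (simp add: \<xi>_def)
    show "g 1 = 1" using high[of 1] H_plus_AC_endpoints(2)[OF f] pm by (simp add: g_def)
  qed (auto simp: g_def \<xi>I)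
  have "rho g f = (\<integral>x. \<bar>\<xi> x - \<phi> x\<bar> \<partial>unit_measure)" by (rule rho_eq[OF g \<phi>])
  also have "\<dots> \<le> (\<integral>x. indicator {..m} x * \<xi> x + indicator {..m} x * \<phi> x \<partial>unit_measure)"
  proof (rule integral_mono)
    show "\<bar>\<xi> x - \<phi> x\<bar> \<le> indicator {..m} x * \<xi> x + indicator {..m} x * \<phi> x" for x
    proof (cases "x \<le> m")
      case True
      then show ?thesis using F(4)[of x] has_densityD(4)[OF g, of x] by (simp add: indicator_def)
    next
      case False
      then show ?thesis using pm by (simp add: \<xi>_def)
    qed
    show "integrable unit_measure (\<lambda>x. indicator {..m} x * \<xi> x + indicator {..m} x * \<phi> x)"
      by (intro Bochner_Integration.integrable_add indicator_integrable_unit_measure \<xi>I F(2)) auto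
  qed (use \<xi>I F(2) in auto)
  also have "\<dots> = primitive \<xi> m + primitive \<phi> m"
    unfolding primitive_def
    by (intro Bochner_Integration.integral_add indicator_integrable_unit_measure \<xi>I F(2)) auto
  also have "\<dots> = 2 * f m" using high[of m] F(5)[of m] pm by simp
  finally show ?thesis
    using has_densityD(1)[OF g] low high pm by (intro bexI[of _ g]) (auto simp: g_def)
qed

section \<open>Dynamics of the generated group\<close>

text \<open>The infimum of the orbit of \<open>y\<close> is fixed by every generator.\<close>

lemma orbit_approaches_zero:
  assumes A: "A \<subseteq> H_plus_AC" and y: "0 < y" "y < 1"
    and nofix: "\<And>c. 0 < c \<Longrightarrow> c \<le> y \<Longrightarrow> \<exists>s\<in>A. s c \<noteq> c" and "e > 0"
  shows "\<exists>u\<in>generate H_plus_AC_group A. u y < e"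
proof -
  define Orb where "Orb = (\<lambda>u. u y) ` generate H_plus_AC_group A"
  have S: "u \<in> H_plus_AC" if "u \<in> generate H_plus_AC_group A" for u
    using G.generate_in_carrier[of A u] A that by simp
  have y01: "y \<in> I01" using y by simp
  have "y \<in> Orb"
    unfolding Orb_def
    by (rule rev_image_eqI[OF generate.one]) (simp add: one_apply[OF y01])
  have O01: "Orb \<subseteq> I01" unfolding Orb_def using S H_plus_AC_in_I01[OF _ y01] by blast
  then have bdd: "bdd_below Orb" by (meson bdd_below_Icc bdd_below_mono)
  define c where "c = Inf Orb"
  have cy: "c \<le> y" unfolding c_def by (rule cInf_lower[OF \<open>y \<in> Orb\<close> bdd])
  have c0: "0 \<le> c" unfolding c_def using \<open>y \<in> Orb\<close> O01 by (intro cInf_greatest) auto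
  have c01: "c \<in> I01" using cy c0 y by simp
  \<comment> \<open>A map pushing the infimum down would also push nearby orbit points below it.
    Stated for any map preserving the orbit, this applies to a generator and to its inverse, and the
    two inequalities make \<open>c\<close> a fixed point.\<close>
  have below: "c \<le> s c" if s: "s \<in> H_plus_AC" "\<And>z. z \<in> Orb \<Longrightarrow> s z \<in> Orb" for s
  proof (rule ccontr)
    assume "\<not> c \<le> s c"
    then have lt: "s c < c" by simp
    have si: "inv\<^bsub>H_plus_AC_group\<^esub> s \<in> H_plus_AC" using G.inv_closed[of s] s(1) by simp
    have "(inv\<^bsub>H_plus_AC_group\<^esub> s) (s c) < (inv\<^bsub>H_plus_AC_group\<^esub> s) c"
      using H_plus_AC_less_iff[OF si H_plus_AC_in_I01[OF s(1) c01] c01] lt by simp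
    then have "c < (inv\<^bsub>H_plus_AC_group\<^esub> s) c" using inv_apply_left[OF s(1) c01] by simp
    then obtain z where z: "z \<in> Orb" "z < (inv\<^bsub>H_plus_AC_group\<^esub> s) c"
      using cInf_less_iff[of Orb] \<open>y \<in> Orb\<close> bdd unfolding c_def by blast
    have "s z < s ((inv\<^bsub>H_plus_AC_group\<^esub> s) c)"
      using H_plus_AC_less_iff[OF s(1) _ H_plus_AC_in_I01[OF si c01]] z O01 by blast
    then have "s z < c" using inv_apply_right[OF s(1) c01] by simp
    moreover have "c \<le> s z" unfolding c_def by (rule cInf_lower[OF s(2)[OF z(1)] bdd])
    ultimately show False by simp
  qed
  have inv: "u z \<in> Orb" if "u \<in> generate H_plus_AC_group A" "z \<in> Orb" for u z
  proof -
    obtain w where w: "w \<in> generate H_plus_AC_group A" "z = w y" using \<open>z \<in> Orb\<close> Orb_def by blast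
    then have "u z = (u \<otimes>\<^bsub>H_plus_AC_group\<^esub> w) y"
      using mult_apply[OF S[OF that(1)] S[OF w(1)] y01] by simp
    then show ?thesis unfolding Orb_def using generate.eng[OF that(1) w(1)] by blast
  qed
  have fix_c: "s c = c" if "s \<in> A" for s
  proof (rule antisym)
    have sH: "s \<in> H_plus_AC" using that A by blast
    then have si: "inv\<^bsub>H_plus_AC_group\<^esub> s \<in> H_plus_AC" using G.inv_closed[of s] by simp
    show "c \<le> s c" by (rule below[OF sH inv[OF generate.incl[OF that]]])
    have "c \<le> (inv\<^bsub>H_plus_AC_group\<^esub> s) c" by (rule below[OF si inv[OF generate.inv[OF that]]])
    then have "s c \<le> s ((inv\<^bsub>H_plus_AC_group\<^esub> s) c)"
      using H_plus_AC_le_iff[OF sH c01 H_plus_AC_in_I01[OF si c01]] by simp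
    then show "s c \<le> c" using inv_apply_right[OF sH c01] by simp
  qed
  have "c = 0" using nofix[of c] fix_c cy c0 by force
  then obtain z where "z \<in> Orb" "z < e"
    using cInf_less_iff[of Orb e] \<open>y \<in> Orb\<close> bdd \<open>e > 0\<close> unfolding c_def by auto
  then show ?thesis unfolding Orb_def by blast
qed

text \<open>The partial products of \<open>u\<close> keep \<open>[a,1]\<close> away from \<open>0\<close>, so \<open>u\<close> does not see a change of \<open>f0\<close> near \<open>0\<close>.\<close>

lemma generate_track:
  assumes f0: "f0 \<in> H_plus_AC" and g: "g \<in> H_plus_AC"
    and u: "u \<in> generate H_plus_AC_group {f0, g}" and a: "0 < a" "a \<le> 1"
  shows "\<exists>m>0. \<forall>f\<in>H_plus_AC. (\<forall>x\<in>{m..1}. f x = f0 x) \<longrightarrow>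
    (\<exists>u'\<in>generate H_plus_AC_group {f, g}. \<forall>x\<in>{a..1}. u' x = u x)"
  using u a
proof (induction arbitrary: a rule: generate.induct)
  case one
  show ?case by (intro exI[of _ 1]) (auto intro!: bexI[OF _ generate.one])
next
  case (incl h)
  then consider "h = f0" | "h = g" by blast
  then show ?case
  proof cases
    case 1
    have "\<exists>u'\<in>generate H_plus_AC_group {f, g}. \<forall>x\<in>{a..1}. u' x = h x"
      if "\<forall>x\<in>{a..1}. f x = f0 x" for f
      using 1 that generate.incl[of f "{f, g}" H_plus_AC_group] by (intro bexI[of _ f]) auto
    then show ?thesis using incl(2) by (intro exI[of _ a]) blast
  next
    case 2
    then show ?thesis by (intro exI[of _ 1]) (auto intro!: bexI[OF _ generate.incl])
  qed
next
  case (inv h)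
  then consider "h = f0" | "h = g" by blast
  then show ?case
  proof cases
    case 1
    let ?i = "inv\<^bsub>H_plus_AC_group\<^esub> f0"
    have i: "?i \<in> H_plus_AC" using G.inv_closed[of f0] f0 by simp
    have a01: "a \<in> I01" "0 \<in> I01" using inv by auto
    have "?i 0 < ?i a" using H_plus_AC_less_iff[OF i a01(2,1)] inv(2) by simp
    then have pos: "0 < ?i a" using H_plus_AC_endpoints(1)[OF i] by simp
    \<comment> \<open>The inverse of \<open>f0\<close> carries \<open>[a,1]\<close> into
      \<open>[?i a,1]\<close>, so agreement of \<open>f\<close> with \<open>f0\<close> there
      determines the inverse of \<open>f\<close> on \<open>[a,1]\<close>.\<close>
    have "(inv\<^bsub>H_plus_AC_group\<^esub> f) x = ?i x"
      if f: "f \<in> H_plus_AC" "\<forall>x\<in>{?i a..1}. f x = f0 x" and x: "x \<in> {a..1}" for f x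
    proof -
      have x01: "x \<in> I01" using x inv(2) by auto
      have "?i a \<le> ?i x" using H_plus_AC_le_iff[OF i a01(1) x01] x by simp
      then have "?i x \<in> {?i a..1}" using H_plus_AC_in_I01[OF i x01] by simp
      then have "f (?i x) = x" using f(2) inv_apply_right[OF f0 x01] by simp
      then show ?thesis using inv_apply_left[OF f(1) H_plus_AC_in_I01[OF i x01]] by simp
    qed
    then have "\<exists>u'\<in>generate H_plus_AC_group {f, g}. \<forall>x\<in>{a..1}. u' x = ?i x"
      if "f \<in> H_plus_AC" "\<forall>x\<in>{?i a..1}. f x = f0 x" for f
      using that generate.inv[of f "{f, g}" H_plus_AC_group]
      by (intro bexI[of _ "inv\<^bsub>H_plus_AC_group\<^esub> f"]) auto
    then show ?thesis unfolding 1 using pos by (intro exI[of _ "?i a"]) blast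
  next
    case 2
    then show ?thesis by (intro exI[of _ 1]) (auto intro!: bexI[OF _ generate.inv])
  qed
next
  case (eng h1 h2)
  have gen: "h \<in> H_plus_AC" if "h \<in> generate H_plus_AC_group {f, g}" "f \<in> H_plus_AC" for f h
    using G.generate_in_carrier[of "{f, g}" h] that g by auto
  have h: "h1 \<in> H_plus_AC" "h2 \<in> H_plus_AC" using eng(1,2) gen f0 by auto
  have a01: "a \<in> I01" "0 \<in> I01" using eng by auto
  have "h2 0 < h2 a" using H_plus_AC_less_iff[OF h(2) a01(2,1)] eng(5) by simp
  then have pos: "0 < h2 a" "h2 a \<le> 1"
    using H_plus_AC_endpoints(1)[OF h(2)] H_plus_AC_in_I01[OF h(2) a01(1)] by auto
  \<comment> \<open>\<open>h2\<close> acts first and carries \<open>[a,1]\<close> into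
    \<open>[h2 a,1]\<close>, so the hypothesis for \<open>h1\<close> is needed with the cutoff
    \<open>h2 a\<close>; this is why \<open>a\<close> varies in the induction.\<close>
  obtain m1 where m1: "m1 > 0" "\<forall>f\<in>H_plus_AC. (\<forall>x\<in>{m1..1}. f x = f0 x) \<longrightarrow>
    (\<exists>u'\<in>generate H_plus_AC_group {f, g}. \<forall>x\<in>{h2 a..1}. u' x = h1 x)"
    using eng(3)[OF pos] by blast
  obtain m2 where m2: "m2 > 0" "\<forall>f\<in>H_plus_AC. (\<forall>x\<in>{m2..1}. f x = f0 x) \<longrightarrow>
    (\<exists>u'\<in>generate H_plus_AC_group {f, g}. \<forall>x\<in>{a..1}. u' x = h2 x)"
    using eng(4)[OF eng(5,6)] by blast
  have "\<exists>u'\<in>generate H_plus_AC_group {f, g}. \<forall>x\<in>{a..1}. u' x = (h1 \<otimes>\<^bsub>H_plus_AC_group\<^esub> h2) x"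
    if f: "f \<in> H_plus_AC" "\<forall>x\<in>{min m1 m2..1}. f x = f0 x" for f
  proof -
    have ff: "\<forall>x\<in>{m1..1}. f x = f0 x" "\<forall>x\<in>{m2..1}. f x = f0 x" using f(2) by auto
    obtain u1 where u1: "u1 \<in> generate H_plus_AC_group {f, g}" "\<forall>x\<in>{h2 a..1}. u1 x = h1 x"
      using m1(2)[THEN bspec, OF f(1)] ff by blast
    obtain u2 where u2: "u2 \<in> generate H_plus_AC_group {f, g}" "\<forall>x\<in>{a..1}. u2 x = h2 x"
      using m2(2)[THEN bspec, OF f(1)] ff by blast
    have "(u1 \<otimes>\<^bsub>H_plus_AC_group\<^esub> u2) x = (h1 \<otimes>\<^bsub>H_plus_AC_group\<^esub> h2) x" if x: "x \<in> {a..1}" for x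
    proof -
      have x01: "x \<in> I01" using x eng(5) by auto
      have "h2 a \<le> h2 x" using H_plus_AC_le_iff[OF h(2) a01(1) x01] x by simp
      then have "h2 x \<in> {h2 a..1}" using H_plus_AC_in_I01[OF h(2) x01] by simp
      then show ?thesis
        using mult_apply[OF h x01] mult_apply[OF gen[OF u1(1) f(1)] gen[OF u2(1) f(1)] x01] u1(2) u2(2) x
        by simp
    qed
    then show ?thesis using generate.eng[OF u1(1) u2(1)] by blast
  qed
  then show ?case using m1(1) m2(1) by (intro exI[of _ "min m1 m2"]) auto
qed

section \<open>Approximating a prescribed element\<close>

text \<open>Agreement on an interval forces equal derivatives inside it. Off the interval each
  density contributes just its mass there, \<open>h a\<close> on the left and \<open>1 - h b\<close>
  on the right, the same for \<open>w\<close> and \<open>h\<close> since they agree at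
  \<open>a\<close> and \<open>b\<close>.\<close>

lemma rho_le_if_eq_on:
  assumes w: "w \<in> H_plus_AC" and h: "h \<in> H_plus_AC" and ab: "0 < a" "a < b" "b < 1"
    and eq: "\<And>x. x \<in> {a..b} \<Longrightarrow> w x = h x"
  shows "rho w h \<le> 2 * (h a + 1 - h b)"
proof -
  obtain \<omega> \<eta> where \<omega>: "has_density w \<omega>" and \<eta>: "has_density h \<eta>"
    using w h H_plus_AC_has_density by metis
  note W = has_densityD[OF \<omega>] and H = has_densityD[OF \<eta>]
  define B where "B = {..a} \<union> {b<..}"
  have B: "primitive \<phi> a + (primitive \<phi> 1 - primitive \<phi> b) = (\<integral>x. indicator B x * \<phi> x \<partial>unit_measure)"
    if "integrable unit_measure \<phi>" for \<phi>
  proof -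
    have "primitive \<phi> a + (primitive \<phi> 1 - primitive \<phi> b) =
      (\<integral>x. indicator {..a} x * \<phi> x + indicator {b<..1} x * \<phi> x \<partial>unit_measure)"
      unfolding primitive_diff[OF that less_imp_le[OF ab(3)]] unfolding primitive_def
      by (intro Bochner_Integration.integral_add[symmetric] indicator_integrable_unit_measure that) auto
    also have "\<dots> = (\<integral>x. indicator B x * \<phi> x \<partial>unit_measure)"
      using ab by (intro Bochner_Integration.integral_cong) (auto simp: B_def indicator_def)
    finally show ?thesis .
  qed
  have Bs: "B \<in> sets borel" by (simp add: B_def)
  \<comment> \<open>The point \<open>b\<close> lies neither in \<open>B\<close> nor in the open
    interval where the derivatives agree.\<close>
  have "AE x in unit_measure. x \<notin> {b}"
    by (rule negligible_imp_AE_unit_measure) simp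
  with deriv_eq_density[OF \<omega>] deriv_eq_density[OF \<eta>]
  have AE: "AE x in unit_measure. \<bar>\<omega> x - \<eta> x\<bar> \<le> indicator B x * (\<omega> x + \<eta> x)"
  proof eventually_elim
    case (elim x)
    show ?case
    proof (cases "x \<in> B")
      case True
      then show ?thesis using W(4)[of x] H(4)[of x] by simp
    next
      case False
      then have "x \<in> {a<..<b}" using elim by (auto simp: B_def)
      then have "\<forall>\<^sub>F y in nhds x. w y = h y"
        by (rule eventually_nhds_in_open[OF open_greaterThanLessThan, THEN eventually_mono]) (use eq in auto)
      then have "deriv w x = deriv h x" by (rule deriv_cong_ev) simp
      then show ?thesis using elim False by simp
    qed
  qed
  have "rho w h = (\<integral>x. \<bar>\<omega> x - \<eta> x\<bar> \<partial>unit_measure)" by (rule rho_eq[OF \<omega> \<eta>])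
  also have "\<dots> \<le> (\<integral>x. indicator B x * (\<omega> x + \<eta> x) \<partial>unit_measure)"
    by (rule integral_mono_AE[OF _ indicator_integrable_unit_measure[OF _ Bs] AE]) (use W(2) H(2) in auto)
  also have "\<dots> = (\<integral>x. indicator B x * \<omega> x \<partial>unit_measure) + (\<integral>x. indicator B x * \<eta> x \<partial>unit_measure)"
    unfolding distrib_left
    by (intro Bochner_Integration.integral_add indicator_integrable_unit_measure W(2) H(2) Bs)
  also have "\<dots> = (w a + (1 - w b)) + (h a + (1 - h b))"
    unfolding B[OF W(2), symmetric] B[OF H(2), symmetric]
    using W(5)[of a] W(5)[of b] W(5)[of 1] H(5)[of a] H(5)[of b] H(5)[of 1] ab
      H_plus_AC_endpoints(2)[OF w] H_plus_AC_endpoints(2)[OF h] by simp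
  also have "\<dots> = 2 * (h a + 1 - h b)" using eq[of a] eq[of b] ab by simp
  finally show ?thesis .
qed

text \<open>The order of choices keeps the construction from being circular: \<open>g\<close> and
  \<open>f1\<close>, then \<open>a\<close> and \<open>b\<close>, then \<open>u0\<close> with its
  threshold \<open>m0\<close>, then \<open>m\<close>, then \<open>v\<close>, and only then
  \<open>f\<close>.\<close>

theorem perturb_pair_approximates:
  assumes f0: "f0 \<in> H_plus_AC" and g0: "g0 \<in> H_plus_AC" and h: "h \<in> H_plus_AC" and "e > 0"
  shows "\<exists>f\<in>H_plus_AC. \<exists>g\<in>H_plus_AC. rho f f0 < e \<and> rho g g0 < e \<and>
    (\<exists>w\<in>generate H_plus_AC_group {f, g}. rho w h < e)"
proof -
  obtain g where g: "g \<in> H_plus_AC" "rho g g0 < e" and fin: "finite {x \<in> {0<..<1}. g x = x}"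
    using perturb_finite_fixpoints[OF g0 \<open>e > 0\<close>] by blast
  have sub: "{x \<in> {0<..<1}. g x = x} \<subseteq> {0<..<1}" by auto
  obtain f1 where f1: "f1 \<in> H_plus_AC" "rho f1 f0 < e / 2" "\<forall>x\<in>{x \<in> {0<..<1}. g x = x}. f1 x \<noteq> x"
    using perturb_away_fixpoints[OF f0 fin sub half_gt_zero[OF \<open>e > 0\<close>]] by blast
  \<comment> \<open>The least interior fixed point of \<open>g\<close>; the inserted 1 serves when
    there is none.\<close>
  define d where "d = Min (insert 1 {x \<in> {0<..<1}. g x = x})"
  have d: "0 < d" "d \<le> 1" using fin by (auto simp: d_def)
  have gd: "g c \<noteq> c" if "0 < c" "c < d" for c
  proof
    assume "g c = c"
    then have "c \<in> {x \<in> {0<..<1}. g x = x}" using that d by auto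
    then have "d \<le> c" unfolding d_def by (intro Min_le) (use fin in auto)
    with that show False by simp
  qed
  \<comment> \<open>With \<open>h a = q\<close> and \<open>h b = 1 - q\<close> the final distance is
    at most \<open>4 * q\<close>, below \<open>e\<close>; the bound \<open>1 / 3\<close> ensures
    \<open>q < 1 - q\<close> and hence \<open>a < b\<close>.\<close>
  define q where "q = min (1 / 3) (e / 5)"
  have q: "0 < q" "q \<le> 1 / 3" "q \<le> e / 5" using \<open>e > 0\<close> by (auto simp: q_def)
  have "q \<in> h ` I01" "1 - q \<in> h ` I01" unfolding H_plus_AC_image[OF h] using q by auto
  then obtain a b where ab01: "a \<in> I01" "b \<in> I01" and hab: "h a = q" "h b = 1 - q" by (elim imageE) metis
  have "h 0 < h a" "h a < h b" "h b < h 1" using hab q H_plus_AC_endpoints[OF h] by auto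
  then have ab: "0 < a" "a < b" "b < 1" using H_plus_AC_less_iff[OF h] ab01 by auto
  \<comment> \<open>The interval \<open>[a',b']\<close> contains both \<open>[a,b]\<close> and its
    image under \<open>h\<close>, and \<open>u\<close> has to be controlled on both.\<close>
  define a' b' where "a' = min a (h a)" and "b' = max b (h b)"
  have a': "0 < a'" "a' \<le> a" "a' \<le> h a" "a' \<le> 1" using ab hab q by (auto simp: a'_def)
  have b': "b \<le> b'" "h b \<le> b'" "0 < b'" "b' < 1" "b' \<in> I01" using ab hab q by (auto simp: b'_def)
  have "\<exists>u\<in>generate H_plus_AC_group {f1, g}. u b' < d"
  proof (rule orbit_approaches_zero[OF _ b'(3,4) _ d(1)])
    show "\<exists>s\<in>{f1, g}. s c \<noteq> c" if "0 < c" "c \<le> b'" for c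
      using f1(3) that b' by (cases "g c = c") auto
  qed (use f1(1) g(1) in auto)
  then obtain u0 where u0: "u0 \<in> generate H_plus_AC_group {f1, g}" "u0 b' < d" by blast
  have u0H: "u0 \<in> H_plus_AC" using G.generate_in_carrier[of "{f1, g}" u0] u0 f1(1) g(1) by simp
  obtain m0 where m0: "m0 > 0" "\<forall>f\<in>H_plus_AC. (\<forall>x\<in>{m0..1}. f x = f1 x) \<longrightarrow>
    (\<exists>u'\<in>generate H_plus_AC_group {f, g}. \<forall>x\<in>{a'..1}. u' x = u0 x)"
    using generate_track[OF f1(1) g(1) u0(1) a'(1,4)] by blast
  \<comment> \<open>Gluing at \<open>m\<close> will cost at most \<open>2 * e / 5\<close>, which
    fits with the \<open>e / 2\<close> spent on \<open>f1\<close>; \<open>m \<le> m0\<close>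
    protects \<open>u0\<close> from the change.\<close>
  obtain m where m: "0 < m" "m \<le> m0" "m < 1" "f1 m \<le> e / 5" "0 < f1 m"
  proof -
    define r where "r = min (1 / 2) (e / 5)"
    have r: "0 < r" "r \<le> 1 / 2" "r \<le> e / 5" using \<open>e > 0\<close> by (auto simp: r_def)
    have "r \<in> f1 ` I01" unfolding H_plus_AC_image[OF f1(1)] using r by auto
    then obtain z where z: "z \<in> I01" "f1 z = r" by blast
    then have "f1 0 < f1 z" "f1 z < f1 1" using r H_plus_AC_endpoints[OF f1(1)] by auto
    then have z0: "0 < z" "z < 1" using H_plus_AC_less_iff[OF f1(1)] z(1) by auto
    let ?m = "min z m0"
    have "?m \<in> I01" using z0 m0(1) by auto
    then have "f1 ?m \<le> f1 z" "f1 0 < f1 ?m"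
      using H_plus_AC_le_iff[OF f1(1), of ?m z] H_plus_AC_less_iff[OF f1(1), of 0 ?m] z z0 m0(1) by auto
    then show thesis
      using that[of ?m] z z0 m0(1) r H_plus_AC_endpoints(1)[OF f1(1)] by auto
  qed
  have "u0 0 < u0 b'" using H_plus_AC_less_iff[OF u0H, of 0 b'] b' by simp
  then have "0 < u0 b'" using H_plus_AC_endpoints(1)[OF u0H] by simp
  \<comment> \<open>From a point below \<open>d\<close> the orbit under \<open>g\<close> alone
    descends to 0. The bound by \<open>m\<close> leaves room for the changed part of
    \<open>f\<close>; the bound by \<open>f1 m\<close> becomes the condition for gluing.\<close>
  then have "\<exists>v\<in>generate H_plus_AC_group {g}. v (u0 b') < min m (f1 m)"
    using u0(2) d(2) gd g(1) m by (intro orbit_approaches_zero) auto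
  then obtain v where v: "v \<in> generate H_plus_AC_group {g}" "v (u0 b') < min m (f1 m)" by blast
  have vH: "v \<in> H_plus_AC" using G.generate_in_carrier[of "{g}" v] v(1) g(1) by simp
  define u where "u = v \<otimes>\<^bsub>H_plus_AC_group\<^esub> u0"
  have uH: "u \<in> H_plus_AC" unfolding u_def using G.m_closed[of v u0] vH u0H by simp
  have ub': "u b' < min m (f1 m)" unfolding u_def using mult_apply[OF vH u0H b'(5)] v(2) by simp
  have hb01: "h b \<in> I01" using H_plus_AC_in_I01[OF h ab01(2)] .
  have ub: "u b < m" "u (h b) < f1 m"
    using H_plus_AC_le_iff[OF uH ab01(2) b'(5)] H_plus_AC_le_iff[OF uH hb01 b'(5)] b'(1,2) ub' by auto
  let ?inv = "\<lambda>s. inv\<^bsub>H_plus_AC_group\<^esub> s"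
  define w where "w = u \<otimes>\<^bsub>H_plus_AC_group\<^esub> (h \<otimes>\<^bsub>H_plus_AC_group\<^esub> ?inv u)"
  have iH: "?inv s \<in> H_plus_AC" if "s \<in> H_plus_AC" for s using G.inv_closed[of s] that by simp
  have mH: "s \<otimes>\<^bsub>H_plus_AC_group\<^esub> t \<in> H_plus_AC" if "s \<in> H_plus_AC" "t \<in> H_plus_AC" for s t
    using G.m_closed[of s t] that by simp
  have wH: "w \<in> H_plus_AC" unfolding w_def by (intro mH iH uH h)
  have wu: "w (u x) = u (h x)" if "x \<in> I01" for x
    unfolding w_def
    using mult_apply[OF uH mH[OF h iH[OF uH]] H_plus_AC_in_I01[OF uH that]]
      mult_apply[OF h iH[OF uH] H_plus_AC_in_I01[OF uH that]] inv_apply_left[OF uH that] by simp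
  have "u 0 < u b" using H_plus_AC_less_iff[OF uH, of 0 b] ab by simp
  then have ub0: "0 < u b" using H_plus_AC_endpoints(1)[OF uH] by simp
  \<comment> \<open>Glued with \<open>p = u b\<close>: there the conjugate \<open>w\<close> takes
    the value \<open>u (h b)\<close>, which lies below \<open>f1 m\<close>.\<close>
  obtain f where f: "f \<in> H_plus_AC" "rho f f1 \<le> 2 * f1 m"
    "\<forall>x\<in>{0..u b}. f x = w x" "\<forall>x\<in>{m..1}. f x = f1 x"
    using H_plus_AC_glue[OF f1(1) wH ub0 ub(1) m(3)] wu[OF ab01(2)] ub(2) by auto
  have "\<forall>x\<in>{m0..1}. f x = f1 x" using f(4) m(2) by auto
  then obtain u1 where u1: "u1 \<in> generate H_plus_AC_group {f, g}" "\<forall>x\<in>{a'..1}. u1 x = u0 x"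
    using m0(2) f(1) by blast
  have u1H: "u1 \<in> H_plus_AC" using G.generate_in_carrier[of "{f, g}" u1] u1(1) f(1) g(1) by simp
  have vfg: "v \<in> generate H_plus_AC_group {f, g}" using G.mono_generate[of "{g}" "{f, g}"] v(1) by auto
  define u2 where "u2 = v \<otimes>\<^bsub>H_plus_AC_group\<^esub> u1"
  have u2: "u2 \<in> generate H_plus_AC_group {f, g}" unfolding u2_def by (rule generate.eng[OF vfg u1(1)])
  have u2H: "u2 \<in> H_plus_AC" unfolding u2_def by (rule mH[OF vH u1H])
  \<comment> \<open>\<open>u2\<close> is \<open>u\<close> rebuilt from the new generators:
    \<open>v\<close> involves only \<open>g\<close>, and \<open>u1\<close> follows \<open>u0\<close>
    on \<open>[a',1]\<close>.\<close>
  have u2u: "u2 x = u x" if x: "x \<in> {a'..1}" for x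
  proof -
    have x01: "x \<in> I01" using x a'(1) by auto
    show ?thesis unfolding u2_def u_def
      using mult_apply[OF vH u1H x01] mult_apply[OF vH u0H x01] u1(2) x by simp
  qed
  define W where "W = ?inv u2 \<otimes>\<^bsub>H_plus_AC_group\<^esub> (f \<otimes>\<^bsub>H_plus_AC_group\<^esub> u2)"
  have "?inv u2 \<in> generate H_plus_AC_group {f, g}"
    by (rule G.generate_m_inv_closed[OF _ u2]) (use f(1) g(1) in auto)
  then have W: "W \<in> generate H_plus_AC_group {f, g}"
    unfolding W_def by (rule generate.eng[OF _ generate.eng[OF generate.incl u2]]) simp
  have WH: "W \<in> H_plus_AC" unfolding W_def by (intro mH iH u2H f(1))
  have "W x = h x" if x: "x \<in> {a..b}" for x
  proof -
    have x01: "x \<in> I01" using x ab by auto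
    have hx01: "h x \<in> I01" by (rule H_plus_AC_in_I01[OF h x01])
    have "u x \<le> u b" using H_plus_AC_le_iff[OF uH x01 ab01(2)] x by simp
    moreover have "u x \<in> I01" by (rule H_plus_AC_in_I01[OF uH x01])
    ultimately have "f (u x) = u (h x)" using f(3) wu[OF x01] by simp
    moreover have "u2 x = u x" using x a' ab by (intro u2u) auto
    moreover have "u2 (h x) = u (h x)"
      using H_plus_AC_le_iff[OF h ab01(1) x01] x a' hx01 by (intro u2u) auto
    ultimately have "(f \<otimes>\<^bsub>H_plus_AC_group\<^esub> u2) x = u2 (h x)"
      using mult_apply[OF f(1) u2H x01] by simp
    then show ?thesis
      unfolding W_def using mult_apply[OF iH[OF u2H] mH[OF f(1) u2H] x01] inv_apply_left[OF u2H hx01] by simp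
  qed
  then have "rho W h \<le> 2 * (h a + 1 - h b)" by (rule rho_le_if_eq_on[OF WH h ab])
  then have "rho W h < e" using hab q \<open>e > 0\<close> by simp
  moreover have "rho f f0 < e"
    using H.triangle[OF f(1) f1(1) f0] f(2) f1(2) m(4) \<open>e > 0\<close> by linarith
  ultimately show ?thesis using f(1) g W by blast
qed

section \<open>Generic density\<close>

lemma AC_topology_eq: "AC_topology = H.mtopology"
  by (simp add: AC_topology_def)

lemma topspace_AC_topology [simp]: "topspace AC_topology = H_plus_AC"
  by (simp add: AC_topology_eq)

text \<open>Density is reduced to countably many conditions when \<open>C\<close> is countable:
  targets in \<open>C\<close>, radii \<open>1 / (n + 1)\<close>. Each condition becomes one open set
  of pairs.\<close>

lemma dense_in_AC_topology:
  assumes "A \<subseteq> H_plus_AC" and C: "C \<subseteq> H_plus_AC" "\<And>h e. h \<in> H_plus_AC \<Longrightarrow> e > 0 \<Longrightarrow> \<exists>c\<in>C. rho c h < e"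
  shows "dense_in AC_topology A \<longleftrightarrow> (\<forall>c\<in>C. \<forall>n::nat. \<exists>a\<in>A. rho a c < 1 / real (Suc n))"
proof
  assume D: "dense_in AC_topology A"
  show "\<forall>c\<in>C. \<forall>n::nat. \<exists>a\<in>A. rho a c < 1 / real (Suc n)"
  proof (intro ballI allI)
    fix c n assume "c \<in> C"
    then have "c \<in> H.mtopology closure_of A" using D C(1) by (auto simp: dense_in_def AC_topology_eq)
    then have "\<exists>y\<in>A. y \<in> H.mball c (1 / real (Suc n))"
      unfolding H.metric_closure_of by auto
    then show "\<exists>a\<in>A. rho a c < 1 / real (Suc n)" by (auto simp: H.commute)
  qed
next
  assume R: "\<forall>c\<in>C. \<forall>n::nat. \<exists>a\<in>A. rho a c < 1 / real (Suc n)"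
  have "\<exists>y\<in>A. y \<in> H.mball h r" if h: "h \<in> H_plus_AC" and "r > 0" for h r
  proof -
    obtain c where c: "c \<in> C" "rho c h < r / 2" using C(2)[OF h, of "r / 2"] \<open>r > 0\<close> by auto
    obtain n where "1 / real (Suc n) < r / 2" using nat_approx_posE[of "r / 2"] \<open>r > 0\<close> by auto
    then obtain a where a: "a \<in> A" "rho a c < r / 2" using R c(1) by (meson less_trans)
    have aH: "a \<in> H_plus_AC" and cH: "c \<in> H_plus_AC" using a(1) c(1) assms(1) C(1) by auto
    have "rho a h < r" using H.triangle[OF aH cH h] a(2) c(2) by linarith
    then show ?thesis using a(1) aH h by (auto simp: H.commute)
  qed
  then have "H.mtopology closure_of A = H_plus_AC"
    unfolding H.metric_closure_of using assms(1) by auto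
  then show "dense_in AC_topology A" using assms(1) by (simp add: dense_in_def AC_topology_eq)
qed

definition approx_pairs :: "(real \<Rightarrow> real) \<Rightarrow> real \<Rightarrow> ((real \<Rightarrow> real) \<times> (real \<Rightarrow> real)) set" where
  "approx_pairs h e = {(f, g) \<in> H_plus_AC \<times> H_plus_AC.
    \<exists>u\<in>generate H_plus_AC_group {f, g}. rho u h < e}"

lemma generate_in_H_plus_AC:
  "f \<in> H_plus_AC \<Longrightarrow> g \<in> H_plus_AC \<Longrightarrow> generate H_plus_AC_group {f, g} \<subseteq> H_plus_AC"
  using G.generate_incl[of "{f, g}"] by simp

text \<open>The slack \<open>e - rho u h\<close> absorbs the change of \<open>u\<close> under a
  small perturbation of the generators.\<close>

lemma openin_approx_pairs:
  assumes h: "h \<in> H_plus_AC"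
  shows "openin (prod_topology AC_topology AC_topology) (approx_pairs h e)"
  unfolding openin_prod_topology_alt
proof (intro allI impI)
  fix f0 g0 assume "(f0, g0) \<in> approx_pairs h e"
  then obtain u where fg: "f0 \<in> H_plus_AC" "g0 \<in> H_plus_AC"
    and u: "u \<in> generate H_plus_AC_group {f0, g0}" "rho u h < e"
    by (auto simp: approx_pairs_def)
  have uH: "u \<in> H_plus_AC" using generate_in_H_plus_AC[OF fg] u(1) by blast
  obtain d where d: "d > 0" "\<And>f g. f \<in> H_plus_AC \<Longrightarrow> g \<in> H_plus_AC \<Longrightarrow> rho f f0 < d \<Longrightarrow> rho g g0 < d \<Longrightarrow>
    \<exists>u'\<in>generate H_plus_AC_group {f, g}. rho u' u < e - rho u h"
    using generate_perturb[OF fg u(1), of "e - rho u h"] u(2) by auto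
  have "(f, g) \<in> approx_pairs h e" if f: "f \<in> H.mball f0 d" and g: "g \<in> H.mball g0 d" for f g
  proof -
    have fgH: "f \<in> H_plus_AC" "g \<in> H_plus_AC" "rho f f0 < d" "rho g g0 < d"
      using f g by (auto simp: H.commute)
    obtain u' where u': "u' \<in> generate H_plus_AC_group {f, g}" "rho u' u < e - rho u h"
      using d(2)[OF fgH] by blast
    have "u' \<in> H_plus_AC" using generate_in_H_plus_AC[OF fgH(1,2)] u'(1) by blast
    then have "rho u' h < e" using H.triangle[OF _ uH h, of u'] u'(2) by linarith
    then show ?thesis using fgH u'(1) by (auto simp: approx_pairs_def)
  qed
  then show "\<exists>U V. openin AC_topology U \<and> openin AC_topology V \<and> f0 \<in> U \<and> g0 \<in> V \<and> U \<times> V \<subseteq> approx_pairs h e"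
    using fg d(1)
    by (intro exI[of _ "H.mball f0 d"] exI[of _ "H.mball g0 d"]) (auto simp: AC_topology_eq)
qed

lemma nowhere_dense_approx_pairs:
  assumes h: "h \<in> H_plus_AC" and "e > 0"
  shows "nowhere_dense_in (prod_topology AC_topology AC_topology) (H_plus_AC \<times> H_plus_AC - approx_pairs h e)"
    (is "nowhere_dense_in ?X ?N")
proof -
  have "closedin ?X (topspace ?X - approx_pairs h e)"
    by (rule closedin_diff[OF closedin_topspace openin_approx_pairs[OF h]])
  then have "?X closure_of ?N = ?N" by (simp add: closure_of_closedin)
  moreover have "?X interior_of ?N = {}"
  proof (rule ccontr)
    assume "?X interior_of ?N \<noteq> {}"
    then obtain f0 g0 where fg0: "(f0, g0) \<in> ?X interior_of ?N" by auto
    have "openin ?X (?X interior_of ?N)" by (rule openin_interior_of)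
    from this[unfolded openin_prod_topology_alt, rule_format, OF fg0]
    obtain U V where UV: "openin AC_topology U" "openin AC_topology V" "f0 \<in> U" "g0 \<in> V"
      "U \<times> V \<subseteq> ?X interior_of ?N"
      by (elim exE conjE)
    have sub: "U \<times> V \<subseteq> ?N" by (rule order_trans[OF UV(5) interior_of_subset])
    have fg: "f0 \<in> H_plus_AC" "g0 \<in> H_plus_AC"
      using openin_subset[OF UV(1)] openin_subset[OF UV(2)] UV(3,4) by auto
    obtain r where r: "r > 0" "H.mball f0 r \<subseteq> U"
      using UV(1,3) unfolding AC_topology_eq H.openin_mtopology by blast
    obtain s where s: "s > 0" "H.mball g0 s \<subseteq> V"
      using UV(2,4) unfolding AC_topology_eq H.openin_mtopology by blast
    \<comment> \<open>A single tolerance keeps the perturbed pair inside the box and makes the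
      approximation of \<open>h\<close> good enough.\<close>
    have "min (min r s) e > 0" using r s \<open>e > 0\<close> by simp
    then obtain f g where f: "f \<in> H_plus_AC" "g \<in> H_plus_AC" "rho f f0 < min (min r s) e" "rho g g0 < min (min r s) e"
      and w: "\<exists>w\<in>generate H_plus_AC_group {f, g}. rho w h < min (min r s) e"
      using perturb_pair_approximates[OF fg h] by blast
    have "f \<in> H.mball f0 r" "g \<in> H.mball g0 s" using f fg by (auto simp: H.commute)
    then have "(f, g) \<in> ?N" using r s sub by blast
    moreover have "(f, g) \<in> approx_pairs h e" using f w by (auto simp: approx_pairs_def)
    ultimately show False by blast
  qed
  ultimately show ?thesis by (auto simp: nowhere_dense_in_def)
qed

theorem theorem6:
  shows "comeagre_in (prod_topology AC_topology AC_topology) \<Omega>\<^sub>2"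
proof -
  let ?X = "prod_topology AC_topology AC_topology"
  obtain C where C: "C \<subseteq> H_plus_AC" "countable C"
    "\<And>h e. h \<in> H_plus_AC \<Longrightarrow> e > 0 \<Longrightarrow> \<exists>c\<in>C. rho c h < e"
    using H_plus_AC_separable by blast
  define \<N> where "\<N> = (\<lambda>(c, n). H_plus_AC \<times> H_plus_AC - approx_pairs c (1 / real (Suc n))) ` (C \<times> (UNIV :: nat set))"
  have "countable \<N>" unfolding \<N>_def using C(2) by (intro countable_image countable_SIGMA) auto
  moreover have "nowhere_dense_in ?X N" if "N \<in> \<N>" for N
    using that C(1) unfolding \<N>_def by (auto intro!: nowhere_dense_approx_pairs)
  moreover have "topspace ?X - \<Omega>\<^sub>2 = \<Union>\<N>"
  proof -
    have "(f, g) \<in> \<Omega>\<^sub>2 \<longleftrightarrow> (\<forall>c\<in>C. \<forall>n. (f, g) \<in> approx_pairs c (1 / real (Suc n)))"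
      if fg: "f \<in> H_plus_AC" "g \<in> H_plus_AC" for f g
      using fg dense_in_AC_topology[OF generate_in_H_plus_AC[OF fg] C(1,3)]
      by (simp add: \<Omega>\<^sub>2_def approx_pairs_def)
    then show ?thesis unfolding \<N>_def by fastforce
  qed
  ultimately have "meagre_in ?X (topspace ?X - \<Omega>\<^sub>2)" unfolding meagre_in_def by blast
  moreover have "\<Omega>\<^sub>2 \<subseteq> topspace ?X" by (auto simp: \<Omega>\<^sub>2_def)
  ultimately show ?thesis by (simp add: comeagre_in_def)
qed

end
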